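(* Let $(M,D)$ be a Dirac manifold and $N$ an embedded submanifold of $M$. Then $N$ has a normal bundle $\nu N$ which is a coisotropic submanifold of $(TM,D^{tg})$ if and only if there is a normal bundle $\nu N$ of $N$ such that, around the points of $N$, with respect to local coordinates $(x^u,y^a)$ of $M$ adapted to $(N,\nu N)$, $D$ has local bases $(B_u,\epsilon_u),(C_a,\tau_a)$, $$B_u=b_u^s\frac{\partial}{\partial x^s}+b'^{h}_u\frac{\partial}{\partial y^h},\quad C_a=c_a^s\frac{\partial}{\partial x^s}+c'^{h}_a\frac{\partial}{\partial y^h},\quad \epsilon_u=e_{us}dx^s+e'_{uh}dy^h,\quad \tau_a=t_{as}dx^s+t'_{ah}dy^h,$$ such that the system of equations in the unknowns $(\lambda^u,\nu^a,\mu^u,\xi^a)$ $$\text{(T)}\quad (\mu^u b_u^s+\xi^a c_a^s)_{y=0}=0,\quad (\lambda^u b'^{h}_u+\nu^a c'^{h}_a)_{y=0}=0,\quad \Big(\lambda^u\frac{\partial b_u^s}{\partial y^h}+\nu^a\frac{\partial c_a^s}{\partial y^h}\Big)_{y=0}=0$$ is a consequence of the system of equations $$\text{(A)}\quad (\mu^u e_{us}+\xi^a t_{as})_{y=0}=0,\quad (\lambda^u e'_{uh}+\nu^a t'_{ah})_{y=0}=0,\quad \Big(\lambda^u\frac{\partial e_{us}}{\partial y^h}+\nu^a\frac{\partial t_{as}}{\partial y^h}\Big)_{y=0}=0$$ (where the free indices $s$ and $h$ take all their values in each system). Similarly, $N$ has a normal bundle $\nu N$ which is an isotropic submanifold of $(TM,D^{tg})$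 if and only if there is a normal bundle $\nu N$ of $N$ such that, around the points of $N$, in coordinates $(x^u,y^a)$ adapted to $(N,\nu N)$, $D$ has local bases $(B_u,\epsilon_u),(C_a,\tau_a)$ with $$B_u=b_u^s\frac{\partial}{\partial x^s}+b'^{h}_u\frac{\partial}{\partial y^h},\quad C_a=c_a^s\frac{\partial}{\partial x^s}+c'^{h}_a\frac{\partial}{\partial y^h},\quad \epsilon_u=e_{us}dx^s+e'_{uh}dy^h,\quad \tau_a=t_{as}dx^s+t'_{ah}dy^h,$$ such that the equations (A) are a consequence of the equations (T).
   Context: Everything is $C^\infty$, and the Einstein summation convention is used. For a manifold $M$ put $E(M)=TM\oplus T^*M$, with the metric $g((X,\alpha),(Y,\beta))=\frac12(\alpha(Y)+\beta(X))$ and the 2-form $\omega((X,\alpha),(Y,\beta))=\frac12(\alpha(Y)-\beta(X))$. A Dirac structure on $M$ is a maximal $g$-isotropic subbundle $D\subseteq E(M)$ such that $\Gamma D$ is closed under the Courant bracket $[(X,\alpha),(Y,\beta)]=([X,Y],L_X\beta-L_Y\alpha+d(\omega((X,\alpha),(Y,\beta))))$; $(M,D)$ is then called a Dirac manifold. Lifts: let $z^i$ be local coordinates on $M$, and $w^i$ the natural fiber coordinates on $TM$, $\pi:TM\to M$. For $X=\xi^i\frac{\partial}{\partial z^i}$: $X^V=\xi^i\frac{\partial}{\partial w^i}$ and $X^C=\xi^i\frac{\partial}{\partial z^i}+w^i\frac{\partial \xi^j}{\partial z^i}\frac{\partial}{\partial w^j}$. For $\alpha=\alpha_i dz^i$: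 $\alpha^V=\pi^*\alpha$ and $\alpha^C=w^j\frac{\partial\alpha_i}{\partial z^j}dz^i+\alpha_i dw^i$. The tangent Dirac structure $D^{tg}$ is the Dirac structure on the manifold $TM$ whose sheaf of germs of sections is spanned, over the germs of smooth functions on $TM$, by the pairs $(X^C,\alpha^C)$ and $(X^V,\alpha^V)$, with $(X,\alpha)$ ranging over the local sections of $D$. A normal bundle of $N$ is a vector subbundle $\nu N$ of $T_NM=TM|_N$ with $T_NM=\nu N\oplus TN$; its total space is regarded as a submanifold of the manifold $TM$. A submanifold $Q$ of a Dirac manifold $(W,D')$ is coisotropic if the conditions $\alpha\in \mathrm{ann}\,TQ$ and $(X,\alpha)\in D'$ imply $X\in TQ$; it is isotropic if the conditions $X\in TQ$ and $(X,\alpha)\in D'$ imply $\alpha\in\mathrm{ann}\,TQ$ ($\mathrm{ann}$ denotes the annihilator space, at points of $Q$). Local coordinates $(x^u,y^a)$ of $M$ around a point of $N$ ($u=1,\dots,\dim N$; $a=1,\dots,\mathrm{codim}\,N$) are adapted to $(N,\nu N)$ if they come from a tubular neighborhood of $N$ with fibers tangent to $\nu N$: $x^u$ are coordinates along $N$, $y^a$ are coordinates along the tubular fibers, $N$ has the local equations $y^a=0$, and along $N$ ($y=0$) $TN=\mathrm{span}\{\partial/\partial x^u\}$ and $\nu N=\mathrm{span}\{\partial/\partial y^a\}$. The indices $u,s$ range over $1,\dots,\dim N$ and the indices $a,h$ over $1,\dots,\mathrm{codim}\,N$. A local basis of $D$ consists of $\dim M$ independent local sections.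
   Formalization: "D has local bases such that" one system implies the other is read as: adapted coordinates and local bases exist around each point of N, and the implication holds for all of them; with only some basis the "if" parts are false. Also dim M ≥ 1. *)

theory Defs
  imports "HOL-Analysis.Analysis"
begin

section \<open>Smooth maps between normed spaces\<close>

text \<open>Used for open \<open>S\<close> and finite-dimensional domains only.\<close>

primrec Ck_on :: "nat \<Rightarrow> 'a::real_normed_vector set \<Rightarrow> ('a \<Rightarrow> 'b::real_normed_vector) \<Rightarrow> bool" where
  "Ck_on 0 S f \<longleftrightarrow> continuous_on S f"
| "Ck_on (Suc k) S f \<longleftrightarrow>
     (\<forall>x\<in>S. f differentiable (at x)) \<and> (\<forall>v. Ck_on k S (\<lambda>x. frechet_derivative f (at x) v))"

definition smooth_on :: "'a::real_normed_vector set \<Rightarrow> ('a \<Rightarrow> 'b::real_normed_vector) \<Rightarrow> bool" where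
  "smooth_on S f \<longleftrightarrow> (\<forall>k. Ck_on k S f)"


section \<open>Manifolds\<close>

text \<open>
  A manifold is given by an atlas. A chart is a pair of its domain and a map that is relevant
  on the domain only. The model space is an arbitrary Euclidean space, whose \<open>Basis\<close> serves as
  the set of coordinate indices: the coordinate \<open>z\<^sup>i\<close> of the chart \<open>c\<close> is \<open>snd c p \<bullet> i\<close>
  for \<open>i \<in> Basis\<close>.
\<close>

type_synonym ('p, 'e) chart = "'p set \<times> ('p \<Rightarrow> 'e)"

definition chart_inv :: "('p, 'e) chart \<Rightarrow> 'e \<Rightarrow> 'p" where
  "chart_inv c = inv_into (fst c) (snd c)"

definition is_chart :: "('p, 'e::euclidean_space) chart \<Rightarrow> bool" where
  "is_chart c \<longleftrightarrow> inj_on (snd c) (fst c) \<and> open (snd c ` fst c)"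

definition compatible :: "('p, 'e::euclidean_space) chart \<Rightarrow> ('p, 'e) chart \<Rightarrow> bool" where
  "compatible c d \<longleftrightarrow> open (snd c ` (fst c \<inter> fst d)) \<and>
     smooth_on (snd c ` (fst c \<inter> fst d)) (snd d \<circ> chart_inv c)"

definition smooth_atlas :: "('p, 'e::euclidean_space) chart set \<Rightarrow> bool" where
  "smooth_atlas A \<longleftrightarrow> (\<forall>c\<in>A. is_chart c) \<and> (\<forall>c\<in>A. \<forall>d\<in>A. compatible c d)"

definition points :: "('p, 'e) chart set \<Rightarrow> 'p set" where
  "points A = (\<Union>c\<in>A. fst c)"

text \<open>The maximal atlas.\<close>

definition charts :: "('p, 'e::euclidean_space) chart set \<Rightarrow> ('p, 'e) chart set" where
  "charts A = {c. is_chart c \<and> fst c \<subseteq> points A \<and> (\<forall>d\<in>A. compatible c d \<and> compatible d c)}"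

definition manifold_topology :: "('p, 'e::euclidean_space) chart set \<Rightarrow> 'p topology" where
  "manifold_topology A =
     topology (\<lambda>W. W \<subseteq> points A \<and> (\<forall>c\<in>A. open (snd c ` (fst c \<inter> W))))"

lemma openin_manifold_topology:
  assumes "smooth_atlas A"
  shows "openin (manifold_topology A) W \<longleftrightarrow>
           W \<subseteq> points A \<and> (\<forall>c\<in>A. open (snd c ` (fst c \<inter> W)))"
proof -
  have "istopology (\<lambda>W. W \<subseteq> points A \<and> (\<forall>c\<in>A. open (snd c ` (fst c \<inter> W))))"
    unfolding istopology_def
  proof (intro conjI allI impI ballI)
    fix S T c
    assume S: "S \<subseteq> points A \<and> (\<forall>c\<in>A. open (snd c ` (fst c \<inter> S)))"
      and T: "T \<subseteq> points A \<and> (\<forall>c\<in>A. open (snd c ` (fst c \<inter> T)))" and c: "c \<in> A"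
    have "inj_on (snd c) (fst c)"
      using assms c by (auto simp: smooth_atlas_def is_chart_def)
    then have "snd c ` (fst c \<inter> (S \<inter> T)) = snd c ` (fst c \<inter> S) \<inter> snd c ` (fst c \<inter> T)"
      by (auto simp: inj_on_def)
    then show "open (snd c ` (fst c \<inter> (S \<inter> T)))"
      using S T c by auto
  next
    fix K c
    assume "\<forall>W\<in>K. W \<subseteq> points A \<and> (\<forall>c\<in>A. open (snd c ` (fst c \<inter> W)))" and "c \<in> A"
    moreover have "snd c ` (fst c \<inter> \<Union>K) = (\<Union>W\<in>K. snd c ` (fst c \<inter> W))"
      by auto
    ultimately show "open (snd c ` (fst c \<inter> \<Union>K))"
      by auto
  qed blast+
  then show ?thesis
    by (simp add: manifold_topology_def)
qed

definition second_countable :: "'p topology \<Rightarrow> bool" where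
  "second_countable T \<longleftrightarrow> (\<exists>\<B>. countable \<B> \<and> (\<forall>W\<in>\<B>. openin T W) \<and>
     (\<forall>U x. openin T U \<and> x \<in> U \<longrightarrow> (\<exists>W\<in>\<B>. x \<in> W \<and> W \<subseteq> U)))"

definition smooth_manifold :: "('p, 'e::euclidean_space) chart set \<Rightarrow> bool" where
  "smooth_manifold A \<longleftrightarrow> smooth_atlas A \<and>
     Hausdorff_space (manifold_topology A) \<and> second_countable (manifold_topology A)"


section \<open>Tangent vectors, covectors and fields\<close>

text \<open>
  The tangent space at \<open>p\<close> is the model space itself: a vector at \<open>p\<close> is encoded by its
  components in the chart \<open>chart_at A p\<close>, chosen once and for all. Its components in another
  chart \<open>c\<close> are obtained by the derivative of the change of coordinates. Covectors at \<open>p\<close>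
  are the linear forms on the tangent space at \<open>p\<close>.
\<close>

definition chart_at :: "('p, 'e) chart set \<Rightarrow> 'p \<Rightarrow> ('p, 'e) chart" where
  "chart_at A p = (SOME c. c \<in> A \<and> p \<in> fst c)"

definition vec_coord ::
  "('p, 'e::euclidean_space) chart set \<Rightarrow> ('p, 'e) chart \<Rightarrow> 'p \<Rightarrow> 'e \<Rightarrow> 'e" where
  "vec_coord A c p =
     frechet_derivative (snd c \<circ> chart_inv (chart_at A p)) (at (snd (chart_at A p) p))"

text \<open>
  Conversely, \<open>vec_of_coord A c p w\<close> is the vector at \<open>p\<close> with components \<open>w\<close> in the chart
  \<open>c\<close>; for \<open>i \<in> Basis\<close>, \<open>vec_of_coord A c p i\<close> is \<open>\<partial>/\<partial>z\<^sup>i\<close> at \<open>p\<close>.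
\<close>

definition vec_of_coord ::
  "('p, 'e::euclidean_space) chart set \<Rightarrow> ('p, 'e) chart \<Rightarrow> 'p \<Rightarrow> 'e \<Rightarrow> 'e" where
  "vec_of_coord A c p =
     frechet_derivative (snd (chart_at A p) \<circ> chart_inv c) (at (snd c p))"

definition cov_coord ::
  "('p, 'e::euclidean_space) chart set \<Rightarrow> ('p, 'e) chart \<Rightarrow> 'p \<Rightarrow> ('e \<Rightarrow>\<^sub>L real) \<Rightarrow> ('e \<Rightarrow>\<^sub>L real)" where
  "cov_coord A c p \<alpha> = Blinfun (\<lambda>w. blinfun_apply \<alpha> (vec_of_coord A c p w))"

definition cov_of_coord ::
  "('p, 'e::euclidean_space) chart set \<Rightarrow> ('p, 'e) chart \<Rightarrow> 'p \<Rightarrow> ('e \<Rightarrow>\<^sub>L real) \<Rightarrow> ('e \<Rightarrow>\<^sub>L real)" where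
  "cov_of_coord A c p a = Blinfun (\<lambda>v. blinfun_apply a (vec_coord A c p v))"

text \<open>
  Components of a vector field and of a 1-form in the chart \<open>c\<close>, as functions of the coordinates:
  \<open>vf_rep A c X z \<bullet> i\<close> is \<open>\<xi>\<^sup>i(z)\<close>, and \<open>form_rep A c \<alpha> z i\<close> is \<open>\<alpha>\<^sub>i(z)\<close>.
\<close>

definition vf_rep ::
  "('p, 'e::euclidean_space) chart set \<Rightarrow> ('p, 'e) chart \<Rightarrow> ('p \<Rightarrow> 'e) \<Rightarrow> 'e \<Rightarrow> 'e" where
  "vf_rep A c X z = vec_coord A c (chart_inv c z) (X (chart_inv c z))"

definition form_rep ::
  "('p, 'e::euclidean_space) chart set \<Rightarrow> ('p, 'e) chart \<Rightarrow> ('p \<Rightarrow> 'e \<Rightarrow>\<^sub>L real) \<Rightarrow> 'e \<Rightarrow> ('e \<Rightarrow>\<^sub>L real)" where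
  "form_rep A c \<alpha> z = cov_coord A c (chart_inv c z) (\<alpha> (chart_inv c z))"

definition smooth_vf :: "('p, 'e::euclidean_space) chart set \<Rightarrow> 'p set \<Rightarrow> ('p \<Rightarrow> 'e) \<Rightarrow> bool" where
  "smooth_vf A V X \<longleftrightarrow> (\<forall>c\<in>A. smooth_on (snd c ` (fst c \<inter> V)) (vf_rep A c X))"

definition smooth_form ::
  "('p, 'e::euclidean_space) chart set \<Rightarrow> 'p set \<Rightarrow> ('p \<Rightarrow> 'e \<Rightarrow>\<^sub>L real) \<Rightarrow> bool" where
  "smooth_form A V \<alpha> \<longleftrightarrow> (\<forall>c\<in>A. smooth_on (snd c ` (fst c \<inter> V)) (form_rep A c \<alpha>))"

text \<open>
  The Lie bracket, the Lie derivative and the differential are computed at \<open>p\<close> in the chart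
  \<open>chart_at A p\<close>, where a vector at \<open>p\<close> coincides with its components.
\<close>

definition lie_bracket ::
  "('p, 'e::euclidean_space) chart set \<Rightarrow> ('p \<Rightarrow> 'e) \<Rightarrow> ('p \<Rightarrow> 'e) \<Rightarrow> 'p \<Rightarrow> 'e" where
  "lie_bracket A X Y p =
     (let c = chart_at A p; z = snd c p; \<xi> = vf_rep A c X; \<eta> = vf_rep A c Y
      in frechet_derivative \<eta> (at z) (\<xi> z) - frechet_derivative \<xi> (at z) (\<eta> z))"

definition lie_deriv_form ::
  "('p, 'e::euclidean_space) chart set \<Rightarrow> ('p \<Rightarrow> 'e) \<Rightarrow> ('p \<Rightarrow> 'e \<Rightarrow>\<^sub>L real) \<Rightarrow> 'p \<Rightarrow> ('e \<Rightarrow>\<^sub>L real)" where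
  "lie_deriv_form A X \<beta> p =
     (let c = chart_at A p; z = snd c p; \<xi> = vf_rep A c X; b = form_rep A c \<beta>
      in Blinfun (\<lambda>v. blinfun_apply (frechet_derivative b (at z) (\<xi> z)) v
                     + blinfun_apply (b z) (frechet_derivative \<xi> (at z) v)))"

definition differential ::
  "('p, 'e::euclidean_space) chart set \<Rightarrow> ('p \<Rightarrow> real) \<Rightarrow> 'p \<Rightarrow> ('e \<Rightarrow>\<^sub>L real)" where
  "differential A f p =
     (let c = chart_at A p in Blinfun (frechet_derivative (f \<circ> chart_inv c) (at (snd c p))))"


section \<open>Dirac structures\<close>

type_synonym 'e big_fibre = "'e \<times> ('e \<Rightarrow>\<^sub>L real)"

definition g_pairing :: "'e::euclidean_space big_fibre \<Rightarrow> 'e big_fibre \<Rightarrow> real" where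
  "g_pairing a b = (blinfun_apply (snd a) (fst b) + blinfun_apply (snd b) (fst a)) / 2"

definition omega_pairing :: "'e::euclidean_space big_fibre \<Rightarrow> 'e big_fibre \<Rightarrow> real" where
  "omega_pairing a b = (blinfun_apply (snd a) (fst b) - blinfun_apply (snd b) (fst a)) / 2"

definition g_isotropic :: "'e::euclidean_space big_fibre set \<Rightarrow> bool" where
  "g_isotropic L \<longleftrightarrow> subspace L \<and> (\<forall>a\<in>L. \<forall>b\<in>L. g_pairing a b = 0)"

definition maximal_g_isotropic :: "'e::euclidean_space big_fibre set \<Rightarrow> bool" where
  "maximal_g_isotropic L \<longleftrightarrow> g_isotropic L \<and> (\<forall>L'. g_isotropic L' \<and> L \<subseteq> L' \<longrightarrow> L' = L)"

definition basis_family :: "'i set \<Rightarrow> ('i \<Rightarrow> 'v::real_vector) \<Rightarrow> 'v set \<Rightarrow> bool" where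
  "basis_family J f L \<longleftrightarrow> inj_on f J \<and> independent (f ` J) \<and> span (f ` J) = L"

text \<open>Smooth sections over \<open>V\<close> of the family \<open>D\<close> of fibres \<open>D p \<subseteq> T\<^sub>pM \<oplus> T\<^sub>p\<^sup>*M\<close>.\<close>

definition is_section ::
  "('p, 'e::euclidean_space) chart set \<Rightarrow> ('p \<Rightarrow> 'e big_fibre set) \<Rightarrow> 'p set \<Rightarrow> ('p \<Rightarrow> 'e big_fibre) \<Rightarrow> bool" where
  "is_section A D V s \<longleftrightarrow> smooth_vf A V (\<lambda>p. fst (s p)) \<and> smooth_form A V (\<lambda>p. snd (s p)) \<and>
     (\<forall>p\<in>V. s p \<in> D p)"

definition local_frame ::
  "('p, 'e::euclidean_space) chart set \<Rightarrow> ('p \<Rightarrow> 'e big_fibre set) \<Rightarrow> 'p set \<Rightarrow>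
     'i set \<Rightarrow> ('i \<Rightarrow> 'p \<Rightarrow> 'e big_fibre) \<Rightarrow> bool" where
  "local_frame A D V J s \<longleftrightarrow> (\<forall>i\<in>J. is_section A D V (s i)) \<and>
     (\<forall>p\<in>V. basis_family J (\<lambda>i. s i p) (D p))"

definition vector_subbundle ::
  "('p, 'e::euclidean_space) chart set \<Rightarrow> ('p \<Rightarrow> 'e big_fibre set) \<Rightarrow> bool" where
  "vector_subbundle A D \<longleftrightarrow> (\<forall>p\<in>points A. \<exists>V (k::nat) s.
     openin (manifold_topology A) V \<and> p \<in> V \<and> local_frame A D V {..<k} s)"

definition courant_bracket ::
  "('p, 'e::euclidean_space) chart set \<Rightarrow> ('p \<Rightarrow> 'e big_fibre) \<Rightarrow> ('p \<Rightarrow> 'e big_fibre) \<Rightarrow>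
     'p \<Rightarrow> 'e big_fibre" where
  "courant_bracket A s t p =
     (let X = (\<lambda>q. fst (s q)); \<alpha> = (\<lambda>q. snd (s q)); Y = (\<lambda>q. fst (t q)); \<beta> = (\<lambda>q. snd (t q))
      in (lie_bracket A X Y p,
          lie_deriv_form A X \<beta> p - lie_deriv_form A Y \<alpha> p
            + differential A (\<lambda>q. omega_pairing (s q) (t q)) p))"

definition dirac_structure ::
  "('p, 'e::euclidean_space) chart set \<Rightarrow> ('p \<Rightarrow> 'e big_fibre set) \<Rightarrow> bool" where
  "dirac_structure A D \<longleftrightarrow> vector_subbundle A D \<and> (\<forall>p\<in>points A. maximal_g_isotropic (D p)) \<and>
     (\<forall>s t. is_section A D (points A) s \<and> is_section A D (points A) t \<longrightarrow>
        is_section A D (points A) (courant_bracket A s t))"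


section \<open>Submanifolds\<close>

definition embedded_submanifold ::
  "('p, 'e::euclidean_space) chart set \<Rightarrow> nat \<Rightarrow> 'p set \<Rightarrow> bool" where
  "embedded_submanifold A k N \<longleftrightarrow> N \<subseteq> points A \<and>
     (\<forall>p\<in>N. \<exists>c\<in>charts A. \<exists>I\<subseteq>Basis. p \<in> fst c \<and> card I = k \<and>
        snd c ` (fst c \<inter> N) = {z \<in> snd c ` fst c. \<forall>a\<in>Basis - I. z \<bullet> a = 0})"

text \<open>The velocity vectors at \<open>q\<close> of the smooth curves of \<open>Q\<close>.\<close>

definition tangent_space ::
  "('p, 'e::euclidean_space) chart set \<Rightarrow> 'p set \<Rightarrow> 'p \<Rightarrow> 'e set" where
  "tangent_space A Q q =
     {v. \<exists>\<epsilon>>0. \<exists>\<gamma> :: real \<Rightarrow> 'p. \<gamma> 0 = q \<and>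
           \<gamma> ` {-\<epsilon><..<\<epsilon>} \<subseteq> Q \<inter> fst (chart_at A q) \<and>
           smooth_on {-\<epsilon><..<\<epsilon>} (snd (chart_at A q) \<circ> \<gamma>) \<and>
           ((snd (chart_at A q) \<circ> \<gamma>) has_vector_derivative v) (at 0)}"

definition ann :: "'e::euclidean_space set \<Rightarrow> ('e \<Rightarrow>\<^sub>L real) set" where
  "ann S = {\<alpha>. \<forall>v\<in>S. blinfun_apply \<alpha> v = 0}"

definition coisotropic_submanifold ::
  "('p, 'e::euclidean_space) chart set \<Rightarrow> ('p \<Rightarrow> 'e big_fibre set) \<Rightarrow> 'p set \<Rightarrow> bool" where
  "coisotropic_submanifold A D Q \<longleftrightarrow> (\<exists>k. embedded_submanifold A k Q) \<and>
     (\<forall>q\<in>Q. \<forall>X \<alpha>. \<alpha> \<in> ann (tangent_space A Q q) \<and> (X, \<alpha>) \<in> D q \<longrightarrow> X \<in> tangent_space A Q q)"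

definition isotropic_submanifold ::
  "('p, 'e::euclidean_space) chart set \<Rightarrow> ('p \<Rightarrow> 'e big_fibre set) \<Rightarrow> 'p set \<Rightarrow> bool" where
  "isotropic_submanifold A D Q \<longleftrightarrow> (\<exists>k. embedded_submanifold A k Q) \<and>
     (\<forall>q\<in>Q. \<forall>X \<alpha>. X \<in> tangent_space A Q q \<and> (X, \<alpha>) \<in> D q \<longrightarrow> \<alpha> \<in> ann (tangent_space A Q q))"

text \<open>
  The normal bundle is given by its fibres \<open>nb p\<close>, which matter for \<open>p \<in> N\<close> only; its total space
  is \<open>Sigma N nb\<close>. Smooth sections of \<open>TM\<close> along the embedded submanifold \<open>N\<close> are locally the
  restrictions of smooth vector fields of \<open>M\<close>.
\<close>

definition normal_bundle ::
  "('p, 'e::euclidean_space) chart set \<Rightarrow> 'p set \<Rightarrow> ('p \<Rightarrow> 'e set) \<Rightarrow> bool" where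
  "normal_bundle A N nb \<longleftrightarrow>
     (\<forall>p\<in>N. subspace (nb p) \<and> nb p \<inter> tangent_space A N p = {0} \<and>
        {v + w | v w. v \<in> nb p \<and> w \<in> tangent_space A N p} = UNIV) \<and>
     (\<forall>p\<in>N. \<exists>V (k::nat) X. openin (manifold_topology A) V \<and> p \<in> V \<and> (\<forall>i<k. smooth_vf A V (X i)) \<and>
        (\<forall>q\<in>V \<inter> N. basis_family {..<k} (\<lambda>i. X i q) (nb q)))"


section \<open>The tangent manifold and the tangent Dirac structure\<close>

text \<open>
  A tangent vector \<open>v\<close> at \<open>p\<close> is the point \<open>(p, v)\<close> of \<open>TM\<close>. The chart of \<open>TM\<close> induced by \<open>c\<close>
  has the values \<open>(z, w)\<close>, where \<open>w\<close> are the natural fibre coordinates.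
\<close>

definition tangent_chart ::
  "('p, 'e::euclidean_space) chart set \<Rightarrow> ('p, 'e) chart \<Rightarrow> ('p \<times> 'e, 'e \<times> 'e) chart" where
  "tangent_chart A c = (fst c \<times> UNIV, \<lambda>(p, v). (snd c p, vec_coord A c p v))"

definition tangent_atlas ::
  "('p, 'e::euclidean_space) chart set \<Rightarrow> ('p \<times> 'e, 'e \<times> 'e) chart set" where
  "tangent_atlas A = tangent_chart A ` A"

text \<open>
  The lifts at the point \<open>(p, v)\<close> of \<open>TM\<close> are given by their components in the chart induced by
  \<open>chart_at A p\<close>; they do not depend on the chart used. A tangent vector of \<open>TM\<close> has the
  components \<open>(\<zeta>, \<eta>)\<close>, \<open>\<zeta>\<close> along \<open>\<partial>/\<partial>z\<^sup>i\<close> and \<open>\<eta>\<close> along \<open>\<partial>/\<partial>w\<^sup>i\<close>.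
\<close>

definition vertical_lift_vf ::
  "('p, 'e::euclidean_space) chart set \<Rightarrow> ('p \<Rightarrow> 'e) \<Rightarrow> 'p \<times> 'e \<Rightarrow> 'e \<times> 'e" where
  "vertical_lift_vf A X q =
     (let c = chart_at A (fst q); z = snd c (fst q); \<xi> = vf_rep A c X
      in vec_of_coord (tangent_atlas A) (tangent_chart A c) q (0, \<xi> z))"

definition complete_lift_vf ::
  "('p, 'e::euclidean_space) chart set \<Rightarrow> ('p \<Rightarrow> 'e) \<Rightarrow> 'p \<times> 'e \<Rightarrow> 'e \<times> 'e" where
  "complete_lift_vf A X q =
     (let c = chart_at A (fst q); z = snd c (fst q); w = vec_coord A c (fst q) (snd q);
          \<xi> = vf_rep A c X
      in vec_of_coord (tangent_atlas A) (tangent_chart A c) q (\<xi> z, frechet_derivative \<xi> (at z) w))"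

definition vertical_lift_form ::
  "('p, 'e::euclidean_space) chart set \<Rightarrow> ('p \<Rightarrow> 'e \<Rightarrow>\<^sub>L real) \<Rightarrow> 'p \<times> 'e \<Rightarrow> (('e \<times> 'e) \<Rightarrow>\<^sub>L real)" where
  "vertical_lift_form A \<alpha> q =
     (let c = chart_at A (fst q); z = snd c (fst q); a = form_rep A c \<alpha>
      in cov_of_coord (tangent_atlas A) (tangent_chart A c) q
           (Blinfun (\<lambda>(\<zeta>, \<eta>). blinfun_apply (a z) \<zeta>)))"

definition complete_lift_form ::
  "('p, 'e::euclidean_space) chart set \<Rightarrow> ('p \<Rightarrow> 'e \<Rightarrow>\<^sub>L real) \<Rightarrow> 'p \<times> 'e \<Rightarrow> (('e \<times> 'e) \<Rightarrow>\<^sub>L real)" where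
  "complete_lift_form A \<alpha> q =
     (let c = chart_at A (fst q); z = snd c (fst q); w = vec_coord A c (fst q) (snd q);
          a = form_rep A c \<alpha>
      in cov_of_coord (tangent_atlas A) (tangent_chart A c) q
           (Blinfun (\<lambda>(\<zeta>, \<eta>). blinfun_apply (frechet_derivative a (at z) w) \<zeta> + blinfun_apply (a z) \<eta>)))"

text \<open>The fibre at \<open>q\<close> is spanned by the values at \<open>q\<close> of the generators of the sheaf of sections.\<close>

definition tangent_dirac ::
  "('p, 'e::euclidean_space) chart set \<Rightarrow> ('p \<Rightarrow> 'e big_fibre set) \<Rightarrow>
     'p \<times> 'e \<Rightarrow> ('e \<times> 'e) big_fibre set" where
  "tangent_dirac A D q =
     span (\<Union>(V, s) \<in> {(V, s). openin (manifold_topology A) V \<and> fst q \<in> V \<and> is_section A D V s}.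
       {(complete_lift_vf A (\<lambda>p. fst (s p)) q, complete_lift_form A (\<lambda>p. snd (s p)) q),
        (vertical_lift_vf A (\<lambda>p. fst (s p)) q, vertical_lift_form A (\<lambda>p. snd (s p)) q)})"


section \<open>Adapted coordinates\<close>

text \<open>
  \<open>I \<subseteq> Basis\<close> is the set of the indices \<open>u\<close> of the coordinates \<open>x\<^sup>u\<close>, and \<open>Basis - I\<close> is the
  set of the indices \<open>a\<close> of the coordinates \<open>y\<^sup>a\<close>. The last condition says that the chart domain
  is a tubular neighbourhood of the part of \<open>N\<close> it contains: the projection is
  \<open>(x, y) \<mapsto> (x, 0)\<close>, and each fibre \<open>x = const\<close> is star-shaped about its point of \<open>N\<close>.
\<close>

definition x_part :: "'e::euclidean_space set \<Rightarrow> 'e \<Rightarrow> 'e" where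
  "x_part I z = (\<Sum>u\<in>I. (z \<bullet> u) *\<^sub>R u)"

definition adapted_chart ::
  "('p, 'e::euclidean_space) chart set \<Rightarrow> 'e set \<Rightarrow> 'p set \<Rightarrow> ('p \<Rightarrow> 'e set) \<Rightarrow> ('p, 'e) chart \<Rightarrow> bool" where
  "adapted_chart A I N nb c \<longleftrightarrow> c \<in> charts A \<and>
     snd c ` (fst c \<inter> N) = {z \<in> snd c ` fst c. \<forall>a\<in>Basis - I. z \<bullet> a = 0} \<and>
     (\<forall>p\<in>fst c \<inter> N. tangent_space A N p = span (vec_of_coord A c p ` I) \<and>
        nb p = span (vec_of_coord A c p ` (Basis - I))) \<and>
     (\<forall>z\<in>snd c ` fst c. \<forall>t\<in>{0..1}. x_part I z + t *\<^sub>R (z - x_part I z) \<in> snd c ` fst c)"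

text \<open>The pairs \<open>(B\<^sub>u, \<epsilon>\<^sub>u)\<close>, \<open>u \<in> I\<close>, and \<open>(C\<^sub>a, \<tau>\<^sub>a)\<close>, \<open>a \<in> Basis - I\<close>, are a basis of \<open>D\<close> over \<open>V\<close>.\<close>

definition split_basis ::
  "('p, 'e::euclidean_space) chart set \<Rightarrow> ('p \<Rightarrow> 'e big_fibre set) \<Rightarrow> 'e set \<Rightarrow> 'p set \<Rightarrow>
     ('e \<Rightarrow> 'p \<Rightarrow> 'e) \<Rightarrow> ('e \<Rightarrow> 'p \<Rightarrow> 'e \<Rightarrow>\<^sub>L real) \<Rightarrow>
     ('e \<Rightarrow> 'p \<Rightarrow> 'e) \<Rightarrow> ('e \<Rightarrow> 'p \<Rightarrow> 'e \<Rightarrow>\<^sub>L real) \<Rightarrow> bool" where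
  "split_basis A D I V B \<epsilon> C \<tau> \<longleftrightarrow>
     local_frame A D V Basis (\<lambda>i p. if i \<in> I then (B i p, \<epsilon> i p) else (C i p, \<tau> i p))"

text \<open>
  The systems (T) and (A) at the point \<open>y = 0\<close> with coordinates \<open>z\<close>. The components
  \<open>b\<^sub>u\<^sup>s, b'\<^sub>u\<^sup>h\<close> of \<open>B\<^sub>u\<close> are \<open>vf_rep A c (B u) z \<bullet> i\<close> for \<open>i = s \<in> I\<close> and \<open>i = h \<in> Basis - I\<close>
  respectively; similarly for \<open>C\<^sub>a\<close>, \<open>\<epsilon>\<^sub>u\<close> and \<open>\<tau>\<^sub>a\<close>. The derivative in the direction of
  the basis vector \<open>h\<close> is \<open>\<partial>/\<partial>y\<^sup>h\<close>.
\<close>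

definition system_T ::
  "('p, 'e::euclidean_space) chart set \<Rightarrow> ('p, 'e) chart \<Rightarrow> 'e set \<Rightarrow>
     ('e \<Rightarrow> 'p \<Rightarrow> 'e) \<Rightarrow> ('e \<Rightarrow> 'p \<Rightarrow> 'e) \<Rightarrow> 'e \<Rightarrow>
     ('e \<Rightarrow> real) \<Rightarrow> ('e \<Rightarrow> real) \<Rightarrow> ('e \<Rightarrow> real) \<Rightarrow> ('e \<Rightarrow> real) \<Rightarrow> bool" where
  "system_T A c I B C z lam \<nu> \<mu> \<xi> \<longleftrightarrow>
     (let b = (\<lambda>u i z. vf_rep A c (B u) z \<bullet> i); c' = (\<lambda>a i z. vf_rep A c (C a) z \<bullet> i) in
      (\<forall>s\<in>I. (\<Sum>u\<in>I. \<mu> u * b u s z) + (\<Sum>a\<in>Basis - I. \<xi> a * c' a s z) = 0) \<and>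
      (\<forall>h\<in>Basis - I. (\<Sum>u\<in>I. lam u * b u h z) + (\<Sum>a\<in>Basis - I. \<nu> a * c' a h z) = 0) \<and>
      (\<forall>s\<in>I. \<forall>h\<in>Basis - I. (\<Sum>u\<in>I. lam u * frechet_derivative (b u s) (at z) h)
         + (\<Sum>a\<in>Basis - I. \<nu> a * frechet_derivative (c' a s) (at z) h) = 0))"

definition system_A ::
  "('p, 'e::euclidean_space) chart set \<Rightarrow> ('p, 'e) chart \<Rightarrow> 'e set \<Rightarrow>
     ('e \<Rightarrow> 'p \<Rightarrow> 'e \<Rightarrow>\<^sub>L real) \<Rightarrow> ('e \<Rightarrow> 'p \<Rightarrow> 'e \<Rightarrow>\<^sub>L real) \<Rightarrow> 'e \<Rightarrow>
     ('e \<Rightarrow> real) \<Rightarrow> ('e \<Rightarrow> real) \<Rightarrow> ('e \<Rightarrow> real) \<Rightarrow> ('e \<Rightarrow> real) \<Rightarrow> bool" where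
  "system_A A c I \<epsilon> \<tau> z lam \<nu> \<mu> \<xi> \<longleftrightarrow>
     (let e = (\<lambda>u i z. blinfun_apply (form_rep A c (\<epsilon> u) z) i);
          t = (\<lambda>a i z. blinfun_apply (form_rep A c (\<tau> a) z) i) in
      (\<forall>s\<in>I. (\<Sum>u\<in>I. \<mu> u * e u s z) + (\<Sum>a\<in>Basis - I. \<xi> a * t a s z) = 0) \<and>
      (\<forall>h\<in>Basis - I. (\<Sum>u\<in>I. lam u * e u h z) + (\<Sum>a\<in>Basis - I. \<nu> a * t a h z) = 0) \<and>
      (\<forall>s\<in>I. \<forall>h\<in>Basis - I. (\<Sum>u\<in>I. lam u * frechet_derivative (e u s) (at z) h)
         + (\<Sum>a\<in>Basis - I. \<nu> a * frechet_derivative (t a s) (at z) h) = 0))"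

end

theory Submission
  imports Defs
begin

text \<open>
  The equivalences hold for each normal bundle \<open>\<nu>N\<close> separately. In coordinates \<open>(x, y)\<close> adapted to it, with
  fibre coordinates \<open>w\<close>, the total space is the slice \<open>y\<^sup>a = 0\<close>, \<open>w\<^sup>u = 0\<close> of the tangent manifold, and its tangent
  spaces are spanned by \<open>\<partial>/\<partial>x\<^sup>u\<close> and \<open>\<partial>/\<partial>w\<^sup>a\<close>. The fibre of the tangent Dirac structure is spanned by the lifts
  of a local frame \<open>s\<^sub>i = (X\<^sub>i, \<alpha>\<^sub>i)\<close> of \<open>D\<close> (lemma \<open>tangent_dirac_frame\<close>), and for \<open>\<Sum> \<lambda>\<^sub>i s\<^sub>i\<^sup>C + \<mu>\<^sub>i s\<^sub>i\<^sup>V\<close> the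
  conditions "the vector is tangent" and "the covector annihilates the tangent space" become linear
  equations for \<open>(\<lambda>, \<mu>)\<close>, which depend on the point \<open>w\<close> of the fibre through derivatives of the frame along \<open>w\<close>
  (\<open>point_system\<close>, lemma \<open>tangent_dirac_systems\<close>). Coisotropy says that the covector equations imply the
  vector equations at every \<open>w\<close>; isotropy is the opposite implication.

  The systems (T) and (A) are the corresponding equations with the derivatives in all directions
  \<open>\<partial>/\<partial>y\<^sup>h\<close> imposed separately (\<open>jet_system\<close>). A solution of (A) solves the covector equations at all \<open>w\<close>, so
  coisotropy gives the vector equations at \<open>w = 0\<close> and at \<open>w = \<partial>/\<partial>y\<^sup>h\<close>, which together are (T).

  For the converse, a solution at one \<open>w\<close> need not solve (A). But the implication is known for all frames.
  A change of frame that is the identity at the point adds \<open>\<Sum> \<kappa>\<^sub>h\<^sub>j \<alpha>\<^sub>j\<close> to the derivative \<open>\<Sum> \<lambda>\<^sub>i \<partial>\<alpha>\<^sub>i/\<partial>y\<^sup>h\<close>, and for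
  \<open>\<lambda> \<noteq> 0\<close> the coefficients \<open>\<kappa>\<close> are arbitrary (lemma \<open>change_frame_first_order\<close>). The case \<open>\<lambda> = 0\<close> of the
  implication says that \<open>X \<in> \<nu>N\<close> whenever \<open>(X, \<alpha>) \<in> D\<close> and \<open>\<alpha>\<close> vanishes on \<open>TN\<close>. Since \<open>D\<close> is equal to its
  \<open>g\<close>-orthogonal, this makes the restrictions to \<open>TN\<close> of the covectors of \<open>D\<close> fill the dual of \<open>TN\<close>: a
  tangent vector \<open>u\<close> of \<open>N\<close> killed by all of them has \<open>(u, 0) \<in> D\<close>, so \<open>u \<in> \<nu>N \<inter> TN = 0\<close> (lemma
  \<open>maximal_pair_onto\<close>). Hence \<open>\<kappa>\<close> can be chosen such that (A) holds in the new frame, (T) follows there, and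
  subtracting \<open>\<kappa>\<close> again gives the vector equations at \<open>w\<close>. The isotropic case is the same argument with vectors and
  covectors exchanged.

  Three auxiliary facts carry the rest. A maximal isotropic subspace has dimension \<open>dim M\<close> and equals its
  orthogonal (lemma \<open>isotropic_split\<close>), so frames of \<open>D\<close> are indexed by the coordinates. Lifts have the same
  expression in every chart by the symmetry of second derivatives (lemma \<open>second_derivative_symmetric\<close>).
  Adapted charts exist by the inverse function theorem (lemma \<open>adapted_chart_exists\<close>).
\<close>

section \<open>Calculus of smooth maps\<close>

lemma frechet_derivative_eqI: "(f has_derivative f') (at x) \<Longrightarrow> frechet_derivative f (at x) = f'"
  using frechet_derivative_at by metis

lemma Ck_on_SucD: "Ck_on (Suc k) S f \<Longrightarrow> Ck_on k S f"
proof (induction k arbitrary: f)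
  case 0
  then show ?case
    by (auto intro: differentiable_imp_continuous_on simp: differentiable_on_def differentiable_at_withinI)
next
  case (Suc k)
  then show ?case
    by (metis Ck_on.simps(2))
qed

lemma Ck_on_subset: "Ck_on k S f \<Longrightarrow> T \<subseteq> S \<Longrightarrow> Ck_on k T f"
  by (induction k arbitrary: f) (auto intro: continuous_on_subset)

lemma Ck_on_cong:
  assumes "open S" "\<And>x. x \<in> S \<Longrightarrow> f x = g x"
  shows "Ck_on k S f \<longleftrightarrow> Ck_on k S g"
  using assms(2)
proof (induction k arbitrary: f g)
  case 0
  then show ?case by (auto intro: continuous_on_eq)
next
  case (Suc k)
  have d: "(f has_derivative f') (at x) \<longleftrightarrow> (g has_derivative f') (at x)" if "x \<in> S" for x f'
    using has_derivative_transform_within_open[OF _ assms(1) that] Suc.prems by metis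
  have e: "frechet_derivative f (at x) v = frechet_derivative g (at x) v" if "x \<in> S" for x v
    using d[OF that] by (simp add: frechet_derivative_def)
  show ?case
    using Suc.IH[of "\<lambda>x. frechet_derivative f (at x) v" "\<lambda>x. frechet_derivative g (at x) v" for v] e d
    by (auto simp: differentiable_def)
qed

lemma Ck_on_local:
  assumes "\<And>x. x \<in> S \<Longrightarrow> \<exists>U. open U \<and> x \<in> U \<and> Ck_on k U f"
  shows "Ck_on k S f"
  using assms
proof (induction k arbitrary: f)
  case 0
  then show ?case
    by (metis Ck_on.simps(1) continuous_at_imp_continuous_on continuous_on_eq_continuous_at)
next
  case (Suc k)
  then show ?case by (simp, metis)
qed

lemma Ck_on_const: "Ck_on k S (\<lambda>x. c)"
  by (induction k arbitrary: c) (simp_all)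

lemma Ck_on_bounded_linear: "bounded_linear f \<Longrightarrow> Ck_on k S f"
  by (cases k) (auto intro: linear_continuous_on bounded_linear_imp_differentiable Ck_on_const
      simp: frechet_derivative_eqI[OF bounded_linear_imp_has_derivative])

lemma Ck_on_add:
  assumes "open S" "Ck_on k S f" "Ck_on k S g"
  shows "Ck_on k S (\<lambda>x. f x + g x)"
  using assms(2,3)
proof (induction k arbitrary: f g)
  case 0
  then show ?case by (auto intro: continuous_on_add)
next
  case (Suc k)
  have "frechet_derivative (\<lambda>x. f x + g x) (at x) v
      = frechet_derivative f (at x) v + frechet_derivative g (at x) v" if "x \<in> S" for x v
  proof -
    have "(f has_derivative frechet_derivative f (at x)) (at x)"
      "(g has_derivative frechet_derivative g (at x)) (at x)"
      using Suc.prems that by (auto simp: frechet_derivative_works)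
    then show ?thesis
      by (simp add: frechet_derivative_eqI[OF has_derivative_add])
  qed
  then have "Ck_on k S (\<lambda>x. frechet_derivative (\<lambda>x. f x + g x) (at x) v)" for v
    using Suc by (subst Ck_on_cong[OF assms(1)]) auto
  then show ?case using Suc.prems by auto
qed

lemma Ck_on_sum:
  assumes "open S" "\<And>i. i \<in> J \<Longrightarrow> Ck_on k S (f i)"
  shows "Ck_on k S (\<lambda>x. \<Sum>i\<in>J. f i x)"
  using assms(2)
  by (induction J rule: infinite_finite_induct) (auto intro!: Ck_on_const Ck_on_add[OF assms(1)])

lemma (in bounded_bilinear) Ck_on:
  assumes "open S" "Ck_on k S f" "Ck_on k S g"
  shows "Ck_on k S (\<lambda>x. prod (f x) (g x))"
  using assms(2,3)
proof (induction k arbitrary: f g)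
  case 0
  then show ?case by (auto intro: continuous_on)
next
  case (Suc k)
  have h: "((\<lambda>x. prod (f x) (g x)) has_derivative
      (\<lambda>v. prod (f x) (frechet_derivative g (at x) v) + prod (frechet_derivative f (at x) v) (g x))) (at x)"
    if "x \<in> S" for x
    using Suc.prems that by (intro FDERIV) (auto simp: frechet_derivative_works)
  have "Ck_on k S (\<lambda>x. frechet_derivative (\<lambda>x. prod (f x) (g x)) (at x) v)" for v
    using Suc Ck_on_SucD[OF Suc.prems(1)] Ck_on_SucD[OF Suc.prems(2)]
    by (subst Ck_on_cong[OF assms(1)]) (auto simp: frechet_derivative_eqI[OF h] intro!: Ck_on_add assms(1))
  then show ?case using h by (auto simp: differentiable_def)
qed

lemma linear_expand_Basis:
  fixes f :: "'a::euclidean_space \<Rightarrow> 'b::real_vector"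
  assumes "linear f" shows "f v = (\<Sum>j\<in>Basis. (v \<bullet> j) *\<^sub>R f j)"
proof -
  have "f v = f (\<Sum>j\<in>Basis. (v \<bullet> j) *\<^sub>R j)" by (simp add: euclidean_representation)
  also have "\<dots> = (\<Sum>j\<in>Basis. (v \<bullet> j) *\<^sub>R f j)"
    using assms by (simp add: linear_sum linear_scale)
  finally show ?thesis .
qed

text \<open>
  The chain rule gives the derivative in one direction as a derivative of \<open>g\<close> in a direction that
  varies with the point. Expanding this direction in \<open>Basis\<close> leaves only derivatives of \<open>g\<close> in fixed
  directions, the ones that \<open>Ck_on\<close> speaks of.
\<close>

lemma Ck_on_compose:
  fixes f :: "'a::real_normed_vector \<Rightarrow> 'b::euclidean_space" and g :: "'b \<Rightarrow> 'c::real_normed_vector"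
  assumes "open S" "open T" "f ` S \<subseteq> T" "Ck_on k S f" "Ck_on k T g"
  shows "Ck_on k S (g \<circ> f)"
  using assms(4,5)
proof (induction k arbitrary: g)
  case 0
  then show ?case using assms(3) continuous_on_compose continuous_on_subset by auto blast
next
  case (Suc k)
  have h: "((g \<circ> f) has_derivative
      (\<lambda>v. frechet_derivative g (at (f x)) (frechet_derivative f (at x) v))) (at x)" if "x \<in> S" for x
  proof -
    have "(f has_derivative frechet_derivative f (at x)) (at x)"
      "(g has_derivative frechet_derivative g (at (f x))) (at (f x))"
      using Suc.prems that assms(3) by (auto simp: frechet_derivative_works)
    from diff_chain_at[OF this] show ?thesis by (simp add: o_def)
  qed
  have "Ck_on k S (\<lambda>x. frechet_derivative (g \<circ> f) (at x) v)" for v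
  proof -
    have "frechet_derivative (g \<circ> f) (at x) v =
       (\<Sum>j\<in>Basis. (frechet_derivative f (at x) v \<bullet> j) *\<^sub>R ((\<lambda>y. frechet_derivative g (at y) j) \<circ> f) x)"
      if "x \<in> S" for x
    proof -
      have "linear (frechet_derivative g (at (f x)))"
        using Suc.prems that assms(3) by (auto intro!: linear_frechet_derivative)
      from linear_expand_Basis[OF this, of "frechet_derivative f (at x) v"] show ?thesis
        by (simp only: frechet_derivative_eqI[OF h[OF that]] o_apply)
    qed
    moreover have "Ck_on k S (\<lambda>x. \<Sum>j\<in>Basis. (frechet_derivative f (at x) v \<bullet> j) *\<^sub>R
                             ((\<lambda>y. frechet_derivative g (at y) j) \<circ> f) x)"
      using Suc.prems Ck_on_SucD[OF Suc.prems(1)]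
      by (intro Ck_on_sum bounded_bilinear.Ck_on[OF bounded_bilinear_scaleR]
          bounded_bilinear.Ck_on[OF bounded_bilinear_inner] Ck_on_const assms(1) Suc.IH) auto
    ultimately show ?thesis
      using Ck_on_cong[OF assms(1), of "\<lambda>x. frechet_derivative (g \<circ> f) (at x) v"] by (simp only:)
  qed
  then show ?case
    unfolding Ck_on.simps differentiable_def using h by blast
qed

lemma smooth_on_subset: "smooth_on S f \<Longrightarrow> T \<subseteq> S \<Longrightarrow> smooth_on T f"
  unfolding smooth_on_def using Ck_on_subset by blast

lemma smooth_on_cong:
  "open S \<Longrightarrow> (\<And>x. x \<in> S \<Longrightarrow> f x = g x) \<Longrightarrow> smooth_on S f \<longleftrightarrow> smooth_on S g"
  unfolding smooth_on_def using Ck_on_cong by blast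

lemma smooth_on_transfer:
  "open S \<Longrightarrow> smooth_on S f \<Longrightarrow> (\<And>x. x \<in> S \<Longrightarrow> f x = g x) \<Longrightarrow> smooth_on S g"
  using smooth_on_cong[of S f g] by simp

lemma smooth_on_local:
  "(\<And>x. x \<in> S \<Longrightarrow> \<exists>U. open U \<and> x \<in> U \<and> smooth_on U f) \<Longrightarrow> smooth_on S f"
  unfolding smooth_on_def by (meson Ck_on_local)

lemma smooth_on_const: "smooth_on S (\<lambda>x. c)"
  unfolding smooth_on_def by (simp add: Ck_on_const)

lemma smooth_on_bounded_linear: "bounded_linear f \<Longrightarrow> smooth_on S f"
  unfolding smooth_on_def by (simp add: Ck_on_bounded_linear)

lemma smooth_on_add:
  "open S \<Longrightarrow> smooth_on S f \<Longrightarrow> smooth_on S g \<Longrightarrow> smooth_on S (\<lambda>x. f x + g x)"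
  unfolding smooth_on_def by (simp add: Ck_on_add)

lemma smooth_on_sum:
  "open S \<Longrightarrow> (\<And>i. i \<in> J \<Longrightarrow> smooth_on S (f i)) \<Longrightarrow> smooth_on S (\<lambda>x. \<Sum>i\<in>J. f i x)"
  unfolding smooth_on_def by (simp add: Ck_on_sum)

lemma (in bounded_bilinear) smooth_on:
  "open S \<Longrightarrow> smooth_on S f \<Longrightarrow> smooth_on S g \<Longrightarrow> smooth_on S (\<lambda>x. prod (f x) (g x))"
  unfolding smooth_on_def by (simp add: Ck_on)

lemmas smooth_on_scaleR = bounded_bilinear.smooth_on[OF bounded_bilinear_scaleR]
lemmas smooth_on_mult = bounded_bilinear.smooth_on[OF bounded_bilinear_mult]

lemma smooth_on_inner_const:
  "open S \<Longrightarrow> smooth_on S f \<Longrightarrow> smooth_on S (\<lambda>x. f x \<bullet> j)"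
  by (rule bounded_bilinear.smooth_on[OF bounded_bilinear_inner]) (auto intro: smooth_on_const)

lemma smooth_on_compose:
  fixes f :: "'a::real_normed_vector \<Rightarrow> 'b::euclidean_space" and g :: "'b \<Rightarrow> 'c::real_normed_vector"
  shows "open S \<Longrightarrow> open T \<Longrightarrow> f ` S \<subseteq> T \<Longrightarrow> smooth_on S f \<Longrightarrow> smooth_on T g \<Longrightarrow> smooth_on S (g \<circ> f)"
  unfolding smooth_on_def by (simp add: Ck_on_compose)

lemma smooth_on_differentiable: "smooth_on S f \<Longrightarrow> x \<in> S \<Longrightarrow> f differentiable (at x)"
  unfolding smooth_on_def by (metis Ck_on.simps(2))

lemma smooth_on_has_derivative:
  "smooth_on S f \<Longrightarrow> x \<in> S \<Longrightarrow> (f has_derivative frechet_derivative f (at x)) (at x)"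
  using smooth_on_differentiable frechet_derivative_works by blast

lemma smooth_on_linear_derivative:
  "smooth_on S f \<Longrightarrow> x \<in> S \<Longrightarrow> linear (frechet_derivative f (at x))"
  using smooth_on_differentiable linear_frechet_derivative by blast

lemma smooth_on_derivative: "smooth_on S f \<Longrightarrow> smooth_on S (\<lambda>x. frechet_derivative f (at x) v)"
  unfolding smooth_on_def by (metis Ck_on.simps(2))

lemma smooth_on_continuous: "smooth_on S f \<Longrightarrow> continuous_on S f"
  unfolding smooth_on_def by (metis Ck_on.simps(1))

lemma smooth_on_derivative_fun:
  fixes f :: "'a::euclidean_space \<Rightarrow> 'b::real_normed_vector"
  assumes "open S" "smooth_on S f" "smooth_on S g"
  shows "smooth_on S (\<lambda>x. frechet_derivative f (at x) (g x))"
proof -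
  have "smooth_on S (\<lambda>x. \<Sum>j\<in>Basis. (g x \<bullet> j) *\<^sub>R frechet_derivative f (at x) j)"
    by (intro smooth_on_sum smooth_on_scaleR smooth_on_inner_const smooth_on_derivative assms)
  then show ?thesis
    using linear_expand_Basis[OF smooth_on_linear_derivative[OF assms(2)]]
    by (subst smooth_on_cong[OF assms(1)]) auto
qed

lemma smooth_on_blinfun_componentwise:
  fixes f :: "'a::real_normed_vector \<Rightarrow> 'b::euclidean_space \<Rightarrow>\<^sub>L real"
  assumes "open S" "\<And>j. j \<in> Basis \<Longrightarrow> smooth_on S (\<lambda>x. blinfun_apply (f x) j)"
  shows "smooth_on S f"
proof -
  have e: "f x = (\<Sum>j\<in>Basis. blinfun_apply (f x) j *\<^sub>R blinfun_inner_left j)" for x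
    by (rule blinfun_eqI)
      (subst linear_expand_Basis[OF blinfun.bounded_linear_right[THEN bounded_linear.linear], of "f x"],
        simp add: blinfun.sum_left blinfun.scaleR_left mult.commute inner_commute)
  have "smooth_on S (\<lambda>x. \<Sum>j\<in>Basis. blinfun_apply (f x) j *\<^sub>R blinfun_inner_left j :: 'b \<Rightarrow>\<^sub>L real)"
    by (intro smooth_on_sum smooth_on_scaleR smooth_on_const assms)
  then show ?thesis by (subst e[abs_def])
qed

lemma smooth_on_blinfun_apply:
  "open S \<Longrightarrow> smooth_on S f \<Longrightarrow> smooth_on S g \<Longrightarrow> smooth_on S (\<lambda>x. blinfun_apply (f x) (g x))"
  by (rule bounded_bilinear.smooth_on[OF bounded_bilinear_blinfun_apply])

lemma smooth_on_Pair:
  fixes f :: "'a::real_normed_vector \<Rightarrow> 'b::real_normed_vector" and g :: "'a \<Rightarrow> 'c::real_normed_vector"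
  assumes "open S" "smooth_on S f" "smooth_on S g"
  shows "smooth_on S (\<lambda>x. (f x, g x))"
proof -
  have "Ck_on k S (\<lambda>x. (f x, g x))" if "Ck_on k S f" "Ck_on k S g" for k
    using that
  proof (induction k arbitrary: f g)
    case 0
    then show ?case by (auto intro: continuous_on_Pair)
  next
    case (Suc k)
    have h: "((\<lambda>x. (f x, g x)) has_derivative
      (\<lambda>v. (frechet_derivative f (at x) v, frechet_derivative g (at x) v))) (at x)" if "x \<in> S" for x
      using Suc.prems that by (intro has_derivative_Pair) (auto simp: frechet_derivative_works)
    have "Ck_on k S (\<lambda>x. frechet_derivative (\<lambda>x. (f x, g x)) (at x) v)" for v
      using Suc by (subst Ck_on_cong[OF assms(1)]) (auto simp: frechet_derivative_eqI[OF h])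
    then show ?case using h by (auto simp: differentiable_def)
  qed
  then show ?thesis using assms by (simp add: smooth_on_def)
qed

lemma smooth_on_along_curve:
  fixes f :: "'a::real_normed_vector \<Rightarrow> real"
  assumes f: "smooth_on S f" and q: "(q has_derivative (\<lambda>r. r *\<^sub>R b)) (at t)" and S: "q t \<in> S"
  shows "((\<lambda>t. f (q t)) has_derivative (\<lambda>r. r * frechet_derivative f (at (q t)) b)) (at t)"
proof -
  have "((\<lambda>t. f (q t)) has_derivative (\<lambda>r. frechet_derivative f (at (q t)) (r *\<^sub>R b))) (at t)"
    by (rule has_derivative_compose[OF q smooth_on_has_derivative[OF f S]])
  moreover have "frechet_derivative f (at (q t)) (r *\<^sub>R b) = r * frechet_derivative f (at (q t)) b" for r
    using linear_scale[OF smooth_on_linear_derivative[OF f S]] by simp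
  ultimately show ?thesis by (simp only:)
qed

lemma mvt_from_zero:
  fixes G :: "real \<Rightarrow> real"
  assumes "0 < h" and d: "\<And>s. 0 \<le> s \<Longrightarrow> s \<le> h \<Longrightarrow> (G has_derivative (\<lambda>r. r * g s)) (at s)"
  obtains s where "0 < s" "s < h" "G h - G 0 = h * g s"
proof -
  have "continuous_on {0..h} G"
    by (rule has_derivative_continuous_on[where f' = "\<lambda>s r. r * g s"])
      (auto intro: d has_derivative_at_withinI)
  then obtain s where "0 < s" "s < h" "G h - G 0 = (h - 0) * g s"
    using mvt[of 0 h G "\<lambda>s r. r * g s"] assms by (metis order_less_imp_le)
  then show thesis using that by simp
qed

text \<open>
  The mean value theorem, applied first along \<open>a\<close> to \<open>s \<mapsto> f (z + s a + h b) - f (z + s a)\<close> and then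
  along \<open>b\<close>. The left-hand side is symmetric in \<open>a\<close> and \<open>b\<close>, which makes the mixed second
  derivatives agree in the limit.
\<close>

lemma second_difference_mvt:
  fixes f :: "'a::real_normed_vector \<Rightarrow> real"
  assumes f: "smooth_on S f" and h: "0 < h"
    and S: "\<And>s t. 0 \<le> s \<Longrightarrow> s \<le> h \<Longrightarrow> 0 \<le> t \<Longrightarrow> t \<le> h \<Longrightarrow> z + s *\<^sub>R a + t *\<^sub>R b \<in> S"
  shows "\<exists>s t. 0 < s \<and> s < h \<and> 0 < t \<and> t < h \<and>
    f (z + h *\<^sub>R a + h *\<^sub>R b) - f (z + h *\<^sub>R a) - f (z + h *\<^sub>R b) + f z
      = h\<^sup>2 * frechet_derivative (\<lambda>x. frechet_derivative f (at x) a) (at (z + s *\<^sub>R a + t *\<^sub>R b)) b"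
proof -
  let ?Da = "\<lambda>x. frechet_derivative f (at x) a"
  let ?F = "\<lambda>s. f (z + s *\<^sub>R a + h *\<^sub>R b) - f (z + s *\<^sub>R a + 0 *\<^sub>R b)"
  have dF: "(?F has_derivative (\<lambda>r. r * (?Da (z + s *\<^sub>R a + h *\<^sub>R b) - ?Da (z + s *\<^sub>R a + 0 *\<^sub>R b))))
      (at s)" if "0 \<le> s" "s \<le> h" for s
  proof -
    have "((\<lambda>s. f (z + s *\<^sub>R a + t *\<^sub>R b)) has_derivative
        (\<lambda>r. r * ?Da (z + s *\<^sub>R a + t *\<^sub>R b))) (at s)" if "0 \<le> t" "t \<le> h" for t
      by (rule smooth_on_along_curve[OF f])
        (auto intro!: derivative_eq_intros S that \<open>0 \<le> s\<close> \<open>s \<le> h\<close>)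
    from has_derivative_diff[OF this[of h] this[of 0]] show ?thesis
      using h by (simp only: right_diff_distrib order_refl less_imp_le simp_thms)
  qed
  obtain s where s: "0 < s" "s < h" and
    Fs: "?F h - ?F 0 = h * (?Da (z + s *\<^sub>R a + h *\<^sub>R b) - ?Da (z + s *\<^sub>R a + 0 *\<^sub>R b))"
    by (rule mvt_from_zero[OF h dF])
  let ?G = "\<lambda>t. ?Da (z + s *\<^sub>R a + t *\<^sub>R b)"
  have dG: "(?G has_derivative
       (\<lambda>r. r * frechet_derivative ?Da (at (z + s *\<^sub>R a + t *\<^sub>R b)) b)) (at t)"
    if "0 \<le> t" "t \<le> h" for t
    by (rule smooth_on_along_curve[OF smooth_on_derivative[OF f]])
      (use S s that in \<open>auto intro!: derivative_eq_intros\<close>)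
  obtain t where t: "0 < t" "t < h" and
    Gt: "?G h - ?G 0 = h * frechet_derivative ?Da (at (z + s *\<^sub>R a + t *\<^sub>R b)) b"
    by (rule mvt_from_zero[OF h dG])
  show ?thesis
    using s t Fs Gt by (intro exI[of _ s] exI[of _ t]) (auto simp: power2_eq_square algebra_simps)
qed

lemma second_derivative_limit:
  fixes f :: "'a::real_normed_vector \<Rightarrow> real"
  assumes S: "open S" and f: "smooth_on S f" and z: "z \<in> S"
  shows "((\<lambda>h. (f (z + h *\<^sub>R a + h *\<^sub>R b) - f (z + h *\<^sub>R a) - f (z + h *\<^sub>R b) + f z) / h\<^sup>2)
    \<longlongrightarrow> frechet_derivative (\<lambda>x. frechet_derivative f (at x) a) (at z) b) (at_right 0)"
proof -
  let ?D = "\<lambda>x. frechet_derivative (\<lambda>x. frechet_derivative f (at x) a) (at x) b"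
  have "continuous_on S ?D"
    by (intro smooth_on_continuous smooth_on_derivative f)
  then have cont: "isCont ?D z"
    using S z by (simp add: continuous_on_eq_continuous_at)
  show ?thesis
  proof (rule tendstoI)
    fix e :: real assume "0 < e"
    then obtain d0 where "0 < d0" and d0: "\<And>x. dist x z < d0 \<Longrightarrow> dist (?D x) (?D z) < e"
      using cont unfolding continuous_at_eps_delta by blast
    obtain d1 where "0 < d1" and d1: "ball z d1 \<subseteq> S"
      using S z openE by blast
    define d where "d = min d0 d1 / (norm a + norm b + 1)"
    have n: "0 < norm a + norm b + 1" by (smt (verit) norm_ge_zero)
    have "0 < d" using \<open>0 < d0\<close> \<open>0 < d1\<close> n by (simp add: d_def)
    have near: "dist (z + s *\<^sub>R a + t *\<^sub>R b) z < min d0 d1"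
      if "0 \<le> s" "s \<le> h" "0 \<le> t" "t \<le> h" "h < d" for s t h
    proof -
      have "dist (z + s *\<^sub>R a + t *\<^sub>R b) z \<le> s * norm a + t * norm b"
        using norm_triangle_ineq[of "s *\<^sub>R a" "t *\<^sub>R b"] that by (simp add: dist_norm add.assoc)
      also have "\<dots> \<le> h * (norm a + norm b + 1)"
        using that mult_right_mono[OF that(2) norm_ge_zero[of a]]
          mult_right_mono[OF that(4) norm_ge_zero[of b]] by (auto simp: algebra_simps)
      also have "\<dots> < d * (norm a + norm b + 1)"
        using that(5) n by simp
      finally show ?thesis using n by (simp add: d_def)
    qed
    show "\<forall>\<^sub>F h in at_right 0. dist ((f (z + h *\<^sub>R a + h *\<^sub>R b) - f (z + h *\<^sub>R a)
              - f (z + h *\<^sub>R b) + f z) / h\<^sup>2) (?D z) < e"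
      unfolding eventually_at_right_field
    proof (intro exI[of _ d] conjI allI impI \<open>0 < d\<close>)
      fix h :: real assume h: "0 < h" "h < d"
      obtain s t where st: "0 < s" "s < h" "0 < t" "t < h" and
        e: "f (z + h *\<^sub>R a + h *\<^sub>R b) - f (z + h *\<^sub>R a) - f (z + h *\<^sub>R b) + f z
          = h\<^sup>2 * ?D (z + s *\<^sub>R a + t *\<^sub>R b)"
        using second_difference_mvt[OF f h(1), of z a b] near h d1
        by (auto simp: subset_eq dist_commute)
      then show "dist ((f (z + h *\<^sub>R a + h *\<^sub>R b) - f (z + h *\<^sub>R a)
              - f (z + h *\<^sub>R b) + f z) / h\<^sup>2) (?D z) < e"
        using d0[of "z + s *\<^sub>R a + t *\<^sub>R b"] near[of s h t] h by simp
    qed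
  qed
qed

lemma second_derivative_symmetric:
  fixes f :: "'a::real_normed_vector \<Rightarrow> 'b::euclidean_space"
  assumes S: "open S" and f: "smooth_on S f" and z: "z \<in> S"
  shows "frechet_derivative (\<lambda>x. frechet_derivative f (at x) a) (at z) b
       = frechet_derivative (\<lambda>x. frechet_derivative f (at x) b) (at z) a"
proof (rule euclidean_eqI)
  fix j :: 'b assume "j \<in> Basis"
  let ?f = "\<lambda>x. f x \<bullet> j"
  have fj: "smooth_on S ?f" by (rule smooth_on_inner_const[OF S f])
  have inner: "frechet_derivative (\<lambda>x. g x \<bullet> j) (at x) v = frechet_derivative g (at x) v \<bullet> j"
    if "smooth_on S g" "x \<in> S" for g :: "'a \<Rightarrow> 'b" and x v
    by (simp add: frechet_derivative_eqI[OF bounded_linear.has_derivative[OF bounded_linear_inner_left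
            smooth_on_has_derivative[OF that]]])
  have comp: "frechet_derivative (\<lambda>x. frechet_derivative ?f (at x) a) (at z) b
      = frechet_derivative (\<lambda>x. frechet_derivative f (at x) a) (at z) b \<bullet> j" for a b
  proof -
    have "((\<lambda>x. frechet_derivative f (at x) a \<bullet> j) has_derivative
        (\<lambda>v. frechet_derivative (\<lambda>x. frechet_derivative f (at x) a) (at z) v \<bullet> j)) (at z)"
      by (rule bounded_linear.has_derivative[OF bounded_linear_inner_left
            smooth_on_has_derivative[OF smooth_on_derivative[OF f] z]])
    then have "((\<lambda>x. frechet_derivative ?f (at x) a) has_derivative
        (\<lambda>v. frechet_derivative (\<lambda>x. frechet_derivative f (at x) a) (at z) v \<bullet> j)) (at z)"
      by (rule has_derivative_transform_within_open[OF _ S z]) (simp add: inner[OF f])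
    then show ?thesis by (simp add: frechet_derivative_eqI)
  qed
  have e: "(\<lambda>h. (?f (z + h *\<^sub>R a + h *\<^sub>R b) - ?f (z + h *\<^sub>R a) - ?f (z + h *\<^sub>R b) + ?f z) / h\<^sup>2)
    = (\<lambda>h. (?f (z + h *\<^sub>R b + h *\<^sub>R a) - ?f (z + h *\<^sub>R b) - ?f (z + h *\<^sub>R a) + ?f z) / h\<^sup>2)"
    by (simp add: add.commute add.left_commute algebra_simps)
  have "frechet_derivative (\<lambda>x. frechet_derivative ?f (at x) a) (at z) b
      = frechet_derivative (\<lambda>x. frechet_derivative ?f (at x) b) (at z) a"
    using second_derivative_limit[OF S fj z, of a b] second_derivative_limit[OF S fj z, of b a]
    unfolding e by (intro tendsto_unique[OF trivial_limit_at_right_real])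
  then show "frechet_derivative (\<lambda>x. frechet_derivative f (at x) a) (at z) b \<bullet> j
       = frechet_derivative (\<lambda>x. frechet_derivative f (at x) b) (at z) a \<bullet> j"
    by (simp add: comp)
qed

text \<open>
  Where \<open>h\<close> vanishes, the product rule needs only a limit of the other factor: the omitted term
  \<open>(c x - c0) h' (x - y)\<close> is a product of two quantities tending to \<open>0\<close>, one of them linearly.
\<close>

lemma has_derivative_scaleR_vanishing:
  fixes h :: "'a::real_normed_vector \<Rightarrow> 'b::real_normed_vector"
  assumes c: "(c \<longlongrightarrow> c0) (at y)" and h: "(h has_derivative h') (at y)" and "h y = 0"
  shows "((\<lambda>x. c x *\<^sub>R h x) has_derivative (\<lambda>u. c0 *\<^sub>R h' u)) (at y)"
  unfolding has_derivative_at2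
proof (intro conjI)
  have bl: "bounded_linear h'" using h has_derivative_bounded_linear by blast
  then show "bounded_linear (\<lambda>u. c0 *\<^sub>R h' u)" by (rule bounded_linear_const_scaleR)
  obtain K where Kpos: "0 \<le> K" and K: "\<And>u. norm (h' u) \<le> norm u * K"
    using bounded_linear.nonneg_bounded[OF bl] by blast
  have "((\<lambda>x. (c x - c0) *\<^sub>R ((1 / norm (x - y)) *\<^sub>R h' (x - y))) \<longlongrightarrow> 0) (at y)"
  proof (rule Lim_null_comparison)
    show "\<forall>\<^sub>F x in at y. norm ((c x - c0) *\<^sub>R ((1 / norm (x - y)) *\<^sub>R h' (x - y))) \<le> \<bar>c x - c0\<bar> * K"
    proof (rule always_eventually, rule allI)
      fix x
      have "norm ((1 / norm (x - y)) *\<^sub>R h' (x - y)) \<le> K" if "x \<noteq> y"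
        using K[of "x - y"] that by (simp add: field_simps)
      then show "norm ((c x - c0) *\<^sub>R ((1 / norm (x - y)) *\<^sub>R h' (x - y))) \<le> \<bar>c x - c0\<bar> * K"
        unfolding norm_scaleR[of "c x - c0"] real_norm_def
        using Kpos by (cases "x = y") (simp, blast intro: mult_left_mono abs_ge_zero)
    qed
    have "((\<lambda>x. \<bar>c x - c0\<bar> * K) \<longlongrightarrow> \<bar>c0 - c0\<bar> * K) (at y)"
      by (intro tendsto_intros c)
    then show "((\<lambda>x. \<bar>c x - c0\<bar> * K) \<longlongrightarrow> 0) (at y)" by simp
  qed
  moreover have "((\<lambda>x. c x *\<^sub>R ((1 / norm (x - y)) *\<^sub>R (h x - (h y + h' (x - y))))) \<longlongrightarrow> c0 *\<^sub>R 0) (at y)"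
    using h c by (intro tendsto_scaleR) (auto simp: has_derivative_at2)
  ultimately have "((\<lambda>x. c x *\<^sub>R ((1 / norm (x - y)) *\<^sub>R (h x - (h y + h' (x - y)))) +
       (c x - c0) *\<^sub>R ((1 / norm (x - y)) *\<^sub>R h' (x - y))) \<longlongrightarrow> c0 *\<^sub>R 0 + 0) (at y)"
    using tendsto_add by blast
  then show "((\<lambda>x. (1 / norm (x - y)) *\<^sub>R (c x *\<^sub>R h x - (c y *\<^sub>R h y + c0 *\<^sub>R h' (x - y)))) \<longlongrightarrow> 0) (at y)"
    using \<open>h y = 0\<close> by (simp add: algebra_simps diff_divide_distrib)
qed

text \<open>
  Write \<open>L y\<close> for the derivative of \<open>f\<close> at \<open>g y\<close>, so that \<open>g' y\<close> is the inverse of \<open>L y\<close>. Differentiating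
  \<open>L y (g' y v) = v\<close> expresses the derivative of \<open>y \<mapsto> g' y v\<close> through \<open>g'\<close> and second derivatives of \<open>f\<close>
  at \<open>g y\<close>. Hence \<open>g\<close> and \<open>g'\<close> gain one order of differentiability at each step of the induction.
\<close>

lemma Ck_on_inverse_function:
  fixes f g :: "'a::euclidean_space \<Rightarrow> 'a"
  assumes V: "open V" and U: "open U" and f: "smooth_on U f" and gV: "g ` V \<subseteq> U"
    and g: "\<And>y. y \<in> V \<Longrightarrow> (g has_derivative g' y) (at y)"
    and inv: "\<And>y w. y \<in> V \<Longrightarrow> frechet_derivative f (at (g y)) (g' y w) = w"
  shows "Ck_on k V g \<and> (\<forall>v. Ck_on k V (\<lambda>y. g' y v))"
proof -
  define L where "L y = frechet_derivative f (at (g y))" for y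
  have linL: "linear (L y)" if "y \<in> V" for y
    unfolding L_def using smooth_on_linear_derivative[OF f] gV that by auto
  have ling: "linear (g' y)" if "y \<in> V" for y
    using g[OF that] has_derivative_linear by blast
  have Lg: "L y (g' y w) = w" if "y \<in> V" for y w
    unfolding L_def using inv[OF that] .
  have gL: "g' y (L y w) = w" if "y \<in> V" for y w
  proof -
    have "inj (g' y)" by (metis Lg[OF that] injI)
    then have "surj (g' y)"
      using ling[OF that] linear_injective_imp_surjective by blast
    then obtain u where "w = g' y u" by (metis surjD)
    then show ?thesis using Lg[OF that] by simp
  qed
  have contg: "continuous_on V g"
    using g by (meson continuous_at_imp_continuous_on has_derivative_continuous)
  have contL: "continuous_on V (\<lambda>y. L y v)" for v
    unfolding L_def
    using continuous_on_compose[OF contg continuous_on_subset[OF smooth_on_continuous[OF smooth_on_derivative[OF f, of v]] gV]]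
    by (simp add: o_def)
  have C0: "continuous_on V (\<lambda>y. g' y v)" for v
    unfolding continuous_on_eq_continuous_at[OF V]
  proof
    fix y assume y: "y \<in> V"
    define K where "K x = Blinfun (L x)" for x
    have apK: "blinfun_apply (K x) = L x" if "x \<in> V" for x
      unfolding K_def using linL[OF that] by (simp add: bounded_linear_Blinfun_apply linear_conv_bounded_linear)
    \<comment> \<open>\<open>L y\<close> is bounded below; so is \<open>L x\<close> for \<open>x\<close> near \<open>y\<close>, with half the bound.\<close>
    obtain B where B: "0 < B" "\<And>w. B * norm w \<le> norm (L y w)"
    proof -
      obtain C where "0 < C" and C: "\<And>u. norm (g' y u) \<le> norm u * C"
        using bounded_linear.pos_bounded[OF has_derivative_bounded_linear[OF g[OF y]]] by blast
      have "inverse C * norm w \<le> norm (L y w)" for w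
        using C[of "L y w"] \<open>0 < C\<close> by (simp add: gL[OF y] field_simps)
      then show thesis using that \<open>0 < C\<close> by (meson positive_imp_inverse_positive)
    qed
    have tK: "(K \<longlongrightarrow> K y) (at y)"
    proof (rule tendsto_componentwise1)
      fix j :: 'a
      have "((\<lambda>x. L x j) \<longlongrightarrow> L y j) (at y)"
        using contL[of j] y V by (simp add: continuous_on_eq_continuous_at isCont_def)
      then show "((\<lambda>x. blinfun_apply (K x) j) \<longlongrightarrow> blinfun_apply (K y) j) (at y)"
        unfolding apK[OF y] by (rule Lim_transform_within_open[OF _ V y]) (simp add: apK)
    qed
    have ev: "\<forall>\<^sub>F x in at y. norm (g' x v - g' y v) \<le> (2 / B) * norm (L y (g' y v) - L x (g' y v))"
    proof -
      have "\<forall>\<^sub>F x in at y. norm (K x - K y) < B / 2"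
        using tendstoD[OF tK, of "B / 2"] B(1) by (simp add: dist_norm)
      moreover have "\<forall>\<^sub>F x in at y. x \<in> V"
        using V y eventually_at_in_open' by blast
      ultimately show ?thesis
      proof eventually_elim
        case (elim x)
        let ?w = "g' x v - g' y v"
        have "B * norm ?w \<le> norm (L y ?w)" using B by simp
        also have "\<dots> \<le> norm (L x ?w) + norm (blinfun_apply (K x - K y) ?w)"
          using norm_triangle_ineq4[of "L x ?w" "blinfun_apply (K x - K y) ?w"] apK elim y
          by (simp add: blinfun.diff_left)
        also have "norm (blinfun_apply (K x - K y) ?w) \<le> (B / 2) * norm ?w"
          by (rule order_trans[OF norm_blinfun mult_right_mono]) (use elim in auto)
        also have "L x ?w = L y (g' y v) - L x (g' y v)"
          using linL elim y by (simp add: linear_diff Lg)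
        finally show ?case using B(1) by (simp add: field_simps)
      qed
    qed
    have "((\<lambda>x. (2 / B) * norm (L y (g' y v) - L x (g' y v))) \<longlongrightarrow> (2 / B) * norm (L y (g' y v) - L y (g' y v))) (at y)"
      using contL[of "g' y v"] y V
      by (intro tendsto_intros) (simp add: continuous_on_eq_continuous_at isCont_def)
    then have "((\<lambda>x. (2 / B) * norm (L y (g' y v) - L x (g' y v))) \<longlongrightarrow> 0) (at y)" by simp
    from Lim_null_comparison[OF ev this]
    have "((\<lambda>x. g' x v) \<longlongrightarrow> g' y v) (at y)" by (simp add: LIM_zero_iff)
    then show "isCont (\<lambda>y. g' y v) y" by (simp add: isCont_def)
  qed
  show ?thesis
  proof (induction k)
    case 0
    then show ?case using contg C0 by simp
  next
    case (Suc k)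
    have gSuc: "Ck_on (Suc k) V g"
      using Suc g by (auto simp: differentiable_def frechet_derivative_eqI[OF g] Ck_on_cong[OF V, of "\<lambda>x. frechet_derivative g (at x) _"])
    have "Ck_on (Suc k) V (\<lambda>y. g' y v)" for v
    proof -
      define DL where "DL y w u = frechet_derivative (\<lambda>x. frechet_derivative f (at x) w) (at (g y)) u" for y w u
      have dL: "((\<lambda>x. L x w) has_derivative (\<lambda>u. DL y w (g' y u))) (at y)" if "y \<in> V" for y w
        unfolding L_def DL_def
        by (rule has_derivative_compose[OF g[OF that] smooth_on_has_derivative[OF smooth_on_derivative[OF f]]])
          (use gV that in auto)
      have d: "((\<lambda>x. g' x v) has_derivative
          (\<lambda>u. - g' y (\<Sum>j\<in>Basis. (g' y v \<bullet> j) *\<^sub>R DL y j (g' y u)))) (at y)" if y: "y \<in> V" for y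
      proof -
        define K where "K x = Blinfun (L x)" for x
        have apK: "blinfun_apply (K x) = L x" if "x \<in> V" for x
          unfolding K_def using linL[OF that] by (simp add: bounded_linear_Blinfun_apply linear_conv_bounded_linear)
        \<comment> \<open>\<open>R x = (L x - L y) (g' x v)\<close>, expanded so that the factors \<open>L x j - L y j\<close> vanish at \<open>y\<close>.\<close>
        define R where "R x = (\<Sum>j\<in>Basis. (g' x v \<bullet> j) *\<^sub>R (L x j - L y j))" for x
        have R: "g' x v = g' y v - g' y (R x)" if "x \<in> V" for x
        proof -
          have "R x = L x (g' x v) - L y (g' x v)"
            unfolding R_def
            by (subst (2) linear_expand_Basis[OF linL[OF that]], subst (2) linear_expand_Basis[OF linL[OF y]])
              (simp add: scaleR_diff_right sum_subtractf)
          then show ?thesis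
            using linear_diff[OF ling[OF y]] by (simp add: Lg[OF that] gL[OF y])
        qed
        have dj: "((\<lambda>x. (g' x v \<bullet> j) *\<^sub>R (L x j - L y j)) has_derivative
            (\<lambda>u. (g' y v \<bullet> j) *\<^sub>R DL y j (g' y u))) (at y)" for j
        proof -
          have "((\<lambda>x. L x j - L y j) has_derivative (\<lambda>u. DL y j (g' y u))) (at y)"
            using has_derivative_diff[OF dL[OF y, of j] has_derivative_const] by simp
          moreover have "((\<lambda>x. g' x v \<bullet> j) \<longlongrightarrow> g' y v \<bullet> j) (at y)"
            using C0[of v] y V
            by (intro tendsto_intros) (simp add: continuous_on_eq_continuous_at isCont_def)
          ultimately show ?thesis
            by (intro has_derivative_scaleR_vanishing) auto
        qed
        have "(R has_derivative (\<lambda>u. \<Sum>j\<in>Basis. (g' y v \<bullet> j) *\<^sub>R DL y j (g' y u))) (at y)"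
          unfolding R_def by (intro has_derivative_sum dj)
        from has_derivative_diff[OF has_derivative_const
            bounded_linear.has_derivative[OF ling[OF y, unfolded linear_conv_bounded_linear] this], of "g' y v"]
        have "((\<lambda>x. g' y v - g' y (R x)) has_derivative
          (\<lambda>u. - g' y (\<Sum>j\<in>Basis. (g' y v \<bullet> j) *\<^sub>R DL y j (g' y u)))) (at y)" by simp
        then show ?thesis
          by (rule has_derivative_transform_within_open[OF _ V y]) (simp add: R)
      qed
      have expand: "- g' y (\<Sum>j\<in>Basis. (g' y v \<bullet> j) *\<^sub>R DL y j (g' y u))
        = (\<Sum>i\<in>Basis. ((\<Sum>j\<in>Basis. (g' y v \<bullet> j) *\<^sub>R (\<Sum>l\<in>Basis. (g' y u \<bullet> l) *\<^sub>R DL y j l)) \<bullet> i) *\<^sub>R (- g' y i))"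
        if "y \<in> V" for y u
      proof -
        have "linear (DL y j)" for j
          unfolding DL_def using smooth_on_linear_derivative[OF smooth_on_derivative[OF f]] gV that by auto
        then have "DL y j (g' y u) = (\<Sum>l\<in>Basis. (g' y u \<bullet> l) *\<^sub>R DL y j l)" for j
          using linear_expand_Basis by blast
        then show ?thesis
          by (subst linear_expand_Basis[OF ling[OF that]]) (simp add: sum_negf)
      qed
      have CDL: "Ck_on k V (\<lambda>y. DL y j l)" for j l
        using Ck_on_compose[OF V U gV, of k "\<lambda>x. frechet_derivative (\<lambda>x. frechet_derivative f (at x) j) (at x) l"]
          Suc smooth_on_derivative[OF smooth_on_derivative[OF f]]
        unfolding DL_def smooth_on_def o_def by blast
      have neg: "Ck_on k V (\<lambda>y. - g' y i)" for i
        using bounded_bilinear.Ck_on[OF bounded_bilinear_scaleR V Ck_on_const, of k "\<lambda>y. g' y i" "-1"] Suc by simp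
      have "Ck_on k V (\<lambda>y. frechet_derivative (\<lambda>x. g' x v) (at y) u)" for u
      proof -
        have "frechet_derivative (\<lambda>x. g' x v) (at y) u
          = (\<Sum>i\<in>Basis. ((\<Sum>j\<in>Basis. (g' y v \<bullet> j) *\<^sub>R (\<Sum>l\<in>Basis. (g' y u \<bullet> l) *\<^sub>R DL y j l)) \<bullet> i) *\<^sub>R (- g' y i))"
          if "y \<in> V" for y
          using expand[OF that, of u] frechet_derivative_eqI[OF d[OF that]] by simp
        moreover have "Ck_on k V (\<lambda>y. \<Sum>i\<in>Basis. ((\<Sum>j\<in>Basis. (g' y v \<bullet> j) *\<^sub>R
             (\<Sum>l\<in>Basis. (g' y u \<bullet> l) *\<^sub>R DL y j l)) \<bullet> i) *\<^sub>R (- g' y i))"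
          by (intro Ck_on_sum V bounded_bilinear.Ck_on[OF bounded_bilinear_scaleR]
              bounded_bilinear.Ck_on[OF bounded_bilinear_inner] Ck_on_const CDL neg)
            (use Suc in auto)
        ultimately show ?thesis
          using Ck_on_cong[OF V] by (metis (no_types, lifting))
      qed
      then show ?thesis using d by (auto simp: differentiable_def)
    qed
    then show ?case using gSuc by blast
  qed
qed

section \<open>Charts of the maximal atlas\<close>

lemma chart_inv_left: "is_chart c \<Longrightarrow> p \<in> fst c \<Longrightarrow> chart_inv c (snd c p) = p"
  by (simp add: is_chart_def chart_inv_def)

lemma chart_image_iff: "is_chart c \<Longrightarrow> p \<in> fst c \<Longrightarrow> S \<subseteq> fst c \<Longrightarrow> snd c p \<in> snd c ` S \<longleftrightarrow> p \<in> S"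
  by (auto simp: is_chart_def inj_on_def)

abbreviation transit :: "('p, 'e) chart \<Rightarrow> ('p, 'e) chart \<Rightarrow> 'e \<Rightarrow> 'e" where
  "transit c d \<equiv> snd d \<circ> chart_inv c"

abbreviation Dtransit :: "('p, 'e::euclidean_space) chart \<Rightarrow> ('p, 'e) chart \<Rightarrow> 'e \<Rightarrow> 'e \<Rightarrow> 'e" where
  "Dtransit c d z \<equiv> frechet_derivative (transit c d) (at z)"

locale atlas =
  fixes A :: "('p, 'e::euclidean_space) chart set"
  assumes atlas: "smooth_atlas A"
begin

lemma chartsD: "c \<in> charts A \<Longrightarrow> is_chart c" "c \<in> charts A \<Longrightarrow> fst c \<subseteq> points A"
  by (auto simp: charts_def)

lemma atlas_charts: "c \<in> A \<Longrightarrow> c \<in> charts A"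
  using atlas by (auto simp: charts_def smooth_atlas_def points_def)

lemma charts_inv_left: "c \<in> charts A \<Longrightarrow> p \<in> fst c \<Longrightarrow> chart_inv c (snd c p) = p"
  by (rule chart_inv_left[OF chartsD(1)])

lemma charts_image_iff:
  "c \<in> charts A \<Longrightarrow> p \<in> fst c \<Longrightarrow> S \<subseteq> fst c \<Longrightarrow> snd c p \<in> snd c ` S \<longleftrightarrow> p \<in> S"
  by (rule chart_image_iff[OF chartsD(1)])

text \<open>
  The openness condition on \<open>W\<close> is stated in the charts of \<open>A\<close> only, so that \<open>W\<close> may be an open set of the
  manifold as well as the domain of a chart of the maximal atlas.
\<close>

lemma open_chart_image_if:
  assumes c: "c \<in> charts A" and W: "W \<subseteq> points A" "\<forall>e\<in>A. open (snd e ` (fst e \<inter> W))"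
  shows "open (snd c ` (fst c \<inter> W))"
proof (rule openI)
  fix z assume "z \<in> snd c ` (fst c \<inter> W)"
  then obtain p where p: "p \<in> fst c" "p \<in> W" "z = snd c p" by blast
  then obtain e where e: "e \<in> A" "p \<in> fst e" using W by (auto simp: points_def)
  have ce: "compatible c e" and ec: "is_chart e" "e \<in> charts A"
    using c e atlas atlas_charts by (auto simp: charts_def smooth_atlas_def)
  let ?U = "snd c ` (fst c \<inter> fst e) \<inter> transit c e -` (snd e ` (fst e \<inter> W))"
  have "open ?U"
    using ce W e by (intro continuous_open_preimage smooth_on_continuous) (auto simp: compatible_def)
  moreover have "z \<in> ?U"
    using p e by (auto simp: charts_inv_left[OF c])
  moreover have "?U \<subseteq> snd c ` (fst c \<inter> W)"
  proof
    fix x assume "x \<in> ?U"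
    then obtain q where q: "q \<in> fst c" "q \<in> fst e" "x = snd c q" "snd e q \<in> snd e ` (fst e \<inter> W)"
      by (auto simp: charts_inv_left[OF c])
    then have "q \<in> W" using charts_image_iff[OF ec(2) q(2), of "fst e \<inter> W"] by blast
    then show "x \<in> snd c ` (fst c \<inter> W)" using q by blast
  qed
  ultimately show "\<exists>e>0. ball z e \<subseteq> snd c ` (fst c \<inter> W)"
    by (meson open_contains_ball subset_trans)
qed

lemma openin_iff:
  "openin (manifold_topology A) W \<longleftrightarrow> W \<subseteq> points A \<and> (\<forall>c\<in>A. open (snd c ` (fst c \<inter> W)))"
  by (rule openin_manifold_topology[OF atlas])

lemma open_chart_image:
  "c \<in> charts A \<Longrightarrow> openin (manifold_topology A) W \<Longrightarrow> open (snd c ` (fst c \<inter> W))"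
  using open_chart_image_if by (simp add: openin_iff)

lemma openin_chart: "c \<in> charts A \<Longrightarrow> openin (manifold_topology A) (fst c)"
  unfolding openin_iff by (simp add: charts_def compatible_def)

lemma open_transit_domain: "c \<in> charts A \<Longrightarrow> d \<in> charts A \<Longrightarrow> open (snd c ` (fst c \<inter> fst d))"
  by (intro open_chart_image openin_chart)

lemma open_chart_range: "c \<in> charts A \<Longrightarrow> open (snd c ` fst c)"
  using chartsD(1) is_chart_def by blast

lemma charts_points:
  assumes "c \<in> charts A" "p \<in> fst c" obtains e where "e \<in> A" "p \<in> fst e" "e \<in> charts A"
  using assms chartsD atlas_charts by (metis UN_E points_def subset_iff)

text \<open>
  A chart of the maximal atlas is compatible with the charts of \<open>A\<close> only by definition; near each point
  the change of coordinates factors through one of them.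
\<close>

lemma smooth_transit:
  assumes c: "c \<in> charts A" and d: "d \<in> charts A"
  shows "smooth_on (snd c ` (fst c \<inter> fst d)) (transit c d)"
proof (rule smooth_on_local)
  fix z assume "z \<in> snd c ` (fst c \<inter> fst d)"
  then obtain p where p: "p \<in> fst c" "p \<in> fst d" "z = snd c p" by blast
  then obtain e where e: "e \<in> A" "p \<in> fst e" "e \<in> charts A" using charts_points c by metis
  have ce: "compatible c e" "compatible e d"
    using c d e by (auto simp: charts_def)
  let ?U = "snd c ` (fst c \<inter> (fst d \<inter> fst e))"
  have oU: "open ?U"
    by (intro open_chart_image openin_Int openin_chart c d e)
  have "smooth_on ?U (transit e d \<circ> transit c e)"
  proof (rule smooth_on_compose[OF oU])
    show "open (snd e ` (fst e \<inter> fst d))" "smooth_on (snd e ` (fst e \<inter> fst d)) (transit e d)"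
      using ce by (auto simp: compatible_def)
    show "transit c e ` ?U \<subseteq> snd e ` (fst e \<inter> fst d)"
      by (auto simp: charts_inv_left[OF c])
    show "smooth_on ?U (transit c e)"
      using ce(1) unfolding compatible_def by (rule_tac smooth_on_subset[of "snd c ` (fst c \<inter> fst e)"]) auto
  qed
  moreover have "(transit e d \<circ> transit c e) x = transit c d x" if "x \<in> ?U" for x
    using that by (auto simp: charts_inv_left c e)
  ultimately have "smooth_on ?U (transit c d)"
    by (rule smooth_on_transfer[OF oU])
  then show "\<exists>U. open U \<and> z \<in> U \<and> smooth_on U (transit c d)"
    using oU p e by (intro exI[of _ ?U]) auto
qed

lemma Dtransit_has_derivative:
  assumes "c \<in> charts A" "d \<in> charts A" "p \<in> fst c" "p \<in> fst d"
  shows "(transit c d has_derivative Dtransit c d (snd c p)) (at (snd c p))"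
  by (rule smooth_on_has_derivative[OF smooth_transit]) (use assms in auto)

lemma linear_Dtransit:
  assumes "c \<in> charts A" "d \<in> charts A" "p \<in> fst c" "p \<in> fst d"
  shows "linear (Dtransit c d (snd c p))"
  using Dtransit_has_derivative[OF assms] has_derivative_linear by blast

lemma Dtransit_self:
  assumes "c \<in> charts A" "p \<in> fst c"
  shows "Dtransit c c (snd c p) v = v"
proof -
  have "(transit c c has_derivative (\<lambda>v. v)) (at (snd c p))"
    by (rule has_derivative_transform_within_open[OF has_derivative_ident open_chart_range[OF assms(1)]])
      (use assms in \<open>auto simp: charts_inv_left\<close>)
  then show ?thesis by (simp add: frechet_derivative_eqI)
qed

lemma Dtransit_chain:
  assumes "c \<in> charts A" "d \<in> charts A" "e \<in> charts A" "p \<in> fst c" "p \<in> fst d" "p \<in> fst e"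
  shows "Dtransit d e (snd d p) (Dtransit c d (snd c p) v) = Dtransit c e (snd c p) v"
proof -
  let ?U = "snd c ` (fst c \<inter> (fst d \<inter> fst e))"
  have oU: "open ?U"
    by (intro open_chart_image openin_Int openin_chart assms)
  have tp: "transit c d (snd c p) = snd d p" using assms by (simp add: charts_inv_left)
  have "(transit d e \<circ> transit c d has_derivative (Dtransit d e (snd d p) \<circ> Dtransit c d (snd c p))) (at (snd c p))"
    by (rule diff_chain_at) (simp_all only: Dtransit_has_derivative tp assms)
  then have "(transit c e has_derivative (Dtransit d e (snd d p) \<circ> Dtransit c d (snd c p))) (at (snd c p))"
    by (rule has_derivative_transform_within_open[OF _ oU]) (use assms in \<open>auto simp: charts_inv_left\<close>)
  then show ?thesis by (simp add: frechet_derivative_eqI del: comp_apply) simp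
qed

section \<open>Components of vectors, covectors and fields\<close>

lemma chart_at:
  assumes "p \<in> points A" shows "chart_at A p \<in> A" "p \<in> fst (chart_at A p)" "chart_at A p \<in> charts A"
proof -
  have "\<exists>c. c \<in> A \<and> p \<in> fst c" using assms by (auto simp: points_def)
  from someI_ex[OF this] show "chart_at A p \<in> A" "p \<in> fst (chart_at A p)"
    by (auto simp: chart_at_def)
  then show "chart_at A p \<in> charts A" by (simp add: atlas_charts)
qed

lemma chart_points: "c \<in> charts A \<Longrightarrow> p \<in> fst c \<Longrightarrow> p \<in> points A"
  using chartsD(2) by blast

context
  fixes c p assumes c: "c \<in> charts A" and p: "p \<in> fst c"
begin

lemma linear_vec_coord: "linear (vec_coord A c p)"
  unfolding vec_coord_def using linear_Dtransit c p chart_at chart_points by meson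

lemma linear_vec_of_coord: "linear (vec_of_coord A c p)"
  unfolding vec_of_coord_def using linear_Dtransit c p chart_at chart_points by meson

lemma vec_coord_of_coord [simp]: "vec_coord A c p (vec_of_coord A c p w) = w"
  unfolding vec_coord_def vec_of_coord_def
  using Dtransit_chain[of c "chart_at A p" c p] Dtransit_self[OF c p] c p chart_at chart_points by metis

lemma vec_of_coord_coord [simp]: "vec_of_coord A c p (vec_coord A c p v) = v"
  unfolding vec_coord_def vec_of_coord_def
  using Dtransit_chain[of "chart_at A p" c "chart_at A p" p] Dtransit_self c p chart_at chart_points by metis

lemma cov_coord_apply [simp]: "blinfun_apply (cov_coord A c p \<alpha>) w = blinfun_apply \<alpha> (vec_of_coord A c p w)"
  unfolding cov_coord_def
  using linear_compose[OF linear_vec_of_coord bounded_linear.linear[OF blinfun.bounded_linear_right[of \<alpha>]]]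
  by (subst bounded_linear_Blinfun_apply) (auto simp: linear_conv_bounded_linear o_def)

lemma cov_of_coord_apply [simp]: "blinfun_apply (cov_of_coord A c p a) v = blinfun_apply a (vec_coord A c p v)"
  unfolding cov_of_coord_def
  using linear_compose[OF linear_vec_coord bounded_linear.linear[OF blinfun.bounded_linear_right[of a]]]
  by (subst bounded_linear_Blinfun_apply) (auto simp: linear_conv_bounded_linear o_def)

lemma vf_rep_chart: "vf_rep A c X (snd c p) = vec_coord A c p (X p)"
  by (simp add: vf_rep_def charts_inv_left c p)

lemma form_rep_chart_apply:
  "blinfun_apply (form_rep A c \<alpha> (snd c p)) w = blinfun_apply (\<alpha> p) (vec_of_coord A c p w)"
  by (simp add: form_rep_def charts_inv_left c p)

lemma form_vf_rep:
  "blinfun_apply (form_rep A c \<alpha> (snd c p)) (vf_rep A c X (snd c p)) = blinfun_apply (\<alpha> p) (X p)"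
  by (simp add: form_rep_chart_apply vf_rep_chart)

lemma vec_coord_change:
  assumes "d \<in> charts A" "p \<in> fst d"
  shows "vec_coord A d p v = Dtransit c d (snd c p) (vec_coord A c p v)"
  unfolding vec_coord_def
  using Dtransit_chain[of "chart_at A p" c d p] assms c p chart_at chart_points by metis

lemma vec_of_coord_change:
  assumes "d \<in> charts A" "p \<in> fst d"
  shows "vec_of_coord A d p (Dtransit c d (snd c p) w) = vec_of_coord A c p w"
  unfolding vec_of_coord_def
  using Dtransit_chain[of c d "chart_at A p" p] assms c p chart_at chart_points by metis

end

lemma vec_coord_chart_at: "p \<in> points A \<Longrightarrow> vec_coord A (chart_at A p) p v = v"
  unfolding vec_coord_def using Dtransit_self chart_at by blast

lemma vec_of_coord_chart_at: "p \<in> points A \<Longrightarrow> vec_of_coord A (chart_at A p) p v = v"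
  unfolding vec_of_coord_def using Dtransit_self chart_at by blast

lemma vf_rep_change:
  assumes "c \<in> charts A" "d \<in> charts A" "p \<in> fst c" "p \<in> fst d"
  shows "vf_rep A d X (snd d p) = Dtransit c d (snd c p) (vf_rep A c X (snd c p))"
  using assms by (simp add: vf_rep_chart vec_coord_change[of c p d])

lemma form_rep_change:
  assumes "c \<in> charts A" "d \<in> charts A" "p \<in> fst c" "p \<in> fst d"
  shows "blinfun_apply (form_rep A d \<alpha> (snd d p)) (Dtransit c d (snd c p) w) = blinfun_apply (form_rep A c \<alpha> (snd c p)) w"
  using assms by (simp add: form_rep_chart_apply vec_of_coord_change)

lemma smooth_vf_rep:
  assumes X: "smooth_vf A V X" and V: "openin (manifold_topology A) V" and c: "c \<in> charts A"
  shows "smooth_on (snd c ` (fst c \<inter> V)) (vf_rep A c X)"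
proof (rule smooth_on_local)
  fix z assume "z \<in> snd c ` (fst c \<inter> V)"
  then obtain p where p: "p \<in> fst c" "p \<in> V" "z = snd c p" by blast
  then obtain e where e: "e \<in> A" "p \<in> fst e" "e \<in> charts A" using charts_points c by metis
  let ?W = "fst e \<inter> fst c \<inter> V"
  have oW: "openin (manifold_topology A) ?W"
    by (intro openin_Int openin_chart c e V)
  have oe: "open (snd e ` ?W)" and oc: "open (snd c ` ?W)"
    using open_chart_image[OF e(3) oW] open_chart_image[OF c oW] by (simp_all add: Int_absorb1 Int_assoc Int_left_commute)
  have "smooth_on (snd e ` ?W) (\<lambda>y. Dtransit e c y (vf_rep A e X y))"
  proof (rule smooth_on_derivative_fun[OF oe])
    show "smooth_on (snd e ` ?W) (transit e c)"
      by (rule smooth_on_subset[OF smooth_transit[OF e(3) c]]) auto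
    show "smooth_on (snd e ` ?W) (vf_rep A e X)"
      using X e(1) unfolding smooth_vf_def by (rule_tac smooth_on_subset[of "snd e ` (fst e \<inter> V)"]) auto
  qed
  moreover have "smooth_on (snd c ` ?W) (transit c e)"
    by (rule smooth_on_subset[OF smooth_transit[OF c e(3)]]) auto
  ultimately have "smooth_on (snd c ` ?W) ((\<lambda>y. Dtransit e c y (vf_rep A e X y)) \<circ> transit c e)"
    by (intro smooth_on_compose[OF oc oe]) (auto simp: charts_inv_left[OF c])
  then have "smooth_on (snd c ` ?W) (vf_rep A c X)"
    by (rule smooth_on_transfer[OF oc]) (auto simp: charts_inv_left c e vf_rep_change[of e c])
  then show "\<exists>U. open U \<and> z \<in> U \<and> smooth_on U (vf_rep A c X)"
    using oc p e by (intro exI[of _ "snd c ` ?W"]) auto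
qed

lemma smooth_form_rep:
  assumes X: "smooth_form A V \<alpha>" and V: "openin (manifold_topology A) V" and c: "c \<in> charts A"
  shows "smooth_on (snd c ` (fst c \<inter> V)) (form_rep A c \<alpha>)"
proof (rule smooth_on_local)
  fix z assume "z \<in> snd c ` (fst c \<inter> V)"
  then obtain p where p: "p \<in> fst c" "p \<in> V" "z = snd c p" by blast
  then obtain e where e: "e \<in> A" "p \<in> fst e" "e \<in> charts A" using charts_points c by metis
  let ?W = "fst e \<inter> fst c \<inter> V"
  have oW: "openin (manifold_topology A) ?W"
    by (intro openin_Int openin_chart c e V)
  have oe: "open (snd e ` ?W)" and oc: "open (snd c ` ?W)"
    using open_chart_image[OF e(3) oW] open_chart_image[OF c oW] by (simp_all add: Int_absorb1 Int_assoc Int_left_commute)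
  have ce: "smooth_on (snd c ` ?W) (transit c e)"
    by (rule smooth_on_subset[OF smooth_transit[OF c e(3)]]) auto
  have "smooth_on (snd c ` ?W) (form_rep A c \<alpha>)"
  proof (rule smooth_on_blinfun_componentwise[OF oc])
    fix j :: 'e assume "j \<in> Basis"
    have "smooth_on (snd e ` ?W) (form_rep A e \<alpha>)"
      using X e(1) unfolding smooth_form_def by (rule_tac smooth_on_subset[of "snd e ` (fst e \<inter> V)"]) auto
    then have "smooth_on (snd c ` ?W) (form_rep A e \<alpha> \<circ> transit c e)"
      by (intro smooth_on_compose[OF oc oe _ ce]) (auto simp: charts_inv_left[OF c])
    then have "smooth_on (snd c ` ?W) (\<lambda>z. blinfun_apply ((form_rep A e \<alpha> \<circ> transit c e) z) (Dtransit c e z j))"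
      by (intro smooth_on_blinfun_apply oc smooth_on_derivative ce)
    then show "smooth_on (snd c ` ?W) (\<lambda>z. blinfun_apply (form_rep A c \<alpha> z) j)"
      by (rule smooth_on_transfer[OF oc]) (auto simp: charts_inv_left c e form_rep_change)
  qed
  then show "\<exists>U. open U \<and> z \<in> U \<and> smooth_on U (form_rep A c \<alpha>)"
    using oc p e by (intro exI[of _ "snd c ` ?W"]) auto
qed

section \<open>Tangent spaces of slices\<close>

text \<open>
  The coordinates that vanish on \<open>Q\<close> vanish along every curve of \<open>Q\<close>, hence on its velocity. Conversely,
  a vector with this property is the velocity of a straight line in the chart, which stays in the slice.
\<close>

lemma tangent_space_slice:
  assumes c: "c \<in> charts A" and p: "p \<in> fst c" "p \<in> Q"
    and slice: "snd c ` (fst c \<inter> Q) = {z \<in> snd c ` fst c. \<forall>a\<in>J. z \<bullet> a = 0}"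
  shows "tangent_space A Q p = {v. \<forall>a\<in>J. vec_coord A c p v \<bullet> a = 0}"
proof (intro set_eqI iffI)
  let ?k = "chart_at A p"
  have k: "?k \<in> charts A" "p \<in> fst ?k" using chart_at chart_points c p by blast+
  have mem: "q \<in> Q \<longleftrightarrow> (\<forall>a\<in>J. snd c q \<bullet> a = 0)" if "q \<in> fst c" for q
    using charts_image_iff[OF c that, of "fst c \<inter> Q"] slice that by auto
  fix v
  {
    assume "v \<in> tangent_space A Q p"
    then obtain \<epsilon> \<gamma> where "\<epsilon> > 0" and \<gamma>: "\<gamma> 0 = p" "\<gamma> ` {-\<epsilon><..<\<epsilon>} \<subseteq> Q \<inter> fst ?k"
      and d: "((snd ?k \<circ> \<gamma>) has_vector_derivative v) (at 0)"
      by (auto simp: tangent_space_def)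
    let ?U = "snd ?k ` (fst ?k \<inter> fst c)"
    have oU: "open ?U" by (rule open_transit_domain[OF k(1) c])
    have "isCont (snd ?k \<circ> \<gamma>) 0"
      using d by (simp add: has_vector_derivative_continuous)
    moreover have "(snd ?k \<circ> \<gamma>) 0 \<in> ?U" using \<gamma>(1) p k by auto
    ultimately have "\<exists>S. open S \<and> 0 \<in> S \<and> (\<forall>t\<in>S. (snd ?k \<circ> \<gamma>) t \<in> ?U)"
      using oU unfolding continuous_at_open by simp
    then obtain S where S: "open S" "0 \<in> S" "\<And>t. t \<in> S \<Longrightarrow> (snd ?k \<circ> \<gamma>) t \<in> ?U"
      by blast
    let ?S = "S \<inter> {-\<epsilon><..<\<epsilon>}"
    have in_c: "\<gamma> t \<in> fst c" if "t \<in> ?S" for t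
    proof -
      have "\<gamma> t \<in> fst ?k" using \<gamma>(2) that by auto
      then show ?thesis
        using S(3)[of t] that charts_image_iff[OF k(1), of "\<gamma> t" "fst ?k \<inter> fst c"] by auto
    qed
    have "((transit ?k c \<circ> (snd ?k \<circ> \<gamma>)) has_derivative (Dtransit ?k c (snd ?k p) \<circ> (\<lambda>t. t *\<^sub>R v))) (at 0)"
      using d \<gamma>(1) Dtransit_has_derivative[OF k(1) c k(2) p(1)]
      by (intro diff_chain_at) (auto simp: has_vector_derivative_def)
    then have dc: "((\<lambda>t. snd c (\<gamma> t)) has_derivative (Dtransit ?k c (snd ?k p) \<circ> (\<lambda>t. t *\<^sub>R v))) (at 0)"
    proof (rule has_derivative_transform_within_open)
      show "open ?S" using S by auto
      show "0 \<in> ?S" using S \<open>\<epsilon> > 0\<close> by auto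
      fix t assume "t \<in> ?S"
      then have "\<gamma> t \<in> fst ?k" using \<gamma>(2) by auto
      then show "(transit ?k c \<circ> (snd ?k \<circ> \<gamma>)) t = snd c (\<gamma> t)" by (simp add: charts_inv_left k)
    qed
    have "vec_coord A c p v \<bullet> a = 0" if "a \<in> J" for a
    proof -
      have "((\<lambda>t. snd c (\<gamma> t) \<bullet> a) has_derivative (\<lambda>t. (Dtransit ?k c (snd ?k p) \<circ> (\<lambda>t. t *\<^sub>R v)) t \<bullet> a)) (at 0)"
        by (rule bounded_linear.has_derivative[OF bounded_linear_inner_left dc])
      moreover have "((\<lambda>t. snd c (\<gamma> t) \<bullet> a) has_derivative (\<lambda>t. 0)) (at 0)"
      proof (rule has_derivative_transform_within_open)
        show "((\<lambda>t. 0::real) has_derivative (\<lambda>t. 0)) (at 0)" by simp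
        show "open ?S" using S by auto
        show "0 \<in> ?S" using S \<open>\<epsilon> > 0\<close> by auto
        fix t assume t: "t \<in> ?S"
        then have "\<gamma> t \<in> Q" using \<gamma>(2) by auto
        then show "0 = snd c (\<gamma> t) \<bullet> a" using mem[OF in_c[OF t]] that by simp
      qed
      ultimately have "(Dtransit ?k c (snd ?k p) \<circ> (\<lambda>t. t *\<^sub>R v)) 1 \<bullet> a = 0"
        using has_derivative_unique by (metis (no_types, lifting))
      then show ?thesis by (simp add: vec_coord_def)
    qed
    then show "v \<in> {v. \<forall>a\<in>J. vec_coord A c p v \<bullet> a = 0}" by blast
  next
    assume "v \<in> {v. \<forall>a\<in>J. vec_coord A c p v \<bullet> a = 0}"
    then have v: "\<And>a. a \<in> J \<Longrightarrow> vec_coord A c p v \<bullet> a = 0" by blast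
    let ?w = "vec_coord A c p v" and ?z = "snd c p"
    let ?U = "snd c ` (fst c \<inter> fst ?k)"
    have oU: "open ?U" by (rule open_transit_domain[OF c k(1)])
    have "?z \<in> ?U" using p k by auto
    then obtain r where "r > 0" and r: "ball ?z r \<subseteq> ?U" using oU openE by blast
    define \<epsilon> where "\<epsilon> = r / (norm ?w + 1)"
    have n: "norm ?w + 1 > 0" by (smt (verit) norm_ge_zero)
    have "\<epsilon> > 0" using \<open>r > 0\<close> n by (simp add: \<epsilon>_def)
    define line where "line t = ?z + t *\<^sub>R ?w" for t
    have l: "line t \<in> ?U" if "t \<in> {-\<epsilon><..<\<epsilon>}" for t
    proof -
      have "norm (t *\<^sub>R ?w) \<le> \<bar>t\<bar> * (norm ?w + 1)" by (simp add: algebra_simps)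
      also have "\<dots> < \<epsilon> * (norm ?w + 1)" using that n by (simp add: abs_less_iff)
      also have "\<dots> = r" using n by (simp add: \<epsilon>_def)
      finally show ?thesis using r by (auto simp: line_def dist_norm subset_eq)
    qed
    define \<gamma> where "\<gamma> t = chart_inv c (line t)" for t
    have g: "\<gamma> t \<in> fst c \<inter> fst ?k" "snd c (\<gamma> t) = line t" if "t \<in> {-\<epsilon><..<\<epsilon>}" for t
      using l[OF that] by (auto simp: \<gamma>_def charts_inv_left[OF c])
    have "p \<in> Q \<longleftrightarrow> (\<forall>a\<in>J. ?z \<bullet> a = 0)" by (rule mem[OF p(1)])
    then have gQ: "\<gamma> t \<in> Q" if "t \<in> {-\<epsilon><..<\<epsilon>}" for t
      using mem[of "\<gamma> t"] g[OF that] p v by (simp add: line_def inner_add_left)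
    have sl: "smooth_on {-\<epsilon><..<\<epsilon>} line"
      unfolding line_def
      by (intro smooth_on_add smooth_on_const open_greaterThanLessThan
          smooth_on_bounded_linear bounded_linear_scaleR_left)
    have "smooth_on {-\<epsilon><..<\<epsilon>} (transit c ?k \<circ> line)"
      using l by (intro smooth_on_compose[OF _ oU _ sl smooth_transit[OF c k(1)]]) auto
    then have s: "smooth_on {-\<epsilon><..<\<epsilon>} (snd ?k \<circ> \<gamma>)"
      by (simp add: \<gamma>_def[abs_def] o_def)
    have "((transit c ?k \<circ> line) has_derivative (Dtransit c ?k ?z \<circ> (\<lambda>t. t *\<^sub>R ?w))) (at 0)"
    proof (rule diff_chain_at)
      show "(line has_derivative (\<lambda>t. t *\<^sub>R ?w)) (at 0)"
        unfolding line_def by (auto intro!: derivative_eq_intros)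
      show "(transit c ?k has_derivative Dtransit c ?k ?z) (at (line 0))"
        using Dtransit_has_derivative[OF c k(1) p(1) k(2)] by (simp add: line_def)
    qed
    moreover have "Dtransit c ?k ?z ?w = v"
      using vec_of_coord_coord[OF c p(1)] by (simp add: vec_of_coord_def)
    ultimately have "((snd ?k \<circ> \<gamma>) has_vector_derivative v) (at 0)"
      using linear_scale[OF linear_Dtransit[OF c k(1) p(1) k(2)], of _ ?w]
      by (simp add: has_vector_derivative_def \<gamma>_def[abs_def] o_def)
    moreover have "\<gamma> 0 = p" by (simp add: \<gamma>_def line_def charts_inv_left c p)
    ultimately show "v \<in> tangent_space A Q p"
      using \<open>\<epsilon> > 0\<close> g gQ s unfolding tangent_space_def by blast
  }
qed

end

section \<open>Maximal isotropic subspaces\<close>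

lemma basis_family_iff:
  fixes f :: "'i \<Rightarrow> 'v::real_vector"
  assumes J: "finite J"
  shows "basis_family J f L \<longleftrightarrow>
    (\<forall>c. (\<Sum>j\<in>J. c j *\<^sub>R f j) = 0 \<longrightarrow> (\<forall>j\<in>J. c j = 0)) \<and> L = range (\<lambda>c. \<Sum>j\<in>J. c j *\<^sub>R f j)"
proof -
  have span: "span (f ` J) = range (\<lambda>c. \<Sum>j\<in>J. c j *\<^sub>R f j)"
  proof (intro equalityI subsetI)
    fix x assume "x \<in> span (f ` J)"
    then show "x \<in> range (\<lambda>c. \<Sum>j\<in>J. c j *\<^sub>R f j)"
    proof (induction rule: span_induct_alt)
      case base
      then show ?case by (auto intro!: range_eqI[of _ _ "\<lambda>_. 0"])
    next
      case (step a v y)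
      then obtain i c where i: "i \<in> J" "v = f i" and y: "y = (\<Sum>j\<in>J. c j *\<^sub>R f j)" by auto
      have "a *\<^sub>R v + y = (\<Sum>j\<in>J. (if j = i then a else 0) *\<^sub>R f j) + (\<Sum>j\<in>J. c j *\<^sub>R f j)"
        using i J y by (simp add: if_distrib[of "\<lambda>a. a *\<^sub>R _"] sum.delta' cong: if_cong)
      also have "\<dots> = (\<Sum>j\<in>J. ((if j = i then a else 0) + c j) *\<^sub>R f j)"
        by (simp add: scaleR_left_distrib sum.distrib)
      finally show ?case
        by (intro image_eqI[where x = "\<lambda>j. (if j = i then a else 0) + c j"]) simp_all
    qed
  next
    fix x assume "x \<in> range (\<lambda>c. \<Sum>j\<in>J. c j *\<^sub>R f j)"
    then show "x \<in> span (f ` J)" by (auto intro!: span_sum span_scale intro: span_base)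
  qed
  have ind: "inj_on f J \<and> independent (f ` J) \<longleftrightarrow>
      (\<forall>c. (\<Sum>j\<in>J. c j *\<^sub>R f j) = 0 \<longrightarrow> (\<forall>j\<in>J. c j = 0))" (is "?l \<longleftrightarrow> ?r")
  proof
    assume l: ?l
    show ?r
    proof (intro allI impI ballI)
      fix c j assume c: "(\<Sum>j\<in>J. c j *\<^sub>R f j) = 0" and j: "j \<in> J"
      have "(\<Sum>v\<in>f ` J. c (inv_into J f v) *\<^sub>R v) = (\<Sum>j\<in>J. c j *\<^sub>R f j)"
        using l by (subst sum.reindex) auto
      then have "c (inv_into J f (f j)) = 0"
        using l c j J by (intro independentD[of "f ` J" "f ` J" "\<lambda>v. c (inv_into J f v)"]) auto
      then show "c j = 0" using l j by simp
    qed
  next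
    assume r: ?r
    have inj: "inj_on f J"
    proof (rule inj_onI, rule ccontr)
      fix i j assume ij: "i \<in> J" "j \<in> J" "f i = f j" "i \<noteq> j"
      let ?c = "\<lambda>k. (if k = i then 1 else 0) - (if k = j then 1 else (0::real))"
      have "(\<Sum>k\<in>J. ?c k *\<^sub>R f k) = 0"
        using ij J by (simp add: scaleR_diff_left sum_subtractf if_distrib[of "\<lambda>a. a *\<^sub>R _"] cong: if_cong)
      then have "\<forall>k\<in>J. ?c k = 0" by (rule mp[OF spec[OF r, of ?c]])
      then show False using ij by (auto dest: bspec[of _ _ i])
    qed
    moreover have "independent (f ` J)"
    proof (rule independent_if_scalars_zero)
      fix g x assume "(\<Sum>x\<in>f ` J. g x *\<^sub>R x) = 0" "x \<in> f ` J"
      then show "g x = 0" using r inj by (auto simp: sum.reindex)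
    qed (use J in simp)
    ultimately show ?l by blast
  qed
  show ?thesis unfolding basis_family_def using ind span by auto
qed

lemma basis_family_reindex:
  "bij_betw \<pi> J J' \<Longrightarrow> basis_family J' f L \<Longrightarrow> basis_family J (f \<circ> \<pi>) L"
  unfolding basis_family_def bij_betw_def by (metis comp_inj_on image_comp)

text \<open>
  Covectors are turned into vectors by the Euclidean structure. This makes the pairing \<open>g\<close> the split
  form \<open>(X \<bullet> Y' + X' \<bullet> Y) / 2\<close> on \<open>'e \<times> 'e\<close>, and puts the vector part and the covector part of a section
  on the same footing.
\<close>

definition sharp :: "('e::euclidean_space \<Rightarrow>\<^sub>L real) \<Rightarrow> 'e" where
  "sharp \<alpha> = (\<Sum>j\<in>Basis. blinfun_apply \<alpha> j *\<^sub>R j)"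

lemma inner_sharp: "sharp \<alpha> \<bullet> v = blinfun_apply \<alpha> v"
  using linear_expand_Basis[OF bounded_linear.linear[OF blinfun.bounded_linear_right[of \<alpha>]], of v]
  by (simp add: sharp_def inner_sum_left inner_commute[of v] mult.commute)

lemma linear_sharp: "linear sharp"
  by (rule linearI)
    (simp_all add: sharp_def blinfun.add_left blinfun.scaleR_left scaleR_left_distrib sum.distrib scaleR_sum_right)

lemma sharp_eq_iff: "sharp \<alpha> = sharp \<beta> \<longleftrightarrow> \<alpha> = \<beta>"
  by (metis blinfun_eqI inner_sharp)

lemma sharp_inner_left: "sharp (blinfun_inner_left v) = v"
  by (rule euclidean_eqI) (subst inner_sharp, simp add: inner_commute)

definition sharp2 :: "'e::euclidean_space big_fibre \<Rightarrow> 'e \<times> 'e" where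
  "sharp2 a = (fst a, sharp (snd a))"

lemma linear_sharp2: "linear sharp2"
  by (rule linearI) (simp_all add: sharp2_def linear_add[OF linear_sharp] linear_scale[OF linear_sharp])

lemma inj_sharp2: "inj sharp2"
  by (rule injI) (simp add: sharp2_def sharp_eq_iff prod_eq_iff)

lemma surj_sharp2: "surj sharp2"
  by (rule surjI[of _ "\<lambda>b. (fst b, blinfun_inner_left (snd b))"]) (simp add: sharp2_def sharp_inner_left)

lemma g_pairing_sharp2: "g_pairing a b = (prod.swap (sharp2 a) \<bullet> sharp2 b) / 2"
  by (simp add: g_pairing_def sharp2_def inner_prod_def inner_sharp inner_commute[of "fst a"])

text \<open>
  The split form is definite on the diagonal \<open>P\<close> and on the antidiagonal \<open>M\<close>, which are orthogonal to each
  other. An isotropic \<open>L\<close> meets \<open>P\<close> trivially, so \<open>dim L \<le> n\<close>. If \<open>dim L < n\<close>, the orthogonal space \<open>K\<close> of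
  \<open>L\<close> meets both \<open>P\<close> and \<open>M\<close> nontrivially, and a suitable sum of a vector in \<open>K \<inter> P\<close> and a vector in \<open>K \<inter> M\<close> is isotropic
  and outside \<open>L\<close>, against maximality. Thus \<open>dim L = n = dim K\<close>, and \<open>L = K\<close>.
\<close>

lemma isotropic_split:
  fixes L :: "('e::euclidean_space \<times> 'e) set"
  assumes L: "subspace L" and iso: "\<And>a b. a \<in> L \<Longrightarrow> b \<in> L \<Longrightarrow> prod.swap a \<bullet> b = 0"
    and max: "\<And>a. (\<And>b. b \<in> L \<Longrightarrow> prod.swap a \<bullet> b = 0) \<Longrightarrow> prod.swap a \<bullet> a = 0 \<Longrightarrow> a \<in> L"
  shows "dim L = DIM('e)" "(\<And>b. b \<in> L \<Longrightarrow> prod.swap a \<bullet> b = 0) \<Longrightarrow> a \<in> L"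
proof -
  let ?n = "DIM('e)"
  define P where "P = range (\<lambda>v::'e. (v, v))"
  define M where "M = range (\<lambda>v::'e. (v, -v))"
  define K where "K = {y \<in> UNIV. \<forall>x\<in>prod.swap ` L. orthogonal x y}"
  have sw: "linear (prod.swap :: 'e \<times> 'e \<Rightarrow> 'e \<times> 'e)"
    by (rule linearI) (auto simp: prod.swap_def)
  have swi: "prod.swap (a :: 'e \<times> 'e) \<bullet> b = prod.swap b \<bullet> a" for a b
    by (simp add: inner_prod_def inner_commute add.commute)
  have linP: "linear (\<lambda>v::'e. (v, v))" and linM: "linear (\<lambda>v::'e. (v, -v))"
    by (auto intro!: linearI)
  have sP: "subspace P" and sM: "subspace M"
    unfolding P_def M_def using linP linM by (auto intro: linear_subspace_image)
  have dP: "dim P = ?n" and dM: "dim M = ?n"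
    unfolding P_def M_def using dim_image_eq[OF linP] dim_image_eq[OF linM] by (auto simp: inj_on_def)
  have sK: "subspace K"
    unfolding K_def by (auto simp: subspace_def orthogonal_def inner_add_right)
  have mem_K: "y \<in> K \<longleftrightarrow> (\<forall>b\<in>L. prod.swap y \<bullet> b = 0)" for y
    unfolding K_def orthogonal_def using swi by auto
  have "dim (prod.swap ` L) = dim L"
    by (rule dim_image_eq[OF sw]) (auto simp: inj_on_def)
  then have dK: "dim K + dim L = 2 * ?n"
    using dim_subspace_orthogonal_to_vectors[of "prod.swap ` L" UNIV] linear_subspace_image[OF sw L]
    by (simp add: K_def)
  have le: "dim {x + y |x y. x \<in> S \<and> y \<in> T} \<le> 2 * ?n" for S T :: "('e \<times> 'e) set"
    using dim_subset_UNIV[of "{x + y |x y. x \<in> S \<and> y \<in> T}"] by simp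
  have "v = 0" if "(v, v) \<in> L" for v
    using iso[OF that that] by (simp add: inner_prod_def)
  then have "L \<inter> P = {0}"
    using subspace_0[OF L] subspace_0[OF sP] by (auto simp: P_def zero_prod_def)
  then have "dim L \<le> ?n"
    using dim_sums_Int[OF L sP] dP le[of L P] by simp
  moreover have "\<not> dim L < ?n"
  proof
    assume less: "dim L < ?n"
    have "dim (K \<inter> P) > 0" "dim (K \<inter> M) > 0"
      using dim_sums_Int[OF sK sP] dim_sums_Int[OF sK sM] dP dM le[of K P] le[of K M] dK less by auto
    then have "\<not> K \<inter> P \<subseteq> {0}" "\<not> K \<inter> M \<subseteq> {0}"
      by (metis dim_eq_0 less_irrefl)+
    then obtain p m where p: "p \<in> K" "p \<in> P" "p \<noteq> 0" and m: "m \<in> K" "m \<in> M" "m \<noteq> 0"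
      by blast
    obtain u v where u: "p = (u, u)" and v: "m = (v, -v)" using p m by (auto simp: P_def M_def)
    \<comment> \<open>The form takes the value \<open>2 |u|\<^sup>2\<close> on \<open>p\<close> and \<open>- 2 |v|\<^sup>2\<close> on \<open>m\<close>; \<open>t\<close> balances them.\<close>
    define t where "t = norm u / norm v"
    have un: "u \<noteq> 0" "v \<noteq> 0" using u v p m by (auto simp: zero_prod_def)
    let ?a = "p + t *\<^sub>R m"
    have aK: "?a \<in> K" using p m sK by (simp add: subspace_add subspace_scale)
    have "t\<^sup>2 * (norm v)\<^sup>2 = (norm u)\<^sup>2" using un by (simp add: t_def power_divide)
    then have "t * t * (v \<bullet> v) = u \<bullet> u"
      by (simp add: power2_eq_square[of t] power2_norm_eq_inner)
    then have "prod.swap ?a \<bullet> ?a = 0"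
      by (simp add: u v inner_prod_def inner_add_left inner_add_right inner_diff_left inner_diff_right
          inner_commute algebra_simps)
    then have "?a \<in> L" using max[of ?a] aK by (simp add: mem_K)
    then have "prod.swap p \<bullet> ?a = 0" using p(1) mem_K by blast
    then have "u \<bullet> u = 0" by (simp add: u v inner_prod_def algebra_simps)
    then show False using un by simp
  qed
  ultimately show dL: "dim L = ?n" by simp
  have "L \<subseteq> K" using iso mem_K by blast
  then have "L = K" using dK dL subspace_dim_equal[OF L sK] by simp
  then show "a \<in> L" if "\<And>b. b \<in> L \<Longrightarrow> prod.swap a \<bullet> b = 0"
    using that mem_K by blast
qed

text \<open>
  Maximality among subspaces, applied to the span of \<open>L\<close> and one more vector, becomes the elementwise
  form of maximality.
\<close>

lemma maximal_g_isotropic_split: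
  fixes L :: "'e::euclidean_space big_fibre set"
  assumes "maximal_g_isotropic L"
  shows "subspace (sharp2 ` L)"
    "\<And>a b. a \<in> sharp2 ` L \<Longrightarrow> b \<in> sharp2 ` L \<Longrightarrow> prod.swap a \<bullet> b = 0"
    "\<And>a. (\<And>b. b \<in> sharp2 ` L \<Longrightarrow> prod.swap a \<bullet> b = 0) \<Longrightarrow> prod.swap a \<bullet> a = 0 \<Longrightarrow> a \<in> sharp2 ` L"
proof -
  have sL: "subspace L" and iso: "\<And>a b. a \<in> L \<Longrightarrow> b \<in> L \<Longrightarrow> g_pairing a b = 0"
    using assms by (auto simp: maximal_g_isotropic_def g_isotropic_def)
  show "subspace (sharp2 ` L)" by (rule linear_subspace_image[OF linear_sharp2 sL])
  show "\<And>a b. a \<in> sharp2 ` L \<Longrightarrow> b \<in> sharp2 ` L \<Longrightarrow> prod.swap a \<bullet> b = 0"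
    using iso by (auto simp: g_pairing_sharp2)
  fix a :: "'e \<times> 'e"
  assume a: "\<And>b. b \<in> sharp2 ` L \<Longrightarrow> prod.swap a \<bullet> b = 0" "prod.swap a \<bullet> a = 0"
  obtain a' where a': "a = sharp2 a'" using surj_sharp2 by (metis surjD)
  let ?L = "{x + y |x y. x \<in> L \<and> y \<in> span {a'}}"
  have pa: "g_pairing a' b = 0" "g_pairing b a' = 0" if "b \<in> L" for b
    using a(1)[of "sharp2 b"] that
    by (auto simp: a' g_pairing_sharp2 inner_prod_def inner_commute add.commute)
  have "g_isotropic ?L"
    unfolding g_isotropic_def
  proof (intro conjI ballI)
    show "subspace ?L" by (rule subspace_sums[OF sL subspace_span])
    fix x y assume "x \<in> ?L" "y \<in> ?L"
    then obtain b r' c s' where x': "x = b + r'" "b \<in> L" "r' \<in> span {a'}"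
      and y': "y = c + s'" "c \<in> L" "s' \<in> span {a'}" by blast
    then obtain r s where "r' = r *\<^sub>R a'" "s' = s *\<^sub>R a'" by (auto simp: span_singleton)
    with x' y' have x: "x = b + r *\<^sub>R a'" "b \<in> L" and y: "y = c + s *\<^sub>R a'" "c \<in> L" by auto
    have "g_pairing x y = g_pairing b c + s * g_pairing b a' + r * g_pairing a' c + r * s * g_pairing a' a'"
      by (simp add: x y g_pairing_def blinfun.add_left blinfun.add_right blinfun.scaleR_left
          blinfun.scaleR_right algebra_simps add_divide_distrib)
    then show "g_pairing x y = 0"
      using iso[OF x(2) y(2)] pa[OF x(2)] pa[OF y(2)] a(2) by (simp add: a' g_pairing_sharp2[of a' a'])
  qed
  moreover have "L \<subseteq> ?L"
  proof
    fix x assume "x \<in> L" then show "x \<in> ?L"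
      by (intro CollectI exI[of _ x] exI[of _ 0]) (simp add: span_zero)
  qed
  ultimately have "?L = L" using assms by (auto simp: maximal_g_isotropic_def)
  moreover have "a' \<in> ?L"
    by (intro CollectI exI[of _ 0] exI[of _ a']) (simp add: subspace_0[OF sL] span_base)
  ultimately show "a \<in> sharp2 ` L" by (simp add: a')
qed

lemma maximal_g_isotropic_perp:
  fixes L :: "'e::euclidean_space big_fibre set"
  assumes L: "maximal_g_isotropic L" and a: "\<And>b. b \<in> L \<Longrightarrow> g_pairing a b = 0"
  shows "a \<in> L"
proof -
  have "sharp2 a \<in> sharp2 ` L"
    by (rule isotropic_split(2)[OF maximal_g_isotropic_split[OF L]])
      (use a in \<open>auto simp: g_pairing_sharp2\<close>)
  then show ?thesis using inj_sharp2 by (auto dest: injD)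
qed

lemma maximal_g_isotropic_card_basis:
  fixes L :: "'e::euclidean_space big_fibre set"
  assumes L: "maximal_g_isotropic L" and f: "basis_family J f L" and J: "finite J"
  shows "card J = DIM('e)"
proof -
  have "basis_family J (sharp2 \<circ> f) (sharp2 ` L)"
  proof -
    have s: "(\<Sum>j\<in>J. c j *\<^sub>R sharp2 (f j)) = sharp2 (\<Sum>j\<in>J. c j *\<^sub>R f j)" for c
      by (simp add: linear_sum[OF linear_sharp2] linear_scale[OF linear_sharp2])
    have "sharp2 a = 0 \<longleftrightarrow> a = 0" for a :: "'e big_fibre"
      using injD[OF inj_sharp2, of a 0] linear_0[OF linear_sharp2] by auto
    then show ?thesis
      using f unfolding basis_family_iff[OF J] o_def s by (simp add: image_image)
  qed
  then have "dim (sharp2 ` L) = card J"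
    unfolding basis_family_def by (metis card_image dim_eq_card_independent dim_span)
  moreover have "dim (sharp2 ` L) = DIM('e)"
    by (rule isotropic_split(1)) (fact maximal_g_isotropic_split[OF L])+
  ultimately show ?thesis by simp
qed

section \<open>Linear algebra of the two systems\<close>

text \<open>
  The property of a frame \<open>(F\<^sub>i, G\<^sub>i)\<close> of a maximal isotropic subspace that the linear algebra below
  uses: if \<open>x\<close> is orthogonal to all \<open>F\<^sub>i\<close>, then \<open>(0, x)\<close> is orthogonal to the subspace and therefore in
  it. It holds for (vectors, covectors) and for (covectors, vectors), which is the symmetry between the
  isotropic and the coisotropic case.
\<close>

definition maximal_pair :: "('e::euclidean_space \<Rightarrow> 'e) \<Rightarrow> ('e \<Rightarrow> 'e) \<Rightarrow> bool" where
  "maximal_pair F G \<longleftrightarrow> (\<forall>x. (\<forall>i\<in>Basis. x \<bullet> F i = 0) \<longrightarrow>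
     (\<exists>\<mu>. (\<Sum>i\<in>Basis. \<mu> i *\<^sub>R G i) = x \<and> (\<Sum>i\<in>Basis. \<mu> i *\<^sub>R F i) = 0))"

text \<open>
  The common form of (T) and (A): \<open>F\<^sub>i\<close> are the vectors or the covectors of a frame at a point of \<open>N\<close>,
  \<open>DF\<^sub>i\<close> their derivatives; \<open>lam\<close> collects the unknowns \<open>\<lambda>, \<nu>\<close> and \<open>\<mu>\<close> the unknowns \<open>\<mu>, \<xi>\<close>.
\<close>

definition jet_system where
  "jet_system I F DF lam \<mu> \<longleftrightarrow>
    (\<forall>s\<in>I. (\<Sum>i\<in>Basis. \<mu> i * (F i \<bullet> s)) = 0) \<and>
    (\<forall>h\<in>Basis - I. (\<Sum>i\<in>Basis. lam i * (F i \<bullet> h)) = 0) \<and>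
    (\<forall>s\<in>I. \<forall>h\<in>Basis - I. (\<Sum>i\<in>Basis. lam i * (DF i h \<bullet> s)) = (0::real))"
  for I :: "'e::euclidean_space set" and F :: "'e \<Rightarrow> 'e" and DF :: "'e \<Rightarrow> 'e \<Rightarrow> 'e"

text \<open>
  With vectors for \<open>F\<close>, this says that \<open>\<Sum> lam\<^sub>i X\<^sub>i\<^sup>C + \<mu>\<^sub>i X\<^sub>i\<^sup>V\<close> is tangent to the normal bundle at the
  point with fibre coordinates \<open>w\<close>; with covectors, that \<open>\<Sum> lam\<^sub>i \<alpha>\<^sub>i\<^sup>C + \<mu>\<^sub>i \<alpha>\<^sub>i\<^sup>V\<close> annihilates the tangent
  space there.
\<close>

definition point_system where
  "point_system I F DF w lam \<mu> \<longleftrightarrow>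
    (\<forall>s\<in>I. (\<Sum>i\<in>Basis. lam i * (DF i w \<bullet> s) + \<mu> i * (F i \<bullet> s)) = 0) \<and>
    (\<forall>h\<in>Basis - I. (\<Sum>i\<in>Basis. lam i * (F i \<bullet> h)) = (0::real))"
  for I :: "'e::euclidean_space set" and F :: "'e \<Rightarrow> 'e" and DF :: "'e \<Rightarrow> 'e \<Rightarrow> 'e"

text \<open>
  A solution of the jet system solves the point systems at all \<open>w\<close>. The point systems at \<open>w = 0\<close> and
  \<open>w = h\<close> give back the equations of the jet system.
\<close>

lemma point_systems_imp_jet_systems:
  assumes lin: "\<And>i. i \<in> Basis \<Longrightarrow> linear (DF i)" "\<And>i. i \<in> Basis \<Longrightarrow> linear (DG i)"
    and imp: "\<And>w lam \<mu>. w \<in> span (Basis - I) \<Longrightarrow> point_system I F DF w lam \<mu> \<Longrightarrow> point_system I G DG w lam \<mu>"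
    and F: "jet_system I F DF lam \<mu>"
  shows "jet_system I G DG lam \<mu>"
proof -
  have "point_system I F DF 0 lam \<mu>"
    using F lin by (simp add: jet_system_def point_system_def linear_0)
  then have 0: "point_system I G DG 0 lam \<mu>" by (rule imp[OF span_zero])
  have h: "point_system I G DG h lam \<mu>" if "h \<in> Basis - I" for h
    using F that by (intro imp span_base) (auto simp: jet_system_def point_system_def sum.distrib)
  have 0: "\<And>s. s \<in> I \<Longrightarrow> (\<Sum>i\<in>Basis. \<mu> i * (G i \<bullet> s)) = 0"
    "\<And>h. h \<in> Basis - I \<Longrightarrow> (\<Sum>i\<in>Basis. lam i * (G i \<bullet> h)) = 0"
    using 0 lin by (simp_all add: point_system_def linear_0)
  moreover have "(\<Sum>i\<in>Basis. lam i * (DG i h \<bullet> s)) = 0" if "s \<in> I" "h \<in> Basis - I" for s h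
    using h[OF that(2)] that(1) 0(1)[OF that(1)] by (auto simp: point_system_def sum.distrib)
  ultimately show ?thesis unfolding jet_system_def by blast
qed

text \<open>
  Otherwise some nonzero \<open>x\<close> in \<open>span I\<close> is orthogonal to all \<open>F\<^sub>i\<close>. By maximality \<open>x = \<Sum> \<mu>\<^sub>i G\<^sub>i\<close> with
  \<open>\<Sum> \<mu>\<^sub>i F\<^sub>i = 0\<close>, and the assumed implication makes the \<open>I\<close>-components of \<open>x\<close> vanish.
\<close>

lemma maximal_pair_onto:
  fixes I :: "'e::euclidean_space set"
  assumes max: "maximal_pair F G" and I: "I \<subseteq> Basis"
    and imp: "\<And>\<mu>. \<forall>s\<in>I. (\<Sum>i\<in>Basis. \<mu> i * (F i \<bullet> s)) = 0 \<Longrightarrow> \<forall>s\<in>I. (\<Sum>i\<in>Basis. \<mu> i * (G i \<bullet> s)) = 0"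
  shows "\<exists>\<kappa>. \<forall>s\<in>I. (\<Sum>i\<in>Basis. \<kappa> i * (F i \<bullet> s)) = t s"
proof -
  define S where "S = (\<lambda>i. x_part I (F i)) ` Basis"
  have fI: "finite I" by (rule finite_subset[OF I finite_Basis])
  have xs: "x_part I v \<bullet> s = v \<bullet> s" if "s \<in> I" for v s
  proof -
    have "x_part I v \<bullet> s = (\<Sum>u\<in>I. (v \<bullet> u) * (u \<bullet> s))" by (simp add: x_part_def inner_sum_left)
    also have "\<dots> = (\<Sum>u\<in>I. if u = s then v \<bullet> u else 0)"
      using I that by (intro sum.cong) (auto simp: inner_Basis subset_iff)
    finally show ?thesis using that fI by simp
  qed
  have xI: "x_part I v \<in> span I" for v
    unfolding x_part_def by (auto intro!: span_sum span_scale intro: span_base)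
  have SI: "span S \<subseteq> span I"
    by (rule span_minimal) (use xI in \<open>auto simp: S_def\<close>)
  have "span S = span I"
  proof (rule ccontr)
    assume "span S \<noteq> span I"
    then obtain x where x: "x \<noteq> 0" "x \<in> span I" "\<And>y. y \<in> span S \<Longrightarrow> orthogonal x y"
      using orthogonal_to_subspace_exists_gen[of S I] SI by blast
    have xx: "x = x_part I x"
    proof -
      have "x \<bullet> b = 0" if "b \<in> Basis - I" for b
        using x(2) by (induction rule: span_induct_alt) (use that I in \<open>auto simp: inner_add_left inner_Basis subset_iff\<close>)
      then have "(\<Sum>b\<in>Basis - I. (x \<bullet> b) *\<^sub>R b) = 0" by (simp add: sum.neutral)
      then have "(\<Sum>b\<in>Basis. (x \<bullet> b) *\<^sub>R b) = x_part I x"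
        using sum.subset_diff[OF I finite_Basis, of "\<lambda>b. (x \<bullet> b) *\<^sub>R b"] by (simp add: x_part_def)
      then show ?thesis by (simp add: euclidean_representation)
    qed
    have "x \<bullet> F i = 0" if "i \<in> Basis" for i
    proof -
      have "x \<bullet> x_part I (F i) = 0"
        using x(3)[OF span_base, of "x_part I (F i)"] that by (auto simp: S_def orthogonal_def)
      moreover have "x_part I x \<bullet> F i = x \<bullet> x_part I (F i)"
        by (simp add: x_part_def inner_sum_left inner_sum_right inner_commute mult.commute)
      ultimately show ?thesis using xx by simp
    qed
    then obtain \<mu> where \<mu>: "(\<Sum>i\<in>Basis. \<mu> i *\<^sub>R G i) = x" "(\<Sum>i\<in>Basis. \<mu> i *\<^sub>R F i) = 0"
      using max unfolding maximal_pair_def by blast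
    have e: "(\<Sum>i\<in>Basis. \<mu> i * (H i \<bullet> s)) = (\<Sum>i\<in>Basis. \<mu> i *\<^sub>R H i) \<bullet> s" for H s
      by (simp add: inner_sum_left)
    have "\<forall>s\<in>I. x \<bullet> s = 0" using imp[of \<mu>] \<mu> unfolding e by simp
    then have "x_part I x = 0" by (simp add: x_part_def)
    then show False using x(1) xx by simp
  qed
  moreover have "(\<Sum>u\<in>I. t u *\<^sub>R u) \<in> span I" by (auto intro!: span_sum span_scale intro: span_base)
  ultimately have "(\<Sum>u\<in>I. t u *\<^sub>R u) \<in> span S" by simp
  then have "\<exists>\<kappa>. (\<Sum>u\<in>I. t u *\<^sub>R u) = (\<Sum>i\<in>Basis. \<kappa> i *\<^sub>R x_part I (F i))"
  proof (induction rule: span_induct_alt)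
    case base
    show ?case by (rule exI[of _ "\<lambda>_. 0"]) simp
  next
    case (step a v y)
    then obtain i \<kappa> where i: "i \<in> Basis" "v = x_part I (F i)" and y: "y = (\<Sum>i\<in>Basis. \<kappa> i *\<^sub>R x_part I (F i))"
      by (auto simp: S_def)
    have "a *\<^sub>R v + y = (\<Sum>j\<in>Basis. (if j = i then a else 0) *\<^sub>R x_part I (F j)) + (\<Sum>j\<in>Basis. \<kappa> j *\<^sub>R x_part I (F j))"
      using i y by (simp add: if_distrib[of "\<lambda>a. a *\<^sub>R _"] sum.delta' cong: if_cong)
    also have "\<dots> = (\<Sum>j\<in>Basis. ((if j = i then a else 0) + \<kappa> j) *\<^sub>R x_part I (F j))"
      by (simp add: scaleR_left_distrib sum.distrib)
    finally show ?case by (rule exI[where x = "\<lambda>j. (if j = i then a else 0) + \<kappa> j"])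
  qed
  then obtain \<kappa> where \<kappa>: "(\<Sum>u\<in>I. t u *\<^sub>R u) = (\<Sum>i\<in>Basis. \<kappa> i *\<^sub>R x_part I (F i))" by blast
  have "(\<Sum>i\<in>Basis. \<kappa> i * (F i \<bullet> s)) = t s" if s: "s \<in> I" for s
  proof -
    have "(\<Sum>i\<in>Basis. \<kappa> i * (F i \<bullet> s)) = (\<Sum>u\<in>I. t u *\<^sub>R u) \<bullet> s"
      unfolding \<kappa> using s by (simp add: inner_sum_left xs)
    also have "\<dots> = (\<Sum>u\<in>I. if u = s then t u else 0)"
      unfolding inner_sum_left using I s by (intro sum.cong) (auto simp: inner_Basis subset_iff)
    finally show ?thesis using s fI by simp
  qed
  then show ?thesis by blast
qed

text \<open>
  A solution at a single \<open>w\<close> satisfies only one combination of the equations for the derivatives in the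
  directions \<open>h\<close>. The correction terms \<open>\<kappa>\<close>, which a change of frame can produce, are chosen by
  \<open>maximal_pair_onto\<close> so that each of these equations holds separately. Applying the assumption and
  comparing the combination with weights \<open>w \<bullet> h\<close> with the given solution leaves a difference with
  \<open>lam = 0\<close>, to which \<open>imp0\<close> applies.
\<close>

lemma jet_systems_imp_point_system:
  fixes I :: "'e::euclidean_space set"
  assumes max: "maximal_pair F G" and I: "I \<subseteq> Basis"
    and lin: "\<And>i. i \<in> Basis \<Longrightarrow> linear (DF i)" "\<And>i. i \<in> Basis \<Longrightarrow> linear (DG i)"
    and w: "w \<in> span (Basis - I)"
    and imp0: "\<And>\<mu>. jet_system I F DF (\<lambda>_. 0) \<mu> \<Longrightarrow> jet_system I G DG (\<lambda>_. 0) \<mu>"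
    and imp: "\<And>\<kappa> lam. \<exists>i\<in>Basis. lam i \<noteq> 0 \<Longrightarrow>
       \<forall>h\<in>Basis - I. (\<Sum>i\<in>Basis. lam i * (F i \<bullet> h)) = 0 \<Longrightarrow>
       \<forall>s\<in>I. \<forall>h\<in>Basis - I. (\<Sum>i\<in>Basis. lam i * (DF i h \<bullet> s) + \<kappa> h i * (F i \<bullet> s)) = 0 \<Longrightarrow>
       (\<forall>h\<in>Basis - I. (\<Sum>i\<in>Basis. lam i * (G i \<bullet> h)) = 0) \<and>
       (\<forall>s\<in>I. \<forall>h\<in>Basis - I. (\<Sum>i\<in>Basis. lam i * (DG i h \<bullet> s) + \<kappa> h i * (G i \<bullet> s)) = 0)"
    and F: "point_system I F DF w lam \<mu>"
  shows "point_system I G DG w lam \<mu>"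
proof -
  have base: "\<forall>s\<in>I. (\<Sum>i\<in>Basis. \<mu> i * (G i \<bullet> s)) = 0" if "\<forall>s\<in>I. (\<Sum>i\<in>Basis. \<mu> i * (F i \<bullet> s)) = 0" for \<mu>
    using imp0[of \<mu>] that by (simp add: jet_system_def)
  show ?thesis
  proof (cases "\<exists>i\<in>Basis. lam i \<noteq> 0")
    case False
    then show ?thesis using base[of \<mu>] F by (simp add: point_system_def)
  next
    case True
    have "\<exists>\<kappa>. \<forall>s\<in>I. (\<Sum>i\<in>Basis. \<kappa> i * (F i \<bullet> s)) = - (\<Sum>i\<in>Basis. lam i * (DF i h \<bullet> s))" for h
      by (rule maximal_pair_onto[OF max I base])
    then obtain \<kappa> where \<kappa>: "\<And>h s. s \<in> I \<Longrightarrow> (\<Sum>i\<in>Basis. \<kappa> h i * (F i \<bullet> s)) = - (\<Sum>i\<in>Basis. lam i * (DF i h \<bullet> s))"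
      by metis
    have G: "(\<forall>h\<in>Basis - I. (\<Sum>i\<in>Basis. lam i * (G i \<bullet> h)) = 0)"
      "\<And>s h. s \<in> I \<Longrightarrow> h \<in> Basis - I \<Longrightarrow> (\<Sum>i\<in>Basis. \<kappa> h i * (G i \<bullet> s)) = - (\<Sum>i\<in>Basis. lam i * (DG i h \<bullet> s))"
      using imp[OF True, of \<kappa>] F \<kappa> by (auto simp: point_system_def sum.distrib add_eq_0_iff)
    have w_exp: "w = (\<Sum>h\<in>Basis - I. (w \<bullet> h) *\<^sub>R h)"
    proof -
      have "w \<bullet> s = 0" if "s \<in> I" for s
        using w by (induction rule: span_induct_alt)
          (use that I in \<open>auto simp: inner_add_left inner_Basis subset_iff\<close>)
      then have "(\<Sum>b\<in>I. (w \<bullet> b) *\<^sub>R b) = 0" by (simp add: sum.neutral)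
      then show ?thesis
        using sum.subset_diff[OF I finite_Basis, of "\<lambda>b. (w \<bullet> b) *\<^sub>R b"] by (simp add: euclidean_representation)
    qed
    define kw where "kw i = (\<Sum>h\<in>Basis - I. (w \<bullet> h) * \<kappa> h i)" for i
    have D: "(\<Sum>i\<in>Basis. lam i * (DH i w \<bullet> s)) = - (\<Sum>i\<in>Basis. kw i * (H i \<bullet> s))"
      if DH: "\<And>i. i \<in> Basis \<Longrightarrow> linear (DH i)"
        and k: "\<And>h. h \<in> Basis - I \<Longrightarrow> (\<Sum>i\<in>Basis. \<kappa> h i * (H i \<bullet> s)) = - (\<Sum>i\<in>Basis. lam i * (DH i h \<bullet> s))"
      for H :: "'e \<Rightarrow> 'e" and DH s
    proof -
      have "DH i w \<bullet> s = (\<Sum>h\<in>Basis - I. (w \<bullet> h) * (DH i h \<bullet> s))" if "i \<in> Basis" for i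
        by (subst w_exp) (simp add: linear_sum[OF DH[OF that]] linear_scale[OF DH[OF that]] inner_sum_left)
      then have "(\<Sum>i\<in>Basis. lam i * (DH i w \<bullet> s)) = (\<Sum>i\<in>Basis. \<Sum>h\<in>Basis - I. (w \<bullet> h) * (lam i * (DH i h \<bullet> s)))"
        by (simp add: sum_distrib_left mult.left_commute)
      also have "\<dots> = (\<Sum>h\<in>Basis - I. (w \<bullet> h) * (\<Sum>i\<in>Basis. lam i * (DH i h \<bullet> s)))"
        by (subst sum.swap) (simp add: sum_distrib_left)
      also have "\<dots> = (\<Sum>h\<in>Basis - I. - ((w \<bullet> h) * (\<Sum>i\<in>Basis. \<kappa> h i * (H i \<bullet> s))))"
        using k by (intro sum.cong) auto
      also have "\<dots> = - (\<Sum>h\<in>Basis - I. \<Sum>i\<in>Basis. (w \<bullet> h) * \<kappa> h i * (H i \<bullet> s))"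
        by (simp add: sum_negf sum_distrib_left mult.assoc)
      also have "\<dots> = - (\<Sum>i\<in>Basis. kw i * (H i \<bullet> s))"
        by (subst sum.swap) (simp add: kw_def sum_distrib_right)
      finally show ?thesis .
    qed
    have DF: "(\<Sum>i\<in>Basis. lam i * (DF i w \<bullet> s)) = - (\<Sum>i\<in>Basis. kw i * (F i \<bullet> s))"
      and DG: "(\<Sum>i\<in>Basis. lam i * (DG i w \<bullet> s)) = - (\<Sum>i\<in>Basis. kw i * (G i \<bullet> s))"
      if "s \<in> I" for s
      by (rule D, erule lin, rule \<kappa>[OF that]) (rule D, erule lin, rule G(2)[OF that])
    have "\<forall>s\<in>I. (\<Sum>i\<in>Basis. (\<mu> i - kw i) * (F i \<bullet> s)) = 0"
      using F by (simp add: DF point_system_def sum.distrib left_diff_distrib sum_subtractf)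
    from base[OF this] show ?thesis
      using G(1) by (simp add: DG point_system_def sum.distrib left_diff_distrib sum_subtractf)
  qed
qed

section \<open>The tangent manifold\<close>

lemma fst_tangent_chart [simp]: "fst (tangent_chart A c) = fst c \<times> UNIV"
  by (simp add: tangent_chart_def)

lemma snd_tangent_chart [simp]: "snd (tangent_chart A c) (p, v) = (snd c p, vec_coord A c p v)"
  by (simp add: tangent_chart_def)

lemma smooth_on_fst_snd_derivative:
  fixes f :: "'a::euclidean_space \<Rightarrow> 'b::real_normed_vector"
  assumes U: "open U" and f: "smooth_on U f"
  shows "smooth_on (U \<times> UNIV) (\<lambda>x. frechet_derivative f (at (fst x)) (snd x))"
proof -
  have oU: "open (U \<times> (UNIV :: 'a set))" using U by (simp add: open_Times)
  have "smooth_on (U \<times> (UNIV :: 'a set)) ((\<lambda>z. frechet_derivative f (at z) j) \<circ> fst)" for j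
    by (rule smooth_on_compose[OF oU U]) (auto intro: smooth_on_bounded_linear bounded_linear_fst smooth_on_derivative f)
  then have "smooth_on (U \<times> UNIV) (\<lambda>x. \<Sum>j\<in>Basis. (snd x \<bullet> j) *\<^sub>R frechet_derivative f (at (fst x)) j)"
    unfolding o_def
    by (intro smooth_on_sum oU smooth_on_scaleR smooth_on_inner_const)
      (rule smooth_on_bounded_linear[OF bounded_linear_snd])
  then show ?thesis
    by (rule smooth_on_transfer[OF oU])
      (use linear_expand_Basis[OF smooth_on_linear_derivative[OF f]] in \<open>auto simp: mem_Times_iff\<close>)
qed

text \<open>
  The map is smooth, so its derivative is determined by the two partial derivatives.
\<close>

lemma has_derivative_fst_snd_derivative:
  fixes f :: "'a::euclidean_space \<Rightarrow> 'b::real_normed_vector"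
  assumes U: "open U" and f: "smooth_on U f" and z: "z \<in> U"
  shows "((\<lambda>x. frechet_derivative f (at (fst x)) (snd x)) has_derivative
      (\<lambda>(a, b). frechet_derivative (\<lambda>z. frechet_derivative f (at z) w) (at z) a + frechet_derivative f (at z) b))
      (at (z, w))"
proof -
  let ?P = "\<lambda>x. frechet_derivative f (at (fst x)) (snd x)"
  let ?P' = "frechet_derivative ?P (at (z, w))"
  have d: "(?P has_derivative ?P') (at (z, w))"
    by (rule smooth_on_has_derivative[OF smooth_on_fst_snd_derivative[OF U f]]) (use z in auto)
  have lin: "linear ?P'" using d has_derivative_linear by blast
  have p1: "?P' (a, 0) = frechet_derivative (\<lambda>z. frechet_derivative f (at z) w) (at z) a" for a
  proof -
    have "((\<lambda>z. (z, w)) has_derivative (\<lambda>a. (a, 0))) (at z)"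
      by (auto intro!: derivative_eq_intros)
    from has_derivative_compose[OF this d]
    have "((\<lambda>z. frechet_derivative f (at z) w) has_derivative (\<lambda>a. ?P' (a, 0))) (at z)" by simp
    then show ?thesis by (simp add: frechet_derivative_eqI)
  qed
  have p2: "?P' (0, b) = frechet_derivative f (at z) b" for b
  proof -
    have "((\<lambda>w. (z, w)) has_derivative (\<lambda>b. (0, b))) (at w)"
      by (auto intro!: derivative_eq_intros)
    from has_derivative_compose[OF this d]
    have d1: "((\<lambda>w. frechet_derivative f (at z) w) has_derivative (\<lambda>b. ?P' (0, b))) (at w)" by simp
    have d2: "((\<lambda>w. frechet_derivative f (at z) w) has_derivative frechet_derivative f (at z)) (at w)"
      using smooth_on_linear_derivative[OF f z] by (simp add: linear_imp_has_derivative)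
    show ?thesis by (rule fun_cong[OF has_derivative_unique[OF d1 d2], of b])
  qed
  have p3: "?P' (a, b) = ?P' (a, 0) + ?P' (0, b)" for a b
    using linear_add[OF lin, of "(a, 0)" "(0, b)"] by simp
  have "?P' = (\<lambda>(a, b). frechet_derivative (\<lambda>z. frechet_derivative f (at z) w) (at z) a
      + frechet_derivative f (at z) b)"
  proof (rule ext, clarify)
    fix a b
    show "?P' (a, b) = frechet_derivative (\<lambda>z. frechet_derivative f (at z) w) (at z) a
      + frechet_derivative f (at z) b"
      by (simp only: p3[of a b] p1 p2)
  qed
  then show ?thesis using d by (simp only:)
qed

context atlas
begin

lemma is_chart_tangent_chart:
  assumes c: "c \<in> charts A"
  shows "is_chart (tangent_chart A c)"
proof -
  have "inj_on (snd (tangent_chart A c)) (fst (tangent_chart A c))"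
  proof (rule inj_onI)
    fix x y assume xy: "x \<in> fst (tangent_chart A c)" "y \<in> fst (tangent_chart A c)"
      "snd (tangent_chart A c) x = snd (tangent_chart A c) y"
    obtain p v where x: "x = (p, v)" by fastforce
    obtain q w where y: "y = (q, w)" by fastforce
    have pq: "p \<in> fst c" "q \<in> fst c" "snd c p = snd c q" "vec_coord A c p v = vec_coord A c q w"
      using xy by (auto simp: x y)
    then have "p = q" using charts_inv_left[OF c] by metis
    then show "x = y" using pq vec_of_coord_coord[OF c] by (metis x y)
  qed
  moreover have "snd (tangent_chart A c) ` fst (tangent_chart A c) = snd c ` fst c \<times> UNIV"
  proof (intro equalityI subsetI)
    fix x assume "x \<in> snd c ` fst c \<times> (UNIV :: 'e set)"
    then obtain p w where "p \<in> fst c" "x = (snd c p, w)" by auto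
    then have "x = snd (tangent_chart A c) (p, vec_of_coord A c p w)" "(p, vec_of_coord A c p w) \<in> fst (tangent_chart A c)"
      using c by auto
    then show "x \<in> snd (tangent_chart A c) ` fst (tangent_chart A c)" by blast
  qed auto
  ultimately show "is_chart (tangent_chart A c)"
    using open_chart_range[OF c] by (simp add: is_chart_def open_Times)
qed

lemma tangent_chart_inv:
  assumes c: "c \<in> charts A" and p: "p \<in> fst c"
  shows "chart_inv (tangent_chart A c) (snd c p, w) = (p, vec_of_coord A c p w)"
  using chart_inv_left[OF is_chart_tangent_chart[OF c], of "(p, vec_of_coord A c p w)"] p c by simp

lemma tangent_chart_image:
  assumes c: "c \<in> charts A" and S: "S \<subseteq> fst c"
  shows "snd (tangent_chart A c) ` (S \<times> UNIV) = snd c ` S \<times> UNIV"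
proof (intro equalityI subsetI)
  fix x assume "x \<in> snd c ` S \<times> (UNIV :: 'e set)"
  then obtain p w where p: "p \<in> S" "x = (snd c p, w)" by auto
  then have "x = snd (tangent_chart A c) (p, vec_of_coord A c p w)"
    using c S by auto
  then show "x \<in> snd (tangent_chart A c) ` (S \<times> UNIV)" using p by blast
qed auto

lemma transit_tangent_chart:
  assumes c: "c \<in> charts A" and d: "d \<in> charts A" and p: "p \<in> fst c" "p \<in> fst d"
  shows "transit (tangent_chart A c) (tangent_chart A d) (snd c p, w)
    = (snd d p, Dtransit c d (snd c p) w)"
  using assms by (simp add: tangent_chart_inv vec_coord_change[OF c p(1)])

lemma compatible_tangent_chart:
  assumes c: "c \<in> charts A" and d: "d \<in> charts A"
  shows "compatible (tangent_chart A c) (tangent_chart A d)"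
proof -
  let ?U = "snd c ` (fst c \<inter> fst d)"
  have im: "snd (tangent_chart A c) ` (fst (tangent_chart A c) \<inter> fst (tangent_chart A d)) = ?U \<times> UNIV"
    using tangent_chart_image[OF c, of "fst c \<inter> fst d"] by (simp add: Times_Int_Times)
  have oU: "open ?U" by (rule open_transit_domain[OF c d])
  then have oUU: "open (?U \<times> (UNIV :: 'e set))" by (simp add: open_Times)
  have "smooth_on (?U \<times> (UNIV :: 'e set)) (transit c d \<circ> fst)"
    by (rule smooth_on_compose[OF oUU oU]) (auto intro: smooth_on_bounded_linear bounded_linear_fst smooth_transit c d)
  then have "smooth_on (?U \<times> UNIV) (\<lambda>x. ((transit c d \<circ> fst) x, Dtransit c d (fst x) (snd x)))"
    by (intro smooth_on_Pair oUU smooth_on_fst_snd_derivative oU smooth_transit c d)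
  then have "smooth_on (?U \<times> UNIV) (transit (tangent_chart A c) (tangent_chart A d))"
  proof (rule smooth_on_transfer[OF oUU])
    fix x assume "x \<in> ?U \<times> (UNIV :: 'e set)"
    then obtain p w where p: "p \<in> fst c" "p \<in> fst d" "x = (snd c p, w)" by auto
    show "((transit c d \<circ> fst) x, Dtransit c d (fst x) (snd x)) = transit (tangent_chart A c) (tangent_chart A d) x"
      unfolding p(3) transit_tangent_chart[OF c d p(1,2)] by (simp add: charts_inv_left c p)
  qed
  then show ?thesis
    unfolding compatible_def im by (rule conjI[OF oUU])
qed

lemma smooth_tangent_atlas: "smooth_atlas (tangent_atlas A)"
  unfolding smooth_atlas_def tangent_atlas_def
  by (auto intro: compatible_tangent_chart is_chart_tangent_chart atlas_charts)

lemma points_tangent_atlas: "points (tangent_atlas A) = points A \<times> UNIV"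
  by (auto simp: points_def tangent_atlas_def)

lemma tangent_chart_charts:
  assumes c: "c \<in> charts A" shows "tangent_chart A c \<in> charts (tangent_atlas A)"
proof -
  have "fst (tangent_chart A c) \<subseteq> points (tangent_atlas A)"
    using chartsD(2)[OF c] by (auto simp: points_tangent_atlas)
  moreover have "\<forall>d\<in>tangent_atlas A. compatible (tangent_chart A c) d \<and> compatible d (tangent_chart A c)"
    by (auto simp: tangent_atlas_def intro!: compatible_tangent_chart c atlas_charts)
  ultimately show ?thesis
    using is_chart_tangent_chart[OF c] unfolding charts_def[of "tangent_atlas A"] by blast
qed

interpretation T: atlas "tangent_atlas A"
  by (rule atlas.intro[OF smooth_tangent_atlas])

text \<open>
  The derivative of \<open>(z, w) \<mapsto> (\<phi> z, \<phi>' z w)\<close>, where \<open>\<phi>\<close> is the change of coordinates on the base.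
\<close>

lemma Dtransit_tangent_chart:
  assumes c: "c \<in> charts A" and d: "d \<in> charts A" and p: "p \<in> fst c" "p \<in> fst d"
  shows "Dtransit (tangent_chart A c) (tangent_chart A d) (snd c p, w) (a, b)
    = (Dtransit c d (snd c p) a,
       frechet_derivative (\<lambda>z. Dtransit c d z w) (at (snd c p)) a + Dtransit c d (snd c p) b)"
proof -
  let ?U = "snd c ` (fst c \<inter> fst d)"
  have oU: "open ?U" by (rule open_transit_domain[OF c d])
  then have oUU: "open (?U \<times> (UNIV :: 'e set))" by (simp add: open_Times)
  have z: "snd c p \<in> ?U" using p by blast
  have "((\<lambda>x. (transit c d (fst x), Dtransit c d (fst x) (snd x))) has_derivative
     (\<lambda>x. (Dtransit c d (snd c p) (fst x), case x of (a, b) \<Rightarrow>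
       frechet_derivative (\<lambda>z. Dtransit c d z w) (at (snd c p)) a + Dtransit c d (snd c p) b))) (at (snd c p, w))"
  proof (rule has_derivative_Pair)
    show "((\<lambda>x. transit c d (fst x)) has_derivative (\<lambda>x. Dtransit c d (snd c p) (fst x))) (at (snd c p, w))"
      by (rule has_derivative_compose[OF bounded_linear_imp_has_derivative[OF bounded_linear_fst]])
        (simp only: fst_conv Dtransit_has_derivative[OF c d p])
  qed (rule has_derivative_fst_snd_derivative[OF oU smooth_transit[OF c d] z])
  then have "(transit (tangent_chart A c) (tangent_chart A d) has_derivative
     (\<lambda>x. (Dtransit c d (snd c p) (fst x), case x of (a, b) \<Rightarrow>
       frechet_derivative (\<lambda>z. Dtransit c d z w) (at (snd c p)) a + Dtransit c d (snd c p) b))) (at (snd c p, w))"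
  proof (rule has_derivative_transform_within_open[OF _ oUU])
    show "(snd c p, w) \<in> ?U \<times> UNIV" using z by simp
    fix x assume "x \<in> ?U \<times> (UNIV :: 'e set)"
    then obtain p w where p: "p \<in> fst c" "p \<in> fst d" "x = (snd c p, w)" by auto
    show "(transit c d (fst x), Dtransit c d (fst x) (snd x)) = transit (tangent_chart A c) (tangent_chart A d) x"
      unfolding p(3) transit_tangent_chart[OF c d p(1,2)] by (simp add: charts_inv_left c p)
  qed
  then show ?thesis by (simp add: frechet_derivative_eqI)
qed

lemma vec_coord_tangent_change:
  assumes c: "c \<in> charts A" and d: "d \<in> charts A" and p: "p \<in> fst c" "p \<in> fst d"
    and Z: "vec_coord (tangent_atlas A) (tangent_chart A c) (p, v) Z = (a, b)"
  shows "vec_coord (tangent_atlas A) (tangent_chart A d) (p, v) Z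
    = (Dtransit c d (snd c p) a,
       frechet_derivative (\<lambda>z. Dtransit c d z (vec_coord A c p v)) (at (snd c p)) a + Dtransit c d (snd c p) b)"
proof -
  have "vec_coord (tangent_atlas A) (tangent_chart A d) (p, v) Z
      = Dtransit (tangent_chart A c) (tangent_chart A d) (snd (tangent_chart A c) (p, v)) (a, b)"
    using T.vec_coord_change[OF tangent_chart_charts[OF c] _ tangent_chart_charts[OF d], of "(p, v)" Z] p Z by simp
  then show ?thesis by (simp add: Dtransit_tangent_chart[OF c d p])
qed

section \<open>Lifts in an arbitrary chart\<close>

lemma vertical_lift_vf_coord:
  assumes c: "c \<in> charts A" and p: "p \<in> fst c"
  shows "vec_coord (tangent_atlas A) (tangent_chart A c) (p, v) (vertical_lift_vf A X (p, v))
    = (0, vf_rep A c X (snd c p))"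
proof -
  let ?k = "chart_at A p"
  have k: "?k \<in> charts A" "p \<in> fst ?k" using chart_at chart_points c p by blast+
  have "vec_coord (tangent_atlas A) (tangent_chart A ?k) (p, v) (vertical_lift_vf A X (p, v))
      = (0, vf_rep A ?k X (snd ?k p))"
    unfolding vertical_lift_vf_def Let_def fst_conv snd_conv
    by (rule T.vec_coord_of_coord[OF tangent_chart_charts[OF k(1)]]) (use k in simp)
  note vec_coord_tangent_change[OF k(1) c k(2) p this]
  moreover have "linear (frechet_derivative (\<lambda>z. Dtransit ?k c z (vec_coord A ?k p v)) (at (snd ?k p)))"
    by (rule smooth_on_linear_derivative[OF smooth_on_derivative[OF smooth_transit[OF k(1) c]]]) (use k p in auto)
  ultimately show ?thesis
    using linear_0[OF linear_Dtransit[OF k(1) c k(2) p]] vf_rep_change[OF k(1) c k(2) p, of X]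
    by (simp add: linear_0)
qed

text \<open>
  The components \<open>(\<xi>, \<xi>' w)\<close> of the complete lift have the same form in every chart. Differentiating the
  transformation law \<open>\<eta> (\<phi> z) = \<phi>' z (\<xi> z)\<close> along \<open>w\<close> gives a second derivative \<open>\<phi>''(w, \<xi>)\<close>, and the change of
  coordinates on the tangent manifold gives \<open>\<phi>''(\<xi>, w)\<close>.
\<close>

lemma complete_lift_vf_coord:
  assumes c: "c \<in> charts A" and p: "p \<in> fst c"
    and V: "openin (manifold_topology A) V" "p \<in> V" and X: "smooth_vf A V X"
  shows "vec_coord (tangent_atlas A) (tangent_chart A c) (p, v) (complete_lift_vf A X (p, v))
    = (vf_rep A c X (snd c p), frechet_derivative (vf_rep A c X) (at (snd c p)) (vec_coord A c p v))"
proof -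
  let ?k = "chart_at A p"
  have k: "?k \<in> charts A" "p \<in> fst ?k" using chart_at chart_points c p by blast+
  let ?z = "snd ?k p" and ?w = "vec_coord A ?k p v"
  let ?\<xi> = "vf_rep A ?k X" and ?\<eta> = "vf_rep A c X" and ?D = "Dtransit ?k c"
  let ?U = "snd ?k ` (fst ?k \<inter> (fst c \<inter> V))"
  have oU: "open ?U" by (intro open_chart_image openin_Int openin_chart k c V)
  have zU: "?z \<in> ?U" using k p V by blast
  have st: "smooth_on ?U (transit ?k c)"
    by (rule smooth_on_subset[OF smooth_transit[OF k(1) c]]) auto
  have lift: "vec_coord (tangent_atlas A) (tangent_chart A ?k) (p, v) (complete_lift_vf A X (p, v))
      = (?\<xi> ?z, frechet_derivative ?\<xi> (at ?z) ?w)"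
    unfolding complete_lift_vf_def Let_def fst_conv snd_conv
    by (rule T.vec_coord_of_coord[OF tangent_chart_charts[OF k(1)]]) (use k in simp)
  have dxi: "(?\<xi> has_derivative frechet_derivative ?\<xi> (at ?z)) (at ?z)"
    by (rule smooth_on_has_derivative[OF smooth_vf_rep[OF X V(1) k(1)]]) (use k V in auto)
  have deta: "(?\<eta> has_derivative frechet_derivative ?\<eta> (at (snd c p))) (at (transit ?k c ?z))"
    using smooth_on_has_derivative[OF smooth_vf_rep[OF X V(1) c], of "snd c p"] k p V
    by (simp add: charts_inv_left)
  have "((\<lambda>z. ?D z (?\<xi> z)) has_derivative
     (\<lambda>w. frechet_derivative (\<lambda>z. ?D z (?\<xi> ?z)) (at ?z) w + ?D ?z (frechet_derivative ?\<xi> (at ?z) w))) (at ?z)"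
    using has_derivative_compose[OF has_derivative_Pair[OF has_derivative_ident dxi]
        has_derivative_fst_snd_derivative[OF oU st zU, of "?\<xi> ?z"]] by simp
  then have d1: "((\<lambda>z. ?\<eta> (transit ?k c z)) has_derivative
     (\<lambda>w. frechet_derivative (\<lambda>z. ?D z (?\<xi> ?z)) (at ?z) w + ?D ?z (frechet_derivative ?\<xi> (at ?z) w))) (at ?z)"
    by (rule has_derivative_transform_within_open[OF _ oU zU])
      (use k c in \<open>auto simp: charts_inv_left vf_rep_change[of ?k c]\<close>)
  have d2: "((\<lambda>z. ?\<eta> (transit ?k c z)) has_derivative
     (\<lambda>w. frechet_derivative ?\<eta> (at (snd c p)) (?D ?z w))) (at ?z)"
    by (rule has_derivative_compose[OF Dtransit_has_derivative[OF k(1) c k(2) p] deta])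
  have "frechet_derivative ?\<eta> (at (snd c p)) (?D ?z ?w)
     = frechet_derivative (\<lambda>z. ?D z (?\<xi> ?z)) (at ?z) ?w + ?D ?z (frechet_derivative ?\<xi> (at ?z) ?w)"
    by (rule fun_cong[OF has_derivative_unique[OF d2 d1], of ?w])
  also have "frechet_derivative (\<lambda>z. ?D z (?\<xi> ?z)) (at ?z) ?w = frechet_derivative (\<lambda>z. ?D z ?w) (at ?z) (?\<xi> ?z)"
    by (rule second_derivative_symmetric[OF oU st zU])
  finally show ?thesis
    by (simp only: vec_coord_tangent_change[OF k(1) c k(2) p lift] vf_rep_change[OF k(1) c k(2) p, of X]
        vec_coord_change[OF k c p])
qed

lemma Blinfun_pair_apply:
  "blinfun_apply (Blinfun (\<lambda>(\<zeta>, \<eta>). blinfun_apply a \<zeta> + blinfun_apply b \<eta>)) (x, y)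
    = blinfun_apply a x + blinfun_apply b y" for a b :: "'e \<Rightarrow>\<^sub>L real"
proof -
  have "bounded_linear (\<lambda>x. blinfun_apply a (fst x) + blinfun_apply b (snd x))"
    by (intro bounded_linear_add bounded_linear_compose[OF blinfun.bounded_linear_right]
        bounded_linear_fst bounded_linear_snd)
  then show ?thesis by (simp add: bounded_linear_Blinfun_apply case_prod_beta')
qed

lemma vertical_lift_form_apply:
  assumes c: "c \<in> charts A" and p: "p \<in> fst c"
    and Z: "vec_coord (tangent_atlas A) (tangent_chart A c) (p, v) Z = (a, b)"
  shows "blinfun_apply (vertical_lift_form A \<alpha> (p, v)) Z = blinfun_apply (form_rep A c \<alpha> (snd c p)) a"
proof -
  let ?k = "chart_at A p"
  have k: "?k \<in> charts A" "p \<in> fst ?k" using chart_at chart_points c p by blast+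
  obtain a' b' where Z': "vec_coord (tangent_atlas A) (tangent_chart A ?k) (p, v) Z = (a', b')"
    by fastforce
  have "blinfun_apply (vertical_lift_form A \<alpha> (p, v)) Z = blinfun_apply (form_rep A ?k \<alpha> (snd ?k p)) a'"
    unfolding vertical_lift_form_def Let_def fst_conv snd_conv
    using T.cov_of_coord_apply[OF tangent_chart_charts[OF k(1)], of "(p, v)"] k Z'
      Blinfun_pair_apply[of "form_rep A ?k \<alpha> (snd ?k p)" 0] by simp
  also have "\<dots> = blinfun_apply (form_rep A c \<alpha> (snd c p)) a"
    using vec_coord_tangent_change[OF k(1) c k(2) p Z'] Z form_rep_change[OF k(1) c k(2) p] by simp
  finally show ?thesis .
qed

text \<open>
  As for vector fields: the second derivatives of the change of coordinates that come from the
  differentiated transformation law and from the tangent manifold agree by symmetry.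
\<close>

lemma complete_lift_form_apply:
  assumes c: "c \<in> charts A" and p: "p \<in> fst c"
    and V: "openin (manifold_topology A) V" "p \<in> V" and \<alpha>: "smooth_form A V \<alpha>"
    and Z: "vec_coord (tangent_atlas A) (tangent_chart A c) (p, v) Z = (a, b)"
  shows "blinfun_apply (complete_lift_form A \<alpha> (p, v)) Z
    = blinfun_apply (frechet_derivative (form_rep A c \<alpha>) (at (snd c p)) (vec_coord A c p v)) a
      + blinfun_apply (form_rep A c \<alpha> (snd c p)) b"
proof -
  let ?k = "chart_at A p"
  have k: "?k \<in> charts A" "p \<in> fst ?k" using chart_at chart_points c p by blast+
  let ?z = "snd ?k p" and ?w = "vec_coord A ?k p v"
  let ?\<xi> = "form_rep A ?k \<alpha>" and ?\<eta> = "form_rep A c \<alpha>" and ?D = "Dtransit ?k c"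
  let ?U = "snd ?k ` (fst ?k \<inter> (fst c \<inter> V))"
  have oU: "open ?U" by (intro open_chart_image openin_Int openin_chart k c V)
  have zU: "?z \<in> ?U" using k p V by blast
  have st: "smooth_on ?U (transit ?k c)"
    by (rule smooth_on_subset[OF smooth_transit[OF k(1) c]]) auto
  obtain a' b' where Z': "vec_coord (tangent_atlas A) (tangent_chart A ?k) (p, v) Z = (a', b')"
    by fastforce
  have ab: "a = ?D ?z a'" "b = frechet_derivative (\<lambda>z. ?D z ?w) (at ?z) a' + ?D ?z b'"
    using vec_coord_tangent_change[OF k(1) c k(2) p Z'] Z by simp_all
  have dxi: "(?\<xi> has_derivative frechet_derivative ?\<xi> (at ?z)) (at ?z)"
    by (rule smooth_on_has_derivative[OF smooth_form_rep[OF \<alpha> V(1) k(1)]]) (use k V in auto)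
  have deta: "(?\<eta> has_derivative frechet_derivative ?\<eta> (at (snd c p))) (at (transit ?k c ?z))"
    using smooth_on_has_derivative[OF smooth_form_rep[OF \<alpha> V(1) c], of "snd c p"] k p V
    by (simp add: charts_inv_left)
  have "((\<lambda>z. blinfun_apply (?\<eta> (transit ?k c z)) (?D z a')) has_derivative
     (\<lambda>w. blinfun_apply (?\<eta> (transit ?k c ?z)) (frechet_derivative (\<lambda>z. ?D z a') (at ?z) w)
        + blinfun_apply (frechet_derivative ?\<eta> (at (snd c p)) (?D ?z w)) (?D ?z a'))) (at ?z)"
    by (rule bounded_bilinear.FDERIV[OF bounded_bilinear_blinfun_apply])
      (rule has_derivative_compose[OF Dtransit_has_derivative[OF k(1) c k(2) p] deta]
        smooth_on_has_derivative[OF smooth_on_derivative[OF st] zU])+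
  then have d1: "((\<lambda>z. blinfun_apply (?\<xi> z) a') has_derivative
     (\<lambda>w. blinfun_apply (?\<eta> (transit ?k c ?z)) (frechet_derivative (\<lambda>z. ?D z a') (at ?z) w)
        + blinfun_apply (frechet_derivative ?\<eta> (at (snd c p)) (?D ?z w)) (?D ?z a'))) (at ?z)"
    by (rule has_derivative_transform_within_open[OF _ oU zU])
      (use k c in \<open>auto simp: charts_inv_left form_rep_change[of ?k c]\<close>)
  have d2: "((\<lambda>z. blinfun_apply (?\<xi> z) a') has_derivative
     (\<lambda>w. blinfun_apply (frechet_derivative ?\<xi> (at ?z) w) a')) (at ?z)"
    by (rule bounded_linear.has_derivative[OF blinfun.bounded_linear_left dxi])
  have "blinfun_apply (frechet_derivative ?\<xi> (at ?z) ?w) a'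
    = blinfun_apply (?\<eta> (transit ?k c ?z)) (frechet_derivative (\<lambda>z. ?D z a') (at ?z) ?w)
        + blinfun_apply (frechet_derivative ?\<eta> (at (snd c p)) (?D ?z ?w)) (?D ?z a')"
    by (rule fun_cong[OF has_derivative_unique[OF d2 d1], of ?w])
  also have "frechet_derivative (\<lambda>z. ?D z a') (at ?z) ?w = frechet_derivative (\<lambda>z. ?D z ?w) (at ?z) a'"
    by (rule second_derivative_symmetric[OF oU st zU])
  finally have e: "blinfun_apply (frechet_derivative ?\<xi> (at ?z) ?w) a'
    = blinfun_apply (?\<eta> (snd c p)) (frechet_derivative (\<lambda>z. ?D z ?w) (at ?z) a')
        + blinfun_apply (frechet_derivative ?\<eta> (at (snd c p)) (vec_coord A c p v)) a"
    by (simp only: ab(1) vec_coord_change[OF k c p] comp_apply[of "snd c" "chart_inv ?k" ?z] charts_inv_left[OF k])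
  have "blinfun_apply (complete_lift_form A \<alpha> (p, v)) Z
      = blinfun_apply (frechet_derivative ?\<xi> (at ?z) ?w) a' + blinfun_apply (?\<xi> ?z) b'"
    unfolding complete_lift_form_def Let_def fst_conv snd_conv
    using T.cov_of_coord_apply[OF tangent_chart_charts[OF k(1)], of "(p, v)"] k Z'
      Blinfun_pair_apply by simp
  also have "\<dots> = blinfun_apply (frechet_derivative ?\<eta> (at (snd c p)) (vec_coord A c p v)) a
      + blinfun_apply (?\<eta> (snd c p)) b"
    unfolding e ab(2) using form_rep_change[OF k(1) c k(2) p, of \<alpha> b'] by (simp add: blinfun.add_right)
  finally show ?thesis .
qed

end

section \<open>The tangent Dirac structure in a local frame\<close>

definition complete_lift where
  "complete_lift A s q = (complete_lift_vf A (\<lambda>p. fst (s p)) q, complete_lift_form A (\<lambda>p. snd (s p)) q)"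

definition vertical_lift where
  "vertical_lift A s q = (vertical_lift_vf A (\<lambda>p. fst (s p)) q, vertical_lift_form A (\<lambda>p. snd (s p)) q)"

lemma fst_sum: "fst (\<Sum>i\<in>J. f i) = (\<Sum>i\<in>J. fst (f i))"
  and snd_sum: "snd (\<Sum>i\<in>J. f i) = (\<Sum>i\<in>J. snd (f i))"
  by (induction J rule: infinite_finite_induct) auto

context atlas
begin

interpretation T: atlas "tangent_atlas A"
  by (rule atlas.intro[OF smooth_tangent_atlas])

lemma lift_combination_vec:
  assumes c: "c \<in> charts A" and p: "p \<in> fst c" and V: "openin (manifold_topology A) V" "p \<in> V"
    and s: "\<And>i. i \<in> J \<Longrightarrow> is_section A D V (s i)"
  shows "vec_coord (tangent_atlas A) (tangent_chart A c) (p, v)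
      (fst (\<Sum>i\<in>J. lam i *\<^sub>R complete_lift A (s i) (p, v) + \<mu> i *\<^sub>R vertical_lift A (s i) (p, v)))
    = (\<Sum>i\<in>J. lam i *\<^sub>R vf_rep A c (\<lambda>p. fst (s i p)) (snd c p),
       \<Sum>i\<in>J. lam i *\<^sub>R frechet_derivative (vf_rep A c (\<lambda>p. fst (s i p))) (at (snd c p)) (vec_coord A c p v)
             + \<mu> i *\<^sub>R vf_rep A c (\<lambda>p. fst (s i p)) (snd c p))"
proof -
  let ?L = "vec_coord (tangent_atlas A) (tangent_chart A c) (p, v)"
  have L: "linear ?L"
    by (rule T.linear_vec_coord[OF tangent_chart_charts[OF c]]) (use p in simp)
  have "?L (fst (\<Sum>i\<in>J. lam i *\<^sub>R complete_lift A (s i) (p, v) + \<mu> i *\<^sub>R vertical_lift A (s i) (p, v)))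
     = (\<Sum>i\<in>J. lam i *\<^sub>R ?L (fst (complete_lift A (s i) (p, v))) + \<mu> i *\<^sub>R ?L (fst (vertical_lift A (s i) (p, v))))"
    by (simp add: fst_sum linear_sum[OF L] linear_add[OF L] linear_scale[OF L])
  also have "\<dots> = (\<Sum>i\<in>J. lam i *\<^sub>R (vf_rep A c (\<lambda>p. fst (s i p)) (snd c p),
        frechet_derivative (vf_rep A c (\<lambda>p. fst (s i p))) (at (snd c p)) (vec_coord A c p v))
      + \<mu> i *\<^sub>R (0, vf_rep A c (\<lambda>p. fst (s i p)) (snd c p)))"
  proof (rule sum.cong[OF refl])
    fix i assume "i \<in> J"
    then have "smooth_vf A V (\<lambda>p. fst (s i p))" using s by (simp add: is_section_def)
    then show "lam i *\<^sub>R ?L (fst (complete_lift A (s i) (p, v))) + \<mu> i *\<^sub>R ?L (fst (vertical_lift A (s i) (p, v)))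
     = lam i *\<^sub>R (vf_rep A c (\<lambda>p. fst (s i p)) (snd c p),
        frechet_derivative (vf_rep A c (\<lambda>p. fst (s i p))) (at (snd c p)) (vec_coord A c p v))
      + \<mu> i *\<^sub>R (0, vf_rep A c (\<lambda>p. fst (s i p)) (snd c p))"
      by (simp only: complete_lift_def vertical_lift_def fst_conv
          complete_lift_vf_coord[OF c p V] vertical_lift_vf_coord[OF c p])
  qed
  finally show ?thesis by (simp add: prod_eq_iff fst_sum snd_sum)
qed

lemma lift_combination_form:
  assumes c: "c \<in> charts A" and p: "p \<in> fst c" and V: "openin (manifold_topology A) V" "p \<in> V"
    and s: "\<And>i. i \<in> J \<Longrightarrow> is_section A D V (s i)"
    and Z: "vec_coord (tangent_atlas A) (tangent_chart A c) (p, v) Z = (a, b)"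
  shows "blinfun_apply
      (snd (\<Sum>i\<in>J. lam i *\<^sub>R complete_lift A (s i) (p, v) + \<mu> i *\<^sub>R vertical_lift A (s i) (p, v))) Z
    = (\<Sum>i\<in>J. lam i * (blinfun_apply (frechet_derivative (form_rep A c (\<lambda>p. snd (s i p))) (at (snd c p)) (vec_coord A c p v)) a
          + blinfun_apply (form_rep A c (\<lambda>p. snd (s i p)) (snd c p)) b)
        + \<mu> i * blinfun_apply (form_rep A c (\<lambda>p. snd (s i p)) (snd c p)) a)"
proof -
  have "blinfun_apply
      (snd (\<Sum>i\<in>J. lam i *\<^sub>R complete_lift A (s i) (p, v) + \<mu> i *\<^sub>R vertical_lift A (s i) (p, v))) Z
    = (\<Sum>i\<in>J. lam i * blinfun_apply (snd (complete_lift A (s i) (p, v))) Z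
          + \<mu> i * blinfun_apply (snd (vertical_lift A (s i) (p, v))) Z)"
    by (simp add: snd_sum blinfun.sum_left blinfun.add_left blinfun.scaleR_left)
  also have "\<dots> = (\<Sum>i\<in>J. lam i * (blinfun_apply (frechet_derivative (form_rep A c (\<lambda>p. snd (s i p))) (at (snd c p)) (vec_coord A c p v)) a
          + blinfun_apply (form_rep A c (\<lambda>p. snd (s i p)) (snd c p)) b)
        + \<mu> i * blinfun_apply (form_rep A c (\<lambda>p. snd (s i p)) (snd c p)) a)"
  proof (rule sum.cong[OF refl])
    fix i assume "i \<in> J"
    then have "smooth_form A V (\<lambda>p. snd (s i p))" using s by (simp add: is_section_def)
    then show "lam i * blinfun_apply (snd (complete_lift A (s i) (p, v))) Z
          + \<mu> i * blinfun_apply (snd (vertical_lift A (s i) (p, v))) Z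
      = lam i * (blinfun_apply (frechet_derivative (form_rep A c (\<lambda>p. snd (s i p))) (at (snd c p)) (vec_coord A c p v)) a
          + blinfun_apply (form_rep A c (\<lambda>p. snd (s i p)) (snd c p)) b)
        + \<mu> i * blinfun_apply (form_rep A c (\<lambda>p. snd (s i p)) (snd c p)) a"
      by (simp only: complete_lift_def vertical_lift_def snd_conv
          complete_lift_form_apply[OF c p V _ Z] vertical_lift_form_apply[OF c p Z])
  qed
  finally show ?thesis .
qed

text \<open>
  The derivative of \<open>g (s, t) = 0\<close> along \<open>w\<close>, in coordinates.
\<close>

lemma isotropic_sections_derivative:
  assumes c: "c \<in> charts A" and p: "p \<in> fst c"
    and V: "openin (manifold_topology A) V" "p \<in> V" and s: "is_section A D V s"
    and W: "openin (manifold_topology A) W" "p \<in> W" and t: "is_section A D W t"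
    and iso: "\<And>q. q \<in> points A \<Longrightarrow> maximal_g_isotropic (D q)"
  shows "blinfun_apply (frechet_derivative (form_rep A c (\<lambda>p. snd (s p))) (at (snd c p)) w) (vf_rep A c (\<lambda>p. fst (t p)) (snd c p))
    + blinfun_apply (form_rep A c (\<lambda>p. snd (s p)) (snd c p)) (frechet_derivative (vf_rep A c (\<lambda>p. fst (t p))) (at (snd c p)) w)
    + blinfun_apply (frechet_derivative (form_rep A c (\<lambda>p. snd (t p))) (at (snd c p)) w) (vf_rep A c (\<lambda>p. fst (s p)) (snd c p))
    + blinfun_apply (form_rep A c (\<lambda>p. snd (t p)) (snd c p)) (frechet_derivative (vf_rep A c (\<lambda>p. fst (s p))) (at (snd c p)) w) = 0"
proof -
  let ?z = "snd c p"
  let ?a = "form_rep A c (\<lambda>p. snd (s p))" and ?b = "form_rep A c (\<lambda>p. snd (t p))"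
  let ?x = "vf_rep A c (\<lambda>p. fst (s p))" and ?y = "vf_rep A c (\<lambda>p. fst (t p))"
  have da: "(?a has_derivative frechet_derivative ?a (at ?z)) (at ?z)"
    by (rule smooth_on_has_derivative[OF smooth_form_rep[OF _ V(1) c]]) (use s p V in \<open>auto simp: is_section_def\<close>)
  have db: "(?b has_derivative frechet_derivative ?b (at ?z)) (at ?z)"
    by (rule smooth_on_has_derivative[OF smooth_form_rep[OF _ W(1) c]]) (use t p W in \<open>auto simp: is_section_def\<close>)
  have dx: "(?x has_derivative frechet_derivative ?x (at ?z)) (at ?z)"
    by (rule smooth_on_has_derivative[OF smooth_vf_rep[OF _ V(1) c]]) (use s p V in \<open>auto simp: is_section_def\<close>)
  have dy: "(?y has_derivative frechet_derivative ?y (at ?z)) (at ?z)"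
    by (rule smooth_on_has_derivative[OF smooth_vf_rep[OF _ W(1) c]]) (use t p W in \<open>auto simp: is_section_def\<close>)
  have d: "((\<lambda>z. blinfun_apply (?a z) (?y z) + blinfun_apply (?b z) (?x z)) has_derivative
     (\<lambda>w. (blinfun_apply (?a ?z) (frechet_derivative ?y (at ?z) w) + blinfun_apply (frechet_derivative ?a (at ?z) w) (?y ?z))
       + (blinfun_apply (?b ?z) (frechet_derivative ?x (at ?z) w) + blinfun_apply (frechet_derivative ?b (at ?z) w) (?x ?z)))) (at ?z)"
    by (intro has_derivative_add bounded_bilinear.FDERIV[OF bounded_bilinear_blinfun_apply] da db dx dy)
  have d0: "((\<lambda>z. blinfun_apply (?a z) (?y z) + blinfun_apply (?b z) (?x z)) has_derivative (\<lambda>w. 0)) (at ?z)"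
  proof (rule has_derivative_transform_within_open)
    show "((\<lambda>z. 0::real) has_derivative (\<lambda>w. 0)) (at ?z)" by simp
    show "open (snd c ` (fst c \<inter> (V \<inter> W)))" by (intro open_chart_image c openin_Int V W)
    show "?z \<in> snd c ` (fst c \<inter> (V \<inter> W))" using p V W by blast
    fix z assume "z \<in> snd c ` (fst c \<inter> (V \<inter> W))"
    then obtain q where q: "q \<in> fst c" "q \<in> V" "q \<in> W" "z = snd c q" by blast
    have "g_pairing (s q) (t q) = 0"
      using s t q iso[OF chart_points[OF c q(1)]]
      by (auto simp: is_section_def maximal_g_isotropic_def g_isotropic_def)
    then show "0 = blinfun_apply (?a z) (?y z) + blinfun_apply (?b z) (?x z)"
      unfolding q(4) form_vf_rep[OF c q(1)] by (simp add: g_pairing_def)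
  qed
  show ?thesis using fun_cong[OF has_derivative_unique[OF d d0], of w] by linarith
qed

text \<open>
  Let \<open>t\<close> be a section and \<open>f\<^sub>i\<close> the constants with \<open>t p = \<Sum> f\<^sub>i s\<^sub>i p\<close>. The difference \<open>t - \<Sum> f\<^sub>i s\<^sub>i\<close> vanishes at
  \<open>p\<close>, so its complete lift is the vertical lift of its derivative \<open>(x, y)\<close> along \<open>v\<close>. By the differentiated
  isotropy \<open>(x, y)\<close> is \<open>g\<close>-orthogonal to \<open>D p\<close>, hence in \<open>D p\<close> by maximality. This replaces the Leibniz rule for
  sections with variable coefficients.
\<close>

lemma tangent_dirac_frame:
  assumes frame: "local_frame A D V J s" and J: "finite J"
    and V: "openin (manifold_topology A) V" "p \<in> V"
    and iso: "\<And>q. q \<in> points A \<Longrightarrow> maximal_g_isotropic (D q)"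
  shows "tangent_dirac A D (p, v) =
    {\<Sum>i\<in>J. lam i *\<^sub>R complete_lift A (s i) (p, v) + \<mu> i *\<^sub>R vertical_lift A (s i) (p, v) | lam \<mu>. True}"
    (is "_ = ?R")
proof (rule antisym)
  have sec: "\<And>i. i \<in> J \<Longrightarrow> is_section A D V (s i)" and bas: "basis_family J (\<lambda>i. s i p) (D p)"
    using frame V by (auto simp: local_frame_def)
  have pA: "p \<in> points A" using V openin_iff by blast
  let ?G = "\<Union>(V, s)\<in>{(V, s). openin (manifold_topology A) V \<and> fst (p, v) \<in> V \<and> is_section A D V s}.
       {(complete_lift_vf A (\<lambda>p. fst (s p)) (p, v), complete_lift_form A (\<lambda>p. snd (s p)) (p, v)),
        (vertical_lift_vf A (\<lambda>p. fst (s p)) (p, v), vertical_lift_form A (\<lambda>p. snd (s p)) (p, v))}"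
  show "?R \<subseteq> tangent_dirac A D (p, v)"
  proof
    fix x assume "x \<in> ?R"
    then obtain lam \<mu> where x: "x = (\<Sum>i\<in>J. lam i *\<^sub>R complete_lift A (s i) (p, v) + \<mu> i *\<^sub>R vertical_lift A (s i) (p, v))"
      by blast
    have "complete_lift A (s i) (p, v) \<in> ?G" "vertical_lift A (s i) (p, v) \<in> ?G" if "i \<in> J" for i
      using sec[OF that] V by (auto simp: complete_lift_def vertical_lift_def)
    then show "x \<in> tangent_dirac A D (p, v)"
      unfolding x tangent_dirac_def by (intro span_sum span_add span_scale span_base)
  qed
  have lin: "subspace ?R"
  proof (rule subspaceI)
    show "0 \<in> ?R" by (intro CollectI exI[of _ "\<lambda>_. 0"]) simp
    fix x y assume "x \<in> ?R" "y \<in> ?R"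
    then obtain l m l' m' where
      x: "x = (\<Sum>i\<in>J. l i *\<^sub>R complete_lift A (s i) (p, v) + m i *\<^sub>R vertical_lift A (s i) (p, v))" and
      y: "y = (\<Sum>i\<in>J. l' i *\<^sub>R complete_lift A (s i) (p, v) + m' i *\<^sub>R vertical_lift A (s i) (p, v))"
      by blast
    have "x + y = (\<Sum>i\<in>J. (l i + l' i) *\<^sub>R complete_lift A (s i) (p, v) + (m i + m' i) *\<^sub>R vertical_lift A (s i) (p, v))"
      by (simp add: x y sum.distrib scaleR_left_distrib)
    then show "x + y \<in> ?R" by (intro CollectI exI[of _ "\<lambda>i. l i + l' i"] exI[of _ "\<lambda>i. m i + m' i"]) simp
    fix r
    have "r *\<^sub>R x = (\<Sum>i\<in>J. (r * l i) *\<^sub>R complete_lift A (s i) (p, v) + (r * m i) *\<^sub>R vertical_lift A (s i) (p, v))"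
      by (simp add: x scaleR_sum_right scaleR_right_distrib)
    then show "r *\<^sub>R x \<in> ?R" by (intro CollectI exI[of _ "\<lambda>i. r * l i"] exI[of _ "\<lambda>i. r * m i"]) simp
  qed
  have gen: "complete_lift A t (p, v) \<in> ?R \<and> vertical_lift A t (p, v) \<in> ?R"
    if W: "openin (manifold_topology A) W" "p \<in> W" and t: "is_section A D W t" for W t
  proof -
    let ?k = "chart_at A p"
    have k: "?k \<in> charts A" "p \<in> fst ?k" using chart_at pA by blast+
    let ?z = "snd ?k p"
    define \<xi> where "\<xi> i = vf_rep A ?k (\<lambda>p. fst (s i p))" for i
    define \<alpha> where "\<alpha> i = form_rep A ?k (\<lambda>p. snd (s i p))" for i
    define \<eta> where "\<eta> = vf_rep A ?k (\<lambda>p. fst (t p))"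
    define \<beta> where "\<beta> = form_rep A ?k (\<lambda>p. snd (t p))"
    have vk: "vec_coord A ?k p u = u" "vec_of_coord A ?k p u = u" for u
      using vec_coord_chart_at[OF pA] vec_of_coord_chart_at[OF pA] by auto
    have val: "\<xi> i ?z = fst (s i p)" "\<alpha> i ?z = snd (s i p)" "\<eta> ?z = fst (t p)" "\<beta> ?z = snd (t p)" for i
      unfolding \<xi>_def \<alpha>_def \<eta>_def \<beta>_def
      by (auto intro!: blinfun_eqI simp: vf_rep_chart[OF k] form_rep_chart_apply[OF k] vk)
    have tp: "t p \<in> D p" using t W by (simp add: is_section_def)
    have Dp: "D p = range (\<lambda>c. \<Sum>j\<in>J. c j *\<^sub>R s j p)"
      using bas unfolding basis_family_iff[OF J] by (rule conjunct2)
    obtain f where f: "t p = (\<Sum>i\<in>J. f i *\<^sub>R s i p)" using tp unfolding Dp by blast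
    have f1: "fst (t p) = (\<Sum>i\<in>J. f i *\<^sub>R fst (s i p))" and f2: "snd (t p) = (\<Sum>i\<in>J. f i *\<^sub>R snd (s i p))"
      using f by (simp_all add: fst_sum snd_sum)
    \<comment> \<open>The derivative along \<open>v\<close> of \<open>t - \<Sum> f\<^sub>i s\<^sub>i\<close>.\<close>
    define x where "x = frechet_derivative \<eta> (at ?z) v - (\<Sum>i\<in>J. f i *\<^sub>R frechet_derivative (\<xi> i) (at ?z) v)"
    define y where "y = frechet_derivative \<beta> (at ?z) v - (\<Sum>i\<in>J. f i *\<^sub>R frechet_derivative (\<alpha> i) (at ?z) v)"
    have ort: "blinfun_apply y (fst (s j p)) + blinfun_apply (snd (s j p)) x = 0" if j: "j \<in> J" for j
    proof -
      have 1: "blinfun_apply (frechet_derivative \<beta> (at ?z) v) (fst (s j p))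
        + blinfun_apply (snd (t p)) (frechet_derivative (\<xi> j) (at ?z) v)
        + blinfun_apply (frechet_derivative (\<alpha> j) (at ?z) v) (fst (t p))
        + blinfun_apply (snd (s j p)) (frechet_derivative \<eta> (at ?z) v) = 0"
        using isotropic_sections_derivative[OF k W t V sec[OF j] iso, of v]
        by (simp only: \<xi>_def[symmetric] \<alpha>_def[symmetric] \<eta>_def[symmetric] \<beta>_def[symmetric] val)
      have 2: "blinfun_apply (frechet_derivative (\<alpha> i) (at ?z) v) (fst (s j p))
        + blinfun_apply (snd (s i p)) (frechet_derivative (\<xi> j) (at ?z) v)
        + blinfun_apply (frechet_derivative (\<alpha> j) (at ?z) v) (fst (s i p))
        + blinfun_apply (snd (s j p)) (frechet_derivative (\<xi> i) (at ?z) v) = 0" if "i \<in> J" for i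
        using isotropic_sections_derivative[OF k V sec[OF that] V sec[OF j] iso, of v]
        by (simp only: \<xi>_def[symmetric] \<alpha>_def[symmetric] val)
      have "(\<Sum>i\<in>J. f i * (blinfun_apply (frechet_derivative (\<alpha> i) (at ?z) v) (fst (s j p))
        + blinfun_apply (snd (s i p)) (frechet_derivative (\<xi> j) (at ?z) v)
        + blinfun_apply (frechet_derivative (\<alpha> j) (at ?z) v) (fst (s i p))
        + blinfun_apply (snd (s j p)) (frechet_derivative (\<xi> i) (at ?z) v))) = 0"
        using 2 by (simp add: sum.neutral)
      then show ?thesis
        using 1 unfolding x_def y_def f1 f2
        by (simp add: blinfun.diff_left blinfun.diff_right blinfun.sum_left blinfun.sum_right
            blinfun.scaleR_left blinfun.scaleR_right sum.distrib distrib_left)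
    qed
    have "(x, y) \<in> D p"
    proof (rule maximal_g_isotropic_perp[OF iso[OF pA]])
      fix b assume "b \<in> D p"
      then obtain e where e: "b = (\<Sum>j\<in>J. e j *\<^sub>R s j p)" unfolding Dp by blast
      have "blinfun_apply y (fst b) + blinfun_apply (snd b) x
         = (\<Sum>j\<in>J. e j * (blinfun_apply y (fst (s j p)) + blinfun_apply (snd (s j p)) x))"
        by (simp add: e fst_sum snd_sum blinfun.sum_left blinfun.sum_right
            blinfun.scaleR_left blinfun.scaleR_right sum.distrib distrib_left)
      also have "\<dots> = 0" using ort by (simp add: sum.neutral)
      finally show "g_pairing (x, y) b = 0" by (simp add: g_pairing_def)
    qed
    then obtain m where m: "(x, y) = (\<Sum>j\<in>J. m j *\<^sub>R s j p)" unfolding Dp by blast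
    have m1: "x = (\<Sum>j\<in>J. m j *\<^sub>R fst (s j p))" and m2: "y = (\<Sum>j\<in>J. m j *\<^sub>R snd (s j p))"
      using arg_cong[OF m, of fst] arg_cong[OF m, of snd] by (simp_all add: fst_sum snd_sum)
    have q: "tangent_chart A ?k \<in> charts (tangent_atlas A)" "(p, v) \<in> fst (tangent_chart A ?k)"
      using tangent_chart_charts[OF k(1)] k by auto
    have eqI: "P = P'" if "vec_coord (tangent_atlas A) (tangent_chart A ?k) (p, v) (fst P)
          = vec_coord (tangent_atlas A) (tangent_chart A ?k) (p, v) (fst P')"
        "\<And>Z a b. vec_coord (tangent_atlas A) (tangent_chart A ?k) (p, v) Z = (a, b) \<Longrightarrow>
          blinfun_apply (snd P) Z = blinfun_apply (snd P') Z" for P P' :: "('e \<times> 'e) big_fibre"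
    proof -
      have "fst P = fst P'" using that(1) T.vec_of_coord_coord[OF q] by metis
      moreover have "snd P = snd P'" by (rule blinfun_eqI) (metis that(2) surj_pair)
      ultimately show ?thesis by (simp add: prod_eq_iff)
    qed
    have 1: "complete_lift A t (p, v) = (\<Sum>i\<in>J. f i *\<^sub>R complete_lift A (s i) (p, v) + m i *\<^sub>R vertical_lift A (s i) (p, v))"
    proof (rule eqI)
      show "vec_coord (tangent_atlas A) (tangent_chart A ?k) (p, v) (fst (complete_lift A t (p, v)))
        = vec_coord (tangent_atlas A) (tangent_chart A ?k) (p, v)
           (fst (\<Sum>i\<in>J. f i *\<^sub>R complete_lift A (s i) (p, v) + m i *\<^sub>R vertical_lift A (s i) (p, v)))"
        using complete_lift_vf_coord[OF k W, of "\<lambda>p. fst (t p)" v] t lift_combination_vec[OF k V sec, where v = v and lam = f and \<mu> = m]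
        using m1 unfolding x_def
        by (simp add: complete_lift_def is_section_def \<xi>_def[symmetric] \<eta>_def[symmetric] val vk f1 sum.distrib
            algebra_simps)
      fix Z a b assume Z: "vec_coord (tangent_atlas A) (tangent_chart A ?k) (p, v) Z = (a, b)"
      have "blinfun_apply y a = (\<Sum>j\<in>J. m j * blinfun_apply (snd (s j p)) a)"
        by (simp add: m2 blinfun.sum_left blinfun.scaleR_left)
      then show "blinfun_apply (snd (complete_lift A t (p, v))) Z = blinfun_apply
           (snd (\<Sum>i\<in>J. f i *\<^sub>R complete_lift A (s i) (p, v) + m i *\<^sub>R vertical_lift A (s i) (p, v))) Z"
        using complete_lift_form_apply[OF k W, of "\<lambda>p. snd (t p)" v Z a b] t Z
          lift_combination_form[OF k V sec Z, where lam = f and \<mu> = m]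
        unfolding y_def
        by (simp add: complete_lift_def is_section_def \<alpha>_def[symmetric] \<beta>_def[symmetric] val vk f2 sum.distrib
            blinfun.diff_left blinfun.sum_left blinfun.scaleR_left algebra_simps)
    qed
    have 2: "vertical_lift A t (p, v) = (\<Sum>i\<in>J. 0 *\<^sub>R complete_lift A (s i) (p, v) + f i *\<^sub>R vertical_lift A (s i) (p, v))"
    proof (rule eqI)
      show "vec_coord (tangent_atlas A) (tangent_chart A ?k) (p, v) (fst (vertical_lift A t (p, v)))
        = vec_coord (tangent_atlas A) (tangent_chart A ?k) (p, v)
           (fst (\<Sum>i\<in>J. 0 *\<^sub>R complete_lift A (s i) (p, v) + f i *\<^sub>R vertical_lift A (s i) (p, v)))"
        using vertical_lift_vf_coord[OF k, of v "\<lambda>p. fst (t p)"] lift_combination_vec[OF k V sec, where v = v and lam = "\<lambda>_. 0" and \<mu> = f]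
        by (simp add: vertical_lift_def \<xi>_def[symmetric] \<eta>_def[symmetric] val vk f1)
      fix Z a b assume Z: "vec_coord (tangent_atlas A) (tangent_chart A ?k) (p, v) Z = (a, b)"
      then show "blinfun_apply (snd (vertical_lift A t (p, v))) Z = blinfun_apply
           (snd (\<Sum>i\<in>J. 0 *\<^sub>R complete_lift A (s i) (p, v) + f i *\<^sub>R vertical_lift A (s i) (p, v))) Z"
        using vertical_lift_form_apply[OF k, of v Z a b "\<lambda>p. snd (t p)"]
          lift_combination_form[OF k V sec Z, where lam = "\<lambda>_. 0" and \<mu> = f]
        by (simp add: vertical_lift_def \<alpha>_def[symmetric] \<beta>_def[symmetric] val vk f2
            blinfun.sum_left blinfun.scaleR_left)
    qed
    have "complete_lift A t (p, v) \<in> ?R" using 1 by (intro CollectI exI[of _ f] exI[of _ m] conjI TrueI)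
    moreover have "vertical_lift A t (p, v) \<in> ?R"
      using 2 by (intro CollectI exI[of _ "\<lambda>_. 0"] exI[of _ f] conjI TrueI)
    ultimately show ?thesis by blast
  qed
  show "tangent_dirac A D (p, v) \<subseteq> ?R"
    unfolding tangent_dirac_def
    by (rule span_minimal[OF _ lin]) (use gen in \<open>auto simp: complete_lift_def vertical_lift_def\<close>)
qed

end

section \<open>The two conditions in adapted coordinates\<close>

definition vf_comp where
  "vf_comp A c s z i = vf_rep A c (\<lambda>p. fst (s i p)) z"

definition form_comp where
  "form_comp A c s z i = sharp (form_rep A c (\<lambda>p. snd (s i p)) z)"

definition vf_jet where
  "vf_jet A c s z i w = frechet_derivative (vf_rep A c (\<lambda>p. fst (s i p))) (at z) w"

definition form_jet where
  "form_jet A c s z i w = sharp (frechet_derivative (form_rep A c (\<lambda>p. snd (s i p))) (at z) w)"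

abbreviation vf_jet_system where
  "vf_jet_system A c I s z \<equiv> jet_system I (vf_comp A c s z) (vf_jet A c s z)"

abbreviation form_jet_system where
  "form_jet_system A c I s z \<equiv> jet_system I (form_comp A c s z) (form_jet A c s z)"

abbreviation vf_point_system where
  "vf_point_system A c I s z \<equiv> point_system I (vf_comp A c s z) (vf_jet A c s z)"

abbreviation form_point_system where
  "form_point_system A c I s z \<equiv> point_system I (form_comp A c s z) (form_jet A c s z)"

lemma span_Basis_diff:
  fixes I :: "'e::euclidean_space set"
  assumes "I \<subseteq> Basis"
  shows "w \<in> span (Basis - I) \<longleftrightarrow> (\<forall>u\<in>I. w \<bullet> u = 0)"
  using span_substd_basis[of "Basis - I"] assms by auto

lemma inner_sum_scaleR_Basis:
  fixes u :: "'e::euclidean_space"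
  assumes "S \<subseteq> Basis" "u \<in> S"
  shows "(\<Sum>h\<in>S. f h *\<^sub>R h) \<bullet> u = f u"
proof -
  have "finite S" by (rule finite_subset[OF assms(1) finite_Basis])
  have "(\<Sum>h\<in>S. f h *\<^sub>R h) \<bullet> u = (\<Sum>h\<in>S. if h = u then f h else 0)"
    unfolding inner_sum_left using assms by (intro sum.cong) (auto simp: inner_Basis subset_iff)
  then show ?thesis using assms \<open>finite S\<close> by simp
qed

text \<open>
  The coordinates of the tangent manifold that vanish on the total space of the normal bundle: \<open>y\<^sup>h\<close> and
  the fibre coordinates \<open>w\<^sup>u\<close> along \<open>N\<close>.
\<close>

definition slice_index :: "'e::euclidean_space set \<Rightarrow> ('e \<times> 'e) set" where
  "slice_index I = (\<lambda>h. (h, 0)) ` (Basis - I) \<union> (\<lambda>u. (0, u)) ` I"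

lemma slice_index_iff:
  "(\<forall>a\<in>slice_index I. (x, y) \<bullet> a = 0) \<longleftrightarrow> (\<forall>h\<in>Basis - I. x \<bullet> h = 0) \<and> (\<forall>u\<in>I. y \<bullet> u = 0)"
  by (simp add: slice_index_def ball_Un)

lemma slice_index_Basis: "I \<subseteq> Basis \<Longrightarrow> slice_index I \<subseteq> Basis"
  by (auto simp: slice_index_def Basis_prod_def)

context atlas
begin

interpretation T: atlas "tangent_atlas A"
  by (rule atlas.intro[OF smooth_tangent_atlas])

lemma adapted_nb_iff:
  assumes c: "adapted_chart A I N nb c" and I: "I \<subseteq> Basis" and p: "p \<in> fst c" "p \<in> N"
  shows "v \<in> nb p \<longleftrightarrow> (\<forall>u\<in>I. vec_coord A c p v \<bullet> u = 0)"
proof -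
  have cA: "c \<in> charts A" and nb: "nb p = span (vec_of_coord A c p ` (Basis - I))"
    using c p by (auto simp: adapted_chart_def)
  have "v \<in> nb p \<longleftrightarrow> v \<in> vec_of_coord A c p ` span (Basis - I)"
    unfolding nb by (simp add: linear_span_image[OF linear_vec_of_coord[OF cA p(1)]])
  also have "\<dots> \<longleftrightarrow> vec_coord A c p v \<in> span (Basis - I)"
  proof
    assume "v \<in> vec_of_coord A c p ` span (Basis - I)"
    then show "vec_coord A c p v \<in> span (Basis - I)" by (auto simp: vec_coord_of_coord[OF cA p(1)])
  next
    assume "vec_coord A c p v \<in> span (Basis - I)"
    then show "v \<in> vec_of_coord A c p ` span (Basis - I)"
      by (rule image_eqI[rotated]) (simp add: vec_of_coord_coord[OF cA p(1)])
  qed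
  finally show ?thesis by (simp add: span_Basis_diff[OF I])
qed

lemma adapted_mem_iff:
  assumes c: "adapted_chart A I N nb c" and p: "p \<in> fst c"
  shows "p \<in> N \<longleftrightarrow> (\<forall>a\<in>Basis - I. snd c p \<bullet> a = 0)"
proof -
  have cA: "c \<in> charts A" and sl: "snd c ` (fst c \<inter> N) = {z \<in> snd c ` fst c. \<forall>a\<in>Basis - I. z \<bullet> a = 0}"
    using c by (auto simp: adapted_chart_def)
  have "p \<in> N \<longleftrightarrow> snd c p \<in> snd c ` (fst c \<inter> N)"
    using charts_image_iff[OF cA p, of "fst c \<inter> N"] p by auto
  then show ?thesis unfolding sl using p by auto
qed

lemma normal_bundle_slice:
  assumes c: "adapted_chart A I N nb c" and I: "I \<subseteq> Basis"
  shows "snd (tangent_chart A c) ` (fst (tangent_chart A c) \<inter> Sigma N nb)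
    = {x \<in> snd (tangent_chart A c) ` fst (tangent_chart A c). \<forall>a\<in>slice_index I. x \<bullet> a = 0}"
proof -
  have "(p, v) \<in> Sigma N nb \<longleftrightarrow> (\<forall>a\<in>slice_index I. snd (tangent_chart A c) (p, v) \<bullet> a = 0)"
    if "p \<in> fst c" for p v
    using adapted_mem_iff[OF c that] adapted_nb_iff[OF c I that]
    unfolding snd_tangent_chart slice_index_iff by auto
  then show ?thesis by fastforce
qed

lemma embedded_normal_bundle:
  assumes N: "N \<subseteq> points A" and I: "I \<subseteq> Basis"
    and ex: "\<And>p. p \<in> N \<Longrightarrow> \<exists>c. adapted_chart A I N nb c \<and> p \<in> fst c"
  shows "embedded_submanifold (tangent_atlas A) (card (Basis - slice_index I)) (Sigma N nb)"
  unfolding embedded_submanifold_def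
proof (intro conjI ballI)
  show "Sigma N nb \<subseteq> points (tangent_atlas A)" using N by (auto simp: points_tangent_atlas)
  fix q assume "q \<in> Sigma N nb"
  then obtain p v where q: "q = (p, v)" "p \<in> N" by auto
  obtain c where c: "adapted_chart A I N nb c" "p \<in> fst c" using ex[OF q(2)] by blast
  have "Basis - (Basis - slice_index I) = slice_index I" using slice_index_Basis[OF I] by auto
  then show "\<exists>c\<in>charts (tangent_atlas A). \<exists>J\<subseteq>Basis. q \<in> fst c \<and> card J = card (Basis - slice_index I) \<and>
      snd c ` (fst c \<inter> Sigma N nb) = {z \<in> snd c ` fst c. \<forall>a\<in>Basis - J. z \<bullet> a = 0}"
    using normal_bundle_slice[OF c(1) I] c tangent_chart_charts[of c] q
    by (intro bexI[of _ "tangent_chart A c"] exI[of _ "Basis - slice_index I"])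
      (auto simp: adapted_chart_def)
qed

lemma tangent_normal_bundle_iff:
  assumes c: "adapted_chart A I N nb c" and I: "I \<subseteq> Basis" and p: "p \<in> fst c" "p \<in> N" and v: "v \<in> nb p"
    and X: "vec_coord (tangent_atlas A) (tangent_chart A c) (p, v) X = (x, y)"
  shows "X \<in> tangent_space (tangent_atlas A) (Sigma N nb) (p, v) \<longleftrightarrow>
     (\<forall>h\<in>Basis - I. x \<bullet> h = 0) \<and> (\<forall>u\<in>I. y \<bullet> u = 0)"
proof -
  have cA: "c \<in> charts A" using c by (simp add: adapted_chart_def)
  show ?thesis
    using T.tangent_space_slice[OF tangent_chart_charts[OF cA] _ _ normal_bundle_slice[OF c I], of "(p, v)"] p v
    by (simp add: X slice_index_iff)
qed

text \<open>
  The tangent space is spanned by the coordinate vectors \<open>\<partial>/\<partial>x\<^sup>u\<close> and \<open>\<partial>/\<partial>w\<^sup>h\<close>. Here \<open>a\<close> and \<open>b\<close> are the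
  components of \<open>\<theta>\<close> along \<open>\<partial>/\<partial>z\<close> and \<open>\<partial>/\<partial>w\<close>.
\<close>

lemma ann_normal_bundle_iff:
  assumes c: "adapted_chart A I N nb c" and I: "I \<subseteq> Basis" and p: "p \<in> fst c" "p \<in> N" and v: "v \<in> nb p"
    and \<theta>: "\<And>Z x y. vec_coord (tangent_atlas A) (tangent_chart A c) (p, v) Z = (x, y) \<Longrightarrow>
       blinfun_apply \<theta> Z = a \<bullet> x + b \<bullet> y"
  shows "\<theta> \<in> ann (tangent_space (tangent_atlas A) (Sigma N nb) (p, v)) \<longleftrightarrow>
     (\<forall>u\<in>I. a \<bullet> u = 0) \<and> (\<forall>h\<in>Basis - I. b \<bullet> h = 0)"
proof
  have cA: "c \<in> charts A" using c by (simp add: adapted_chart_def)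
  note co = T.vec_coord_of_coord[OF tangent_chart_charts[OF cA], of "(p, v)"]
  {
    assume ann: "\<theta> \<in> ann (tangent_space (tangent_atlas A) (Sigma N nb) (p, v))"
    have "a \<bullet> x + b \<bullet> y = 0" if "\<forall>h\<in>Basis - I. x \<bullet> h = 0" "\<forall>u\<in>I. y \<bullet> u = 0" for x y
    proof -
      let ?Z = "vec_of_coord (tangent_atlas A) (tangent_chart A c) (p, v) (x, y)"
      have Z: "vec_coord (tangent_atlas A) (tangent_chart A c) (p, v) ?Z = (x, y)"
        by (rule co) (use p in simp)
      have "blinfun_apply \<theta> ?Z = 0"
        using ann tangent_normal_bundle_iff[OF c I p v Z] that by (auto simp: ann_def)
      then show ?thesis using \<theta>[OF Z] by simp
    qed
    note * = this
    show "(\<forall>u\<in>I. a \<bullet> u = 0) \<and> (\<forall>h\<in>Basis - I. b \<bullet> h = 0)"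
    proof (intro conjI ballI)
      show "a \<bullet> u = 0" if "u \<in> I" for u
      proof -
        have "\<forall>h\<in>Basis - I. u \<bullet> h = 0" using that I by (auto simp: inner_Basis subset_iff)
        then show ?thesis using *[of u 0] by simp
      qed
      show "b \<bullet> h = 0" if "h \<in> Basis - I" for h
      proof -
        have "\<forall>u\<in>I. h \<bullet> u = 0" using that I by (auto simp: inner_Basis subset_iff)
        then show ?thesis using *[of 0 h] by simp
      qed
    qed
  next
    assume ab: "(\<forall>u\<in>I. a \<bullet> u = 0) \<and> (\<forall>h\<in>Basis - I. b \<bullet> h = 0)"
    have "blinfun_apply \<theta> Z = 0" if "Z \<in> tangent_space (tangent_atlas A) (Sigma N nb) (p, v)" for Z
    proof -
      obtain x y where Z: "vec_coord (tangent_atlas A) (tangent_chart A c) (p, v) Z = (x, y)" by fastforce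
      have xy: "\<forall>h\<in>Basis - I. x \<bullet> h = 0" "\<forall>u\<in>I. y \<bullet> u = 0"
        using tangent_normal_bundle_iff[OF c I p v Z] that by auto
      have "a \<bullet> x = 0" "b \<bullet> y = 0"
        unfolding euclidean_inner[of a x] euclidean_inner[of b y]
        using ab xy by (auto intro!: sum.neutral)
      then show ?thesis using \<theta>[OF Z] by simp
    qed
    then show "\<theta> \<in> ann (tangent_space (tangent_atlas A) (Sigma N nb) (p, v))" by (simp add: ann_def)
  }
qed

context
  fixes D I N nb c p v and s :: "'e \<Rightarrow> 'p \<Rightarrow> 'e big_fibre"
  assumes iso: "\<And>q. q \<in> points A \<Longrightarrow> maximal_g_isotropic (D q)"
    and I: "I \<subseteq> Basis" and c: "adapted_chart A I N nb c"
    and s: "local_frame A D (fst c) Basis s"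
    and p: "p \<in> fst c" "p \<in> N" and v: "v \<in> nb p"
begin

text \<open>
  Each element of the fibre of the tangent Dirac structure is a combination of lifts of the frame. The
  arbitrary connective \<open>P\<close> covers both implications between the two conditions.
\<close>

lemma tangent_dirac_systems:
  "(\<forall>X \<theta>. (X, \<theta>) \<in> tangent_dirac A D (p, v) \<longrightarrow>
      P (X \<in> tangent_space (tangent_atlas A) (Sigma N nb) (p, v))
        (\<theta> \<in> ann (tangent_space (tangent_atlas A) (Sigma N nb) (p, v)))) \<longleftrightarrow>
   (\<forall>lam \<mu>. P (vf_point_system A c I s (snd c p) (vec_coord A c p v) lam \<mu>)
        (form_point_system A c I s (snd c p) (vec_coord A c p v) lam \<mu>))"
proof -
  have cA: "c \<in> charts A" using c by (simp add: adapted_chart_def)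
  let ?TS = "tangent_space (tangent_atlas A) (Sigma N nb) (p, v)"
  let ?e = "\<lambda>lam \<mu>. \<Sum>i\<in>Basis. lam i *\<^sub>R complete_lift A (s i) (p, v) + \<mu> i *\<^sub>R vertical_lift A (s i) (p, v)"
  have sec: "\<And>i. i \<in> Basis \<Longrightarrow> is_section A D (fst c) (s i)" using s by (simp add: local_frame_def)
  have 1: "fst (?e lam \<mu>) \<in> ?TS \<longleftrightarrow>
      vf_point_system A c I s (snd c p) (vec_coord A c p v) lam \<mu>" for lam \<mu>
    using tangent_normal_bundle_iff[OF c I p v
        lift_combination_vec[OF cA p(1) openin_chart[OF cA] p(1) sec, where lam = lam and \<mu> = \<mu> and v = v]]
    by (auto simp: point_system_def vf_comp_def vf_jet_def inner_sum_left inner_add_left)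
  have 2: "snd (?e lam \<mu>) \<in> ann ?TS \<longleftrightarrow>
      form_point_system A c I s (snd c p) (vec_coord A c p v) lam \<mu>" for lam \<mu>
  proof -
    define a where "a = (\<Sum>i\<in>Basis. lam i *\<^sub>R form_jet A c s (snd c p) i (vec_coord A c p v) + \<mu> i *\<^sub>R form_comp A c s (snd c p) i)"
    define b where "b = (\<Sum>i\<in>Basis. lam i *\<^sub>R form_comp A c s (snd c p) i)"
    have "snd (?e lam \<mu>) \<in> ann ?TS \<longleftrightarrow> (\<forall>u\<in>I. a \<bullet> u = 0) \<and> (\<forall>h\<in>Basis - I. b \<bullet> h = 0)"
    proof (rule ann_normal_bundle_iff[OF c I p v])
      fix Z x y assume Z: "vec_coord (tangent_atlas A) (tangent_chart A c) (p, v) Z = (x, y)"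
      have "blinfun_apply (snd (?e lam \<mu>)) Z =
        (\<Sum>i\<in>Basis. lam i * (blinfun_apply (frechet_derivative (form_rep A c (\<lambda>p. snd (s i p))) (at (snd c p)) (vec_coord A c p v)) x
          + blinfun_apply (form_rep A c (\<lambda>p. snd (s i p)) (snd c p)) y)
        + \<mu> i * blinfun_apply (form_rep A c (\<lambda>p. snd (s i p)) (snd c p)) x)"
        by (rule lift_combination_form[OF cA p(1) openin_chart[OF cA] p(1) sec Z])
      then show "blinfun_apply (snd (?e lam \<mu>)) Z = a \<bullet> x + b \<bullet> y"
        unfolding a_def b_def
        by (simp only: inner_sum_left inner_add_left inner_scaleR_left form_jet_def form_comp_def inner_sharp
            sum.distrib distrib_left ac_simps)
    qed
    then show ?thesis by (simp add: a_def b_def point_system_def inner_sum_left inner_add_left)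
  qed
  have TD: "tangent_dirac A D (p, v) = {?e lam \<mu> | lam \<mu>. True}"
    by (rule tangent_dirac_frame[OF s finite_Basis openin_chart[OF cA] p(1) iso])
  show ?thesis (is "?l \<longleftrightarrow> ?r")
  proof
    assume l: ?l
    show ?r
    proof (intro allI)
      fix lam \<mu>
      have "(fst (?e lam \<mu>), snd (?e lam \<mu>)) \<in> tangent_dirac A D (p, v)"
        unfolding TD prod.collapse by (intro CollectI exI[of _ lam] exI[of _ \<mu>] conjI TrueI refl)
      with l have "P (fst (?e lam \<mu>) \<in> ?TS) (snd (?e lam \<mu>) \<in> ann ?TS)" by (elim allE impE)
      then show "P (vf_point_system A c I s (snd c p) (vec_coord A c p v) lam \<mu>)
        (form_point_system A c I s (snd c p) (vec_coord A c p v) lam \<mu>)"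
        unfolding 1 2 .
    qed
  next
    assume r: ?r
    show ?l
    proof (intro allI impI)
      fix X \<theta> assume "(X, \<theta>) \<in> tangent_dirac A D (p, v)"
      then obtain lam \<mu> where e: "(X, \<theta>) = ?e lam \<mu>" unfolding TD by blast
      have X: "X = fst (?e lam \<mu>)" "\<theta> = snd (?e lam \<mu>)" unfolding e[symmetric] by simp_all
      show "P (X \<in> ?TS) (\<theta> \<in> ann ?TS)" unfolding X 1 2 by (rule spec[OF spec[OF r]])
    qed
  qed
qed

lemma linear_jets:
  "i \<in> Basis \<Longrightarrow> linear (vf_jet A c s (snd c p) i)" "i \<in> Basis \<Longrightarrow> linear (form_jet A c s (snd c p) i)"
proof -
  have cA: "c \<in> charts A" using c by (simp add: adapted_chart_def)
  assume "i \<in> Basis"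
  then have sec: "is_section A D (fst c) (s i)" using s by (simp add: local_frame_def)
  show "linear (vf_jet A c s (snd c p) i)"
    unfolding vf_jet_def[abs_def]
    by (rule smooth_on_linear_derivative[OF smooth_vf_rep[OF _ openin_chart[OF cA] cA]])
      (use sec p in \<open>auto simp: is_section_def\<close>)
  have "linear (frechet_derivative (form_rep A c (\<lambda>p. snd (s i p))) (at (snd c p)))"
    by (rule smooth_on_linear_derivative[OF smooth_form_rep[OF _ openin_chart[OF cA] cA]])
      (use sec p in \<open>auto simp: is_section_def\<close>)
  from linear_compose[OF this linear_sharp] show "linear (form_jet A c s (snd c p) i)"
    by (simp add: form_jet_def[abs_def] o_def)
qed

text \<open>
  Applied to \<open>(x, 0)\<close> and to \<open>(0, x)\<close>: a pair that is \<open>g\<close>-orthogonal to the frame belongs to \<open>D p\<close>.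
\<close>

lemma maximal_pair_frame:
  "maximal_pair (form_comp A c s (snd c p)) (vf_comp A c s (snd c p))"
  "maximal_pair (vf_comp A c s (snd c p)) (form_comp A c s (snd c p))"
proof -
  have cA: "c \<in> charts A" using c by (simp add: adapted_chart_def)
  have pA: "p \<in> points A" by (rule chart_points[OF cA p(1)])
  have bas: "basis_family Basis (\<lambda>i. s i p) (D p)" using s p by (simp add: local_frame_def)
  then have Dp: "D p = range (\<lambda>c. \<Sum>j\<in>Basis. c j *\<^sub>R s j p)"
    unfolding basis_family_iff[OF finite_Basis] by (rule conjunct2)
  have vf: "vf_comp A c s (snd c p) i = vec_coord A c p (fst (s i p))" for i
    by (simp add: vf_comp_def vf_rep_chart[OF cA p(1)])
  have form: "form_comp A c s (snd c p) i = sharp (cov_coord A c p (snd (s i p)))" for i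
    by (simp add: form_comp_def form_rep_def charts_inv_left[OF cA p(1)])
  have combo: "(\<Sum>i\<in>Basis. \<mu> i *\<^sub>R vf_comp A c s (snd c p) i) = vec_coord A c p (\<Sum>i\<in>Basis. \<mu> i *\<^sub>R fst (s i p))"
    "(\<Sum>i\<in>Basis. \<mu> i *\<^sub>R form_comp A c s (snd c p) i) = sharp (cov_coord A c p (\<Sum>i\<in>Basis. \<mu> i *\<^sub>R snd (s i p)))" for \<mu>
  proof -
    show "(\<Sum>i\<in>Basis. \<mu> i *\<^sub>R vf_comp A c s (snd c p) i) = vec_coord A c p (\<Sum>i\<in>Basis. \<mu> i *\<^sub>R fst (s i p))"
      by (simp add: vf linear_sum[OF linear_vec_coord[OF cA p(1)]] linear_scale[OF linear_vec_coord[OF cA p(1)]])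
    show "(\<Sum>i\<in>Basis. \<mu> i *\<^sub>R form_comp A c s (snd c p) i) = sharp (cov_coord A c p (\<Sum>i\<in>Basis. \<mu> i *\<^sub>R snd (s i p)))"
      by (rule euclidean_eqI)
        (simp add: form inner_sum_left inner_sharp cov_coord_apply[OF cA p(1)] blinfun.sum_left blinfun.scaleR_left)
  qed
  have in_D: "\<exists>\<mu>. (X, \<theta>) = (\<Sum>i\<in>Basis. \<mu> i *\<^sub>R s i p)"
    if "\<And>i. i \<in> Basis \<Longrightarrow> blinfun_apply \<theta> (fst (s i p)) + blinfun_apply (snd (s i p)) X = 0" for X \<theta>
  proof -
    have "(X, \<theta>) \<in> D p"
    proof (rule maximal_g_isotropic_perp[OF iso[OF pA]])
      fix b assume "b \<in> D p"
      then obtain e where e: "b = (\<Sum>j\<in>Basis. e j *\<^sub>R s j p)" unfolding Dp by blast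
      have "blinfun_apply \<theta> (fst b) + blinfun_apply (snd b) X
         = (\<Sum>j\<in>Basis. e j * (blinfun_apply \<theta> (fst (s j p)) + blinfun_apply (snd (s j p)) X))"
        by (simp add: e fst_sum snd_sum blinfun.sum_left blinfun.sum_right
            blinfun.scaleR_left blinfun.scaleR_right sum.distrib distrib_left)
      also have "\<dots> = 0" using that by (simp add: sum.neutral)
      finally show "g_pairing (X, \<theta>) b = 0" by (simp add: g_pairing_def)
    qed
    then show ?thesis unfolding Dp by blast
  qed
  show "maximal_pair (form_comp A c s (snd c p)) (vf_comp A c s (snd c p))"
    unfolding maximal_pair_def
  proof (intro allI impI)
    fix x :: 'e assume x: "\<forall>i\<in>Basis. x \<bullet> form_comp A c s (snd c p) i = 0"
    have "blinfun_apply (snd (s i p)) (vec_of_coord A c p x) = 0" if "i \<in> Basis" for i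
      using x that by (auto simp: form inner_commute[of x] inner_sharp cov_coord_apply[OF cA p(1)])
    then obtain \<mu> where \<mu>: "(vec_of_coord A c p x, 0) = (\<Sum>i\<in>Basis. \<mu> i *\<^sub>R s i p)"
      using in_D[of 0 "vec_of_coord A c p x"] by auto
    have "(\<Sum>i\<in>Basis. \<mu> i *\<^sub>R fst (s i p)) = vec_of_coord A c p x" "(\<Sum>i\<in>Basis. \<mu> i *\<^sub>R snd (s i p)) = 0"
      using arg_cong[OF \<mu>, of fst] arg_cong[OF \<mu>, of snd] by (simp_all add: fst_sum snd_sum)
    moreover have "sharp (cov_coord A c p 0) = 0"
      by (rule euclidean_eqI) (simp add: inner_sharp cov_coord_apply[OF cA p(1)])
    ultimately show "\<exists>\<mu>. (\<Sum>i\<in>Basis. \<mu> i *\<^sub>R vf_comp A c s (snd c p) i) = x \<and>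
         (\<Sum>i\<in>Basis. \<mu> i *\<^sub>R form_comp A c s (snd c p) i) = 0"
      by (intro exI[of _ \<mu>]) (simp add: combo vec_coord_of_coord[OF cA p(1)])
  qed
  show "maximal_pair (vf_comp A c s (snd c p)) (form_comp A c s (snd c p))"
    unfolding maximal_pair_def
  proof (intro allI impI)
    fix x :: 'e assume x: "\<forall>i\<in>Basis. x \<bullet> vf_comp A c s (snd c p) i = 0"
    let ?\<theta> = "cov_of_coord A c p (blinfun_inner_left x)"
    have "blinfun_apply ?\<theta> (fst (s i p)) = 0" if "i \<in> Basis" for i
      using x that by (auto simp: vf cov_of_coord_apply[OF cA p(1)] inner_commute)
    then obtain \<mu> where \<mu>: "(0, ?\<theta>) = (\<Sum>i\<in>Basis. \<mu> i *\<^sub>R s i p)"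
      using in_D[of ?\<theta> 0] by auto
    have "(\<Sum>i\<in>Basis. \<mu> i *\<^sub>R fst (s i p)) = 0" "(\<Sum>i\<in>Basis. \<mu> i *\<^sub>R snd (s i p)) = ?\<theta>"
      using arg_cong[OF \<mu>, of fst] arg_cong[OF \<mu>, of snd] by (simp_all add: fst_sum snd_sum)
    moreover have "sharp (cov_coord A c p ?\<theta>) = x"
    proof -
      have "cov_coord A c p ?\<theta> = blinfun_inner_left x"
        by (rule blinfun_eqI)
          (simp add: cov_coord_apply[OF cA p(1)] cov_of_coord_apply[OF cA p(1)] vec_coord_of_coord[OF cA p(1)])
      then show ?thesis by (simp add: sharp_inner_left)
    qed
    ultimately show "\<exists>\<mu>. (\<Sum>i\<in>Basis. \<mu> i *\<^sub>R form_comp A c s (snd c p) i) = x \<and>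
         (\<Sum>i\<in>Basis. \<mu> i *\<^sub>R vf_comp A c s (snd c p) i) = 0"
      by (intro exI[of _ \<mu>]) (simp add: combo linear_0[OF linear_vec_coord[OF cA p(1)]])
  qed
qed

end

lemma sum_Basis_split:
  assumes "I \<subseteq> (Basis :: 'e set)"
  shows "(\<Sum>i\<in>Basis. (if i \<in> I then f i else g i) * (if i \<in> I then x i else y i))
    = (\<Sum>i\<in>I. f i * x i) + (\<Sum>i\<in>Basis - I. g i * y i :: real)"
proof -
  have "(\<Sum>i\<in>Basis - I. (if i \<in> I then f i else g i) * (if i \<in> I then x i else y i)) = (\<Sum>i\<in>Basis - I. g i * y i)"
    by (rule sum.cong) auto
  then show ?thesis unfolding sum.subset_diff[OF assms finite_Basis] by simp
qed

lemma system_iff_jet_system: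
  fixes B :: "'e \<Rightarrow> 'p \<Rightarrow> 'e" and \<epsilon> :: "'e \<Rightarrow> 'p \<Rightarrow> 'e \<Rightarrow>\<^sub>L real"
    and C :: "'e \<Rightarrow> 'p \<Rightarrow> 'e" and \<tau> :: "'e \<Rightarrow> 'p \<Rightarrow> 'e \<Rightarrow>\<^sub>L real" and I :: "'e set"
  defines "s \<equiv> \<lambda>i p. if i \<in> I then (B i p, \<epsilon> i p) else (C i p, \<tau> i p)"
  assumes I: "I \<subseteq> Basis" and c: "c \<in> charts A" and s: "local_frame A D (fst c) Basis s" and z: "z \<in> snd c ` fst c"
  shows "system_T A c I B C z lam \<nu> \<mu> \<xi> \<longleftrightarrow>
      vf_jet_system A c I s z
        (\<lambda>i. if i \<in> I then lam i else \<nu> i) (\<lambda>i. if i \<in> I then \<mu> i else \<xi> i)"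
    and "system_A A c I \<epsilon> \<tau> z lam \<nu> \<mu> \<xi> \<longleftrightarrow>
      form_jet_system A c I s z
        (\<lambda>i. if i \<in> I then lam i else \<nu> i) (\<lambda>i. if i \<in> I then \<mu> i else \<xi> i)"
proof -
  have sec: "is_section A D (fst c) (s i)" if "i \<in> Basis" for i using s that by (simp add: local_frame_def)
  have vf: "(\<lambda>p. fst (s i p)) = (if i \<in> I then B i else C i)"
    and form: "(\<lambda>p. snd (s i p)) = (if i \<in> I then \<epsilon> i else \<tau> i)" for i
    by (auto simp: s_def)
  have dvf: "(vf_rep A c (\<lambda>p. fst (s i p)) has_derivative
      frechet_derivative (vf_rep A c (\<lambda>p. fst (s i p))) (at z)) (at z)"
    and dform: "(form_rep A c (\<lambda>p. snd (s i p)) has_derivative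
      frechet_derivative (form_rep A c (\<lambda>p. snd (s i p))) (at z)) (at z)" if i: "i \<in> Basis" for i
  proof -
    show "(vf_rep A c (\<lambda>p. fst (s i p)) has_derivative
      frechet_derivative (vf_rep A c (\<lambda>p. fst (s i p))) (at z)) (at z)"
      by (rule smooth_on_has_derivative[OF smooth_vf_rep[OF _ openin_chart[OF c] c]])
        (use sec[OF i] z in \<open>auto simp: is_section_def\<close>)
    show "(form_rep A c (\<lambda>p. snd (s i p)) has_derivative
      frechet_derivative (form_rep A c (\<lambda>p. snd (s i p))) (at z)) (at z)"
      by (rule smooth_on_has_derivative[OF smooth_form_rep[OF _ openin_chart[OF c] c]])
        (use sec[OF i] z in \<open>auto simp: is_section_def\<close>)
  qed
  have vf_i: "frechet_derivative (\<lambda>z. vf_rep A c (\<lambda>p. fst (s i p)) z \<bullet> j) (at z) h = vf_jet A c s z i h \<bullet> j"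
    if "i \<in> Basis" for i j h
    using fun_cong[OF frechet_derivative_eqI[OF bounded_linear.has_derivative[OF bounded_linear_inner_left dvf[OF that]]]]
    by (simp add: vf_jet_def)
  have form_i: "frechet_derivative (\<lambda>z. blinfun_apply (form_rep A c (\<lambda>p. snd (s i p)) z) j) (at z) h = form_jet A c s z i h \<bullet> j"
    if "i \<in> Basis" for i j h
    using fun_cong[OF frechet_derivative_eqI[OF bounded_linear.has_derivative[OF blinfun.bounded_linear_left dform[OF that]]]]
    by (simp add: form_jet_def inner_sharp)
  have split: "(\<Sum>i\<in>Basis. (if i \<in> I then f i else g i) * x i) = (\<Sum>i\<in>I. f i * x i) + (\<Sum>i\<in>Basis - I. g i * x i)"
    for f g x :: "'e \<Rightarrow> real"
    using sum_Basis_split[OF I, of f g x x] by simp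
  have IB: "i \<in> I \<Longrightarrow> i \<in> Basis" for i using I by blast
  have sT: "(\<Sum>u\<in>I. f u * (vf_rep A c (B u) z \<bullet> j)) + (\<Sum>a\<in>Basis - I. g a * (vf_rep A c (C a) z \<bullet> j))
     = (\<Sum>i\<in>Basis. (if i \<in> I then f i else g i) * (vf_comp A c s z i \<bullet> j))" for f g j
    unfolding split vf_comp_def vf by (intro arg_cong2[of _ _ _ _ "(+)"] sum.cong refl) simp_all
  have dT: "(\<Sum>u\<in>I. f u * frechet_derivative (\<lambda>z. vf_rep A c (B u) z \<bullet> j) (at z) h)
      + (\<Sum>a\<in>Basis - I. g a * frechet_derivative (\<lambda>z. vf_rep A c (C a) z \<bullet> j) (at z) h)
     = (\<Sum>i\<in>Basis. (if i \<in> I then f i else g i) * (vf_jet A c s z i h \<bullet> j))" for f g j h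
    unfolding split
  proof (intro arg_cong2[of _ _ _ _ "(+)"] sum.cong refl)
    show "f i * frechet_derivative (\<lambda>z. vf_rep A c (B i) z \<bullet> j) (at z) h = f i * (vf_jet A c s z i h \<bullet> j)" if "i \<in> I" for i
      using vf_i[OF IB[OF that], of j h] that unfolding vf by simp
    show "g i * frechet_derivative (\<lambda>z. vf_rep A c (C i) z \<bullet> j) (at z) h = g i * (vf_jet A c s z i h \<bullet> j)" if "i \<in> Basis - I" for i
      using vf_i[of i j h] that unfolding vf by simp
  qed
  have sA: "(\<Sum>u\<in>I. f u * blinfun_apply (form_rep A c (\<epsilon> u) z) j) + (\<Sum>a\<in>Basis - I. g a * blinfun_apply (form_rep A c (\<tau> a) z) j)
     = (\<Sum>i\<in>Basis. (if i \<in> I then f i else g i) * (form_comp A c s z i \<bullet> j))" for f g j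
    unfolding split form_comp_def form inner_sharp by (intro arg_cong2[of _ _ _ _ "(+)"] sum.cong refl) simp_all
  have dA: "(\<Sum>u\<in>I. f u * frechet_derivative (\<lambda>z. blinfun_apply (form_rep A c (\<epsilon> u) z) j) (at z) h)
      + (\<Sum>a\<in>Basis - I. g a * frechet_derivative (\<lambda>z. blinfun_apply (form_rep A c (\<tau> a) z) j) (at z) h)
     = (\<Sum>i\<in>Basis. (if i \<in> I then f i else g i) * (form_jet A c s z i h \<bullet> j))" for f g j h
    unfolding split
  proof (intro arg_cong2[of _ _ _ _ "(+)"] sum.cong refl)
    show "f i * frechet_derivative (\<lambda>z. blinfun_apply (form_rep A c (\<epsilon> i) z) j) (at z) h = f i * (form_jet A c s z i h \<bullet> j)" if "i \<in> I" for i
      using form_i[OF IB[OF that], of j h] that unfolding form by simp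
    show "g i * frechet_derivative (\<lambda>z. blinfun_apply (form_rep A c (\<tau> i) z) j) (at z) h = g i * (form_jet A c s z i h \<bullet> j)" if "i \<in> Basis - I" for i
      using form_i[of i j h] that unfolding form by simp
  qed
  show "system_T A c I B C z lam \<nu> \<mu> \<xi> \<longleftrightarrow>
      vf_jet_system A c I s z
        (\<lambda>i. if i \<in> I then lam i else \<nu> i) (\<lambda>i. if i \<in> I then \<mu> i else \<xi> i)"
    unfolding system_T_def jet_system_def Let_def sT dT ..
  show "system_A A c I \<epsilon> \<tau> z lam \<nu> \<mu> \<xi> \<longleftrightarrow>
      form_jet_system A c I s z
        (\<lambda>i. if i \<in> I then lam i else \<nu> i) (\<lambda>i. if i \<in> I then \<mu> i else \<xi> i)"
    unfolding system_A_def jet_system_def Let_def sA dA ..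
qed

end

section \<open>Change of frame\<close>

text \<open>
  Up to the factor \<open>\<phi>\<close> the new family is \<open>s\<^sub>i + v\<^sub>i \<Sum> k\<^sub>j s\<^sub>j\<close>. Because \<open>\<Sum> k\<^sub>j v\<^sub>j = 0\<close>, this is a transvection; its inverse
  is obtained by changing the sign of \<open>k\<close>.
\<close>

lemma basis_family_rank_one_change:
  fixes s :: "'i \<Rightarrow> 'v::real_vector"
  assumes J: "finite J" and s: "basis_family J s L" and \<phi>: "\<phi> \<noteq> 0" and kv: "(\<Sum>j\<in>J. k j * v j) = 0"
  shows "basis_family J (\<lambda>i. \<Sum>j\<in>J. (\<phi> * ((if j = i then 1 else 0) + v i * k j)) *\<^sub>R s j) L"
proof -
  let ?s = "\<lambda>i. \<Sum>j\<in>J. (\<phi> * ((if j = i then 1 else 0) + v i * k j)) *\<^sub>R s j"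
  have ind: "\<And>c. (\<Sum>j\<in>J. c j *\<^sub>R s j) = 0 \<Longrightarrow> \<forall>j\<in>J. c j = 0"
    and L: "L = range (\<lambda>c. \<Sum>j\<in>J. c j *\<^sub>R s j)"
    using s unfolding basis_family_iff[OF J] by blast+
  have comb: "(\<Sum>i\<in>J. c i *\<^sub>R ?s i) = (\<Sum>j\<in>J. (\<phi> * (c j + (\<Sum>i\<in>J. c i * v i) * k j)) *\<^sub>R s j)" for c
  proof -
    have "(\<Sum>i\<in>J. c i *\<^sub>R ?s i) = (\<Sum>j\<in>J. \<Sum>i\<in>J. (c i * (\<phi> * ((if j = i then 1 else 0) + v i * k j))) *\<^sub>R s j)"
      by (simp add: scaleR_sum_right) (rule sum.swap)
    also have "\<dots> = (\<Sum>j\<in>J. (\<phi> * (c j + (\<Sum>i\<in>J. c i * v i) * k j)) *\<^sub>R s j)"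
    proof (rule sum.cong[OF refl])
      fix j assume j: "j \<in> J"
      have "(\<Sum>i\<in>J. c i * (\<phi> * ((if j = i then 1 else 0) + v i * k j)))
          = (\<Sum>i\<in>J. (if j = i then \<phi> * c i else 0) + \<phi> * (c i * v i * k j))"
        by (rule sum.cong[OF refl]) (simp add: algebra_simps)
      also have "\<dots> = \<phi> * (c j + (\<Sum>i\<in>J. c i * v i) * k j)"
        using j J by (simp add: sum.distrib sum_distrib_left sum_distrib_right distrib_left mult.assoc)
      finally show "(\<Sum>i\<in>J. (c i * (\<phi> * ((if j = i then 1 else 0) + v i * k j))) *\<^sub>R s j)
          = (\<phi> * (c j + (\<Sum>i\<in>J. c i * v i) * k j)) *\<^sub>R s j"
        unfolding scaleR_sum_left[symmetric] by simp
    qed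
    finally show ?thesis .
  qed
  show ?thesis
    unfolding basis_family_iff[OF J] comb
  proof (intro conjI allI impI)
    fix c assume "(\<Sum>j\<in>J. (\<phi> * (c j + (\<Sum>i\<in>J. c i * v i) * k j)) *\<^sub>R s j) = 0"
    then have "\<forall>j\<in>J. \<phi> * (c j + (\<Sum>i\<in>J. c i * v i) * k j) = 0" by (rule ind)
    then have c: "\<forall>j\<in>J. c j = - (\<Sum>i\<in>J. c i * v i) * k j" using \<phi> by (auto simp: add_eq_0_iff)
    have "(\<Sum>j\<in>J. c j * v j) = (\<Sum>j\<in>J. (- (\<Sum>i\<in>J. c i * v i) * k j) * v j)"
      by (rule sum.cong[OF refl]) (use c in simp)
    also have "\<dots> = - (\<Sum>i\<in>J. c i * v i) * (\<Sum>j\<in>J. k j * v j)"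
      by (simp add: sum_distrib_left mult.assoc sum_negf)
    finally have "(\<Sum>j\<in>J. c j * v j) = 0" using kv by simp
    then show "\<forall>j\<in>J. c j = 0" using c by simp
  next
    show "L = range (\<lambda>c. \<Sum>j\<in>J. (\<phi> * (c j + (\<Sum>i\<in>J. c i * v i) * k j)) *\<^sub>R s j)"
      unfolding L
    proof (intro equalityI image_subsetI)
      fix c :: "'i \<Rightarrow> real"
      define d where "d j = c j / \<phi> - (\<Sum>i\<in>J. c i * v i) / \<phi> * k j" for j
      have "(\<Sum>i\<in>J. d i * v i) = (\<Sum>i\<in>J. c i * v i) / \<phi> - (\<Sum>i\<in>J. c i * v i) / \<phi> * (\<Sum>j\<in>J. k j * v j)"
        by (simp add: d_def left_diff_distrib sum_subtractf sum_divide_distrib sum_distrib_left mult.assoc)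
      then have "\<phi> * (d j + (\<Sum>i\<in>J. d i * v i) * k j) = c j" for j
        using kv \<phi> by (simp add: d_def field_simps)
      then show "(\<Sum>j\<in>J. c j *\<^sub>R s j) \<in> range (\<lambda>c. \<Sum>j\<in>J. (\<phi> * (c j + (\<Sum>i\<in>J. c i * v i) * k j)) *\<^sub>R s j)"
        by (intro image_eqI[where x = d]) simp_all
    qed (rule rangeI)
  qed
qed

context atlas
begin

definition change_frame where
  "change_frame c m s i p = (\<Sum>j\<in>Basis. m i j (snd c p) *\<^sub>R s j p)"
  for c :: "('p, 'e) chart" and m :: "'e \<Rightarrow> 'e \<Rightarrow> 'e \<Rightarrow> real" and s :: "'e \<Rightarrow> 'p \<Rightarrow> 'e big_fibre"

lemma change_frame_rep:
  assumes c: "c \<in> charts A" and d: "d \<in> charts A" and p: "p \<in> fst c" "p \<in> fst d"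
  shows "vf_rep A d (\<lambda>p. fst (change_frame c m s i p)) (snd d p)
      = (\<Sum>j\<in>Basis. m i j (snd c p) *\<^sub>R vf_rep A d (\<lambda>p. fst (s j p)) (snd d p))"
    and "form_rep A d (\<lambda>p. snd (change_frame c m s i p)) (snd d p)
      = (\<Sum>j\<in>Basis. m i j (snd c p) *\<^sub>R form_rep A d (\<lambda>p. snd (s j p)) (snd d p))"
proof -
  show "vf_rep A d (\<lambda>p. fst (change_frame c m s i p)) (snd d p)
      = (\<Sum>j\<in>Basis. m i j (snd c p) *\<^sub>R vf_rep A d (\<lambda>p. fst (s j p)) (snd d p))"
    by (simp add: vf_rep_chart[OF d p(2)] change_frame_def fst_sum
        linear_sum[OF linear_vec_coord[OF d p(2)]] linear_scale[OF linear_vec_coord[OF d p(2)]])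
  show "form_rep A d (\<lambda>p. snd (change_frame c m s i p)) (snd d p)
      = (\<Sum>j\<in>Basis. m i j (snd c p) *\<^sub>R form_rep A d (\<lambda>p. snd (s j p)) (snd d p))"
    by (rule blinfun_eqI)
      (simp add: form_rep_chart_apply[OF d p(2)] change_frame_def snd_sum blinfun.sum_left blinfun.scaleR_left)
qed

lemma local_frame_change:
  assumes c: "c \<in> charts A" and s: "local_frame A D (fst c) Basis s"
    and m: "\<And>i j. smooth_on (snd c ` fst c) (m i j)"
    and bas: "\<And>p. p \<in> fst c \<Longrightarrow> basis_family Basis (\<lambda>i. change_frame c m s i p) (D p)"
  shows "local_frame A D (fst c) Basis (change_frame c m s)"
  unfolding local_frame_def
proof (intro conjI ballI bas)
  fix i :: 'e assume i: "i \<in> Basis"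
  have sec: "is_section A D (fst c) (s j)" if "j \<in> Basis" for j using s that by (simp add: local_frame_def)
  show "is_section A D (fst c) (change_frame c m s i)"
    unfolding is_section_def smooth_vf_def smooth_form_def
  proof (intro conjI ballI)
    fix d assume dA: "d \<in> A"
    then have d: "d \<in> charts A" by (rule atlas_charts)
    let ?U = "snd d ` (fst d \<inter> fst c)"
    have oU: "open ?U" by (rule open_transit_domain[OF d c])
    have mU: "smooth_on ?U (m i j \<circ> transit d c)" for j
      by (rule smooth_on_compose[OF oU open_chart_range[OF c] _ smooth_transit[OF d c] m])
        (auto simp: charts_inv_left[OF d])
    have "smooth_on ?U (\<lambda>x. \<Sum>j\<in>Basis. (m i j \<circ> transit d c) x *\<^sub>R vf_rep A d (\<lambda>p. fst (s j p)) x)"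
      using sec dA by (intro smooth_on_sum smooth_on_scaleR oU mU) (auto simp: is_section_def smooth_vf_def)
    then show "smooth_on ?U (vf_rep A d (\<lambda>p. fst (change_frame c m s i p)))"
    proof (rule smooth_on_transfer[OF oU])
      fix x assume "x \<in> ?U"
      then obtain p where p: "p \<in> fst d" "p \<in> fst c" "x = snd d p" by blast
      show "(\<Sum>j\<in>Basis. (m i j \<circ> transit d c) x *\<^sub>R vf_rep A d (\<lambda>p. fst (s j p)) x)
         = vf_rep A d (\<lambda>p. fst (change_frame c m s i p)) x"
        by (simp add: p change_frame_rep[OF c d] charts_inv_left[OF d])
    qed
    have "smooth_on ?U (\<lambda>x. \<Sum>j\<in>Basis. (m i j \<circ> transit d c) x *\<^sub>R form_rep A d (\<lambda>p. snd (s j p)) x)"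
      using sec dA by (intro smooth_on_sum smooth_on_scaleR oU mU) (auto simp: is_section_def smooth_form_def)
    then show "smooth_on ?U (form_rep A d (\<lambda>p. snd (change_frame c m s i p)))"
    proof (rule smooth_on_transfer[OF oU])
      fix x assume "x \<in> ?U"
      then obtain p where p: "p \<in> fst d" "p \<in> fst c" "x = snd d p" by blast
      show "(\<Sum>j\<in>Basis. (m i j \<circ> transit d c) x *\<^sub>R form_rep A d (\<lambda>p. snd (s j p)) x)
         = form_rep A d (\<lambda>p. snd (change_frame c m s i p)) x"
        by (simp add: p change_frame_rep[OF c d] charts_inv_left[OF d])
    qed
  next
    fix p assume "p \<in> fst c"
    from bas[OF this] show "change_frame c m s i p \<in> D p"
      unfolding basis_family_def using i by (metis image_eqI span_base)
  qed
qed

lemma change_frame_jet: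
  assumes c: "c \<in> charts A" and s: "local_frame A D (fst c) Basis s" and p: "p \<in> fst c"
    and m: "\<And>j. m i j (snd c p) = (if j = i then 1 else 0)" and i: "i \<in> Basis"
    and dm: "\<And>j. (m i j has_derivative dm i j) (at (snd c p))"
  shows "vf_comp A c (change_frame c m s) (snd c p) i = vf_comp A c s (snd c p) i"
    and "form_comp A c (change_frame c m s) (snd c p) i = form_comp A c s (snd c p) i"
    and "vf_jet A c (change_frame c m s) (snd c p) i h
      = vf_jet A c s (snd c p) i h + (\<Sum>j\<in>Basis. dm i j h *\<^sub>R vf_comp A c s (snd c p) j)"
    and "form_jet A c (change_frame c m s) (snd c p) i h
      = form_jet A c s (snd c p) i h + (\<Sum>j\<in>Basis. dm i j h *\<^sub>R form_comp A c s (snd c p) j)"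
proof -
  let ?z = "snd c p"
  have sec: "is_section A D (fst c) (s j)" if "j \<in> Basis" for j using s that by (simp add: local_frame_def)
  have delta: "(\<Sum>j\<in>Basis. (if j = i then 1 else 0) *\<^sub>R f j) = f i" for f :: "'e \<Rightarrow> 'v::real_vector"
  proof -
    have "(\<Sum>j\<in>Basis. (if j = i then 1 else 0) *\<^sub>R f j) = (\<Sum>j\<in>Basis. if j = i then f j else 0)"
      by (rule sum.cong) auto
    then show ?thesis using i by simp
  qed
  show "vf_comp A c (change_frame c m s) ?z i = vf_comp A c s ?z i"
    by (simp add: vf_comp_def change_frame_rep[OF c c p p] m delta)
  show "form_comp A c (change_frame c m s) ?z i = form_comp A c s ?z i"
    by (simp add: form_comp_def change_frame_rep[OF c c p p] m delta)
  have zU: "?z \<in> snd c ` fst c" using p by blast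
  have dvf: "(vf_rep A c (\<lambda>p. fst (s j p)) has_derivative
      frechet_derivative (vf_rep A c (\<lambda>p. fst (s j p))) (at ?z)) (at ?z)" if j: "j \<in> Basis" for j
    by (rule smooth_on_has_derivative[OF smooth_vf_rep[OF _ openin_chart[OF c] c]])
      (use sec[OF j] p in \<open>auto simp: is_section_def\<close>)
  have "((\<lambda>x. \<Sum>j\<in>Basis. m i j x *\<^sub>R vf_rep A c (\<lambda>p. fst (s j p)) x) has_derivative
     (\<lambda>h. \<Sum>j\<in>Basis. m i j ?z *\<^sub>R frechet_derivative (vf_rep A c (\<lambda>p. fst (s j p))) (at ?z) h
        + dm i j h *\<^sub>R vf_rep A c (\<lambda>p. fst (s j p)) ?z)) (at ?z)"
    by (intro has_derivative_sum bounded_bilinear.FDERIV[OF bounded_bilinear_scaleR] dm dvf)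
  then have "(vf_rep A c (\<lambda>p. fst (change_frame c m s i p)) has_derivative
     (\<lambda>h. \<Sum>j\<in>Basis. m i j ?z *\<^sub>R frechet_derivative (vf_rep A c (\<lambda>p. fst (s j p))) (at ?z) h
        + dm i j h *\<^sub>R vf_rep A c (\<lambda>p. fst (s j p)) ?z)) (at ?z)"
    by (rule has_derivative_transform_within_open[OF _ open_chart_range[OF c] zU])
      (auto simp: change_frame_rep[OF c c])
  from frechet_derivative_eqI[OF this]
  show "vf_jet A c (change_frame c m s) ?z i h
      = vf_jet A c s ?z i h + (\<Sum>j\<in>Basis. dm i j h *\<^sub>R vf_comp A c s ?z j)"
    unfolding vf_jet_def vf_comp_def by (simp add: sum.distrib m delta)
  have dform: "(form_rep A c (\<lambda>p. snd (s j p)) has_derivative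
      frechet_derivative (form_rep A c (\<lambda>p. snd (s j p))) (at ?z)) (at ?z)" if j: "j \<in> Basis" for j
    by (rule smooth_on_has_derivative[OF smooth_form_rep[OF _ openin_chart[OF c] c]])
      (use sec[OF j] p in \<open>auto simp: is_section_def\<close>)
  have "((\<lambda>x. \<Sum>j\<in>Basis. m i j x *\<^sub>R form_rep A c (\<lambda>p. snd (s j p)) x) has_derivative
     (\<lambda>h. \<Sum>j\<in>Basis. m i j ?z *\<^sub>R frechet_derivative (form_rep A c (\<lambda>p. snd (s j p))) (at ?z) h
        + dm i j h *\<^sub>R form_rep A c (\<lambda>p. snd (s j p)) ?z)) (at ?z)"
    by (intro has_derivative_sum bounded_bilinear.FDERIV[OF bounded_bilinear_scaleR] dm dform)
  then have "(form_rep A c (\<lambda>p. snd (change_frame c m s i p)) has_derivative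
     (\<lambda>h. \<Sum>j\<in>Basis. m i j ?z *\<^sub>R frechet_derivative (form_rep A c (\<lambda>p. snd (s j p))) (at ?z) h
        + dm i j h *\<^sub>R form_rep A c (\<lambda>p. snd (s j p)) ?z)) (at ?z)"
    by (rule has_derivative_transform_within_open[OF _ open_chart_range[OF c] zU])
      (auto simp: change_frame_rep[OF c c])
  from frechet_derivative_eqI[OF this]
  show "form_jet A c (change_frame c m s) ?z i h
      = form_jet A c s ?z i h + (\<Sum>j\<in>Basis. dm i j h *\<^sub>R form_comp A c s ?z j)"
    unfolding form_jet_def form_comp_def
    by (simp add: sum.distrib m delta linear_add[OF linear_sharp] linear_sum[OF linear_sharp] linear_scale[OF linear_sharp])
qed

text \<open>
  A change of frame that is the identity at \<open>p\<close> and whose first derivatives in the directions \<open>h\<close> transform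
  \<open>lam\<close> into arbitrarily prescribed vectors \<open>\<kappa>\<^sub>h\<close>. Decompose \<open>\<kappa>\<^sub>h = \<beta>\<^sub>h lam + k\<^sub>h\<close> with \<open>k\<^sub>h\<close> orthogonal to \<open>lam\<close>. The
  part \<open>k\<^sub>h\<close> comes from a transvection and the part \<open>\<beta>\<^sub>h lam\<close> from the positive factor \<open>1 + \<beta> + \<beta>\<^sup>2\<close>; both are
  invertible everywhere, so the result is a frame on the whole chart domain.
\<close>

lemma change_frame_first_order:
  fixes lam :: "'e \<Rightarrow> real" and \<kappa> :: "'e \<Rightarrow> 'e \<Rightarrow> real"
  assumes c: "c \<in> charts A" and s: "local_frame A D (fst c) Basis s" and p: "p \<in> fst c"
    and z: "\<And>h. h \<in> Basis - I \<Longrightarrow> snd c p \<bullet> h = 0" and lam: "\<exists>i\<in>Basis. lam i \<noteq> 0"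
  shows "\<exists>m dm. local_frame A D (fst c) Basis (change_frame c m s) \<and>
     (\<forall>i j. m i j (snd c p) = (if j = i then 1 else 0)) \<and>
     (\<forall>i j. (m i j has_derivative dm i j) (at (snd c p))) \<and>
     (\<forall>j\<in>Basis. \<forall>h\<in>Basis - I. (\<Sum>i\<in>Basis. lam i * dm i j h) = \<kappa> h j)"
proof -
  define n where "n = (\<Sum>i\<in>Basis. lam i * lam i)"
  have n0: "n \<noteq> 0"
    using lam by (auto simp: n_def sum_nonneg_eq_0_iff)
  define v where "v i = lam i / n" for i
  have lv: "(\<Sum>i\<in>Basis. lam i * v i) = 1"
    using n0 by (simp add: v_def n_def[symmetric] sum_divide_distrib[symmetric])
  define \<beta> where "\<beta> h = (\<Sum>i\<in>Basis. \<kappa> h i * v i)" for h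
  define k where "k h j = \<kappa> h j - \<beta> h * lam j" for h j
  have kv: "(\<Sum>j\<in>Basis. k h j * v j) = 0" for h
    using lv by (simp add: k_def left_diff_distrib sum_subtractf \<beta>_def[symmetric] mult.assoc sum_distrib_left[symmetric])
  define b where "b = (\<Sum>h\<in>Basis - I. \<beta> h *\<^sub>R h)"
  define K where "K j = (\<Sum>h\<in>Basis - I. k h j *\<^sub>R h)" for j
  have bz: "snd c p \<bullet> b = 0" and Kz: "snd c p \<bullet> K j = 0" for j
    using z by (auto simp: b_def K_def inner_sum_right intro!: sum.neutral)
  have bh: "h \<bullet> b = \<beta> h" and Kh: "h \<bullet> K j = k h j" if "h \<in> Basis - I" for h j
    using inner_sum_scaleR_Basis[OF Diff_subset that] by (auto simp: b_def K_def inner_commute[of h])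
  have Kv: "(\<Sum>j\<in>Basis. (x \<bullet> K j) * v j) = 0" for x
  proof -
    have "(\<Sum>j\<in>Basis. (x \<bullet> K j) * v j) = (\<Sum>j\<in>Basis. \<Sum>h\<in>Basis - I. (x \<bullet> h) * (k h j * v j))"
      by (simp add: K_def inner_sum_right sum_distrib_left sum_distrib_right mult_ac)
    also have "\<dots> = (\<Sum>h\<in>Basis - I. (x \<bullet> h) * (\<Sum>j\<in>Basis. k h j * v j))"
      by (subst sum.swap) (simp add: sum_distrib_left)
    finally show ?thesis by (simp add: kv)
  qed
  define m where "m i j x = (1 + x \<bullet> b + (x \<bullet> b) * (x \<bullet> b)) * ((if j = i then 1 else 0) + v i * (x \<bullet> K j))" for i j x
  define dm where "dm i j h = (h \<bullet> b) * (if j = i then 1 else 0) + v i * (h \<bullet> K j)" for i j h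
  \<comment> \<open>A polynomial substitute for \<open>exp \<beta>\<close>: without zeros, and with derivative \<open>\<beta>\<close> at \<open>\<beta> = 0\<close>.\<close>
  have pos: "1 + t + t * t \<noteq> 0" for t :: real
  proof -
    have "1 + t + t * t = (t + 1/2) * (t + 1/2) + 3/4" by (simp add: algebra_simps)
    then show ?thesis using zero_le_square[of "t + 1/2"] by linarith
  qed
  have "smooth_on (snd c ` fst c) (m i j)" for i j
    unfolding m_def
    by (intro smooth_on_mult smooth_on_add smooth_on_const open_chart_range[OF c]
        smooth_on_bounded_linear bounded_linear_inner_left)
  moreover have "basis_family Basis (\<lambda>i. change_frame c m s i q) (D q)" if "q \<in> fst c" for q
    unfolding change_frame_def m_def
    by (rule basis_family_rank_one_change[OF finite_Basis _ pos Kv]) (use s that in \<open>simp add: local_frame_def\<close>)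
  ultimately have fr: "local_frame A D (fst c) Basis (change_frame c m s)"
    by (intro local_frame_change[OF c s])
  have d: "(m i j has_derivative dm i j) (at (snd c p))" for i j
    unfolding m_def dm_def
    by (rule derivative_eq_intros refl | simp)+ (simp add: bz Kz algebra_simps)
  have "(\<Sum>i\<in>Basis. lam i * dm i j h) = \<kappa> h j" if j: "j \<in> Basis" and h: "h \<in> Basis - I" for j h
  proof -
    have "(\<Sum>i\<in>Basis. lam i * dm i j h) = (\<Sum>i\<in>Basis. (if j = i then lam i * \<beta> h else 0) + k h j * (lam i * v i))"
      by (rule sum.cong[OF refl]) (simp add: dm_def bh[OF h] Kh[OF h] algebra_simps)
    also have "\<dots> = lam j * \<beta> h + k h j"
      using j by (simp add: sum.distrib sum_distrib_left[symmetric] lv)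
    finally show ?thesis by (simp add: k_def)
  qed
  then show ?thesis
    using fr d by (intro exI[of _ m] exI[of _ dm]) (simp add: m_def bz Kz)
qed

end

text \<open>
  The effect on the jet system of a change of frame which is the identity at the point.
\<close>

lemma jet_system_change:
  fixes I :: "'e::euclidean_space set"
  assumes F: "\<And>i. i \<in> Basis \<Longrightarrow> F' i = F i"
    and DF: "\<And>i h. i \<in> Basis \<Longrightarrow> DF' i h = DF i h + (\<Sum>j\<in>Basis. dm i j h *\<^sub>R F j)"
    and dm: "\<And>j h. j \<in> Basis \<Longrightarrow> h \<in> Basis - I \<Longrightarrow> (\<Sum>i\<in>Basis. lam i * dm i j h) = \<kappa> h j"
  shows "jet_system I F' DF' lam (\<lambda>_. 0) \<longleftrightarrow>
     (\<forall>h\<in>Basis - I. (\<Sum>i\<in>Basis. lam i * (F i \<bullet> h)) = 0) \<and>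
     (\<forall>s\<in>I. \<forall>h\<in>Basis - I. (\<Sum>i\<in>Basis. lam i * (DF i h \<bullet> s) + \<kappa> h i * (F i \<bullet> s)) = 0)"
proof -
  have "(\<Sum>i\<in>Basis. lam i * (DF' i h \<bullet> s)) = (\<Sum>i\<in>Basis. lam i * (DF i h \<bullet> s) + \<kappa> h i * (F i \<bullet> s))"
    if h: "h \<in> Basis - I" for s h
  proof -
    have "(\<Sum>i\<in>Basis. lam i * (DF' i h \<bullet> s))
      = (\<Sum>i\<in>Basis. lam i * (DF i h \<bullet> s)) + (\<Sum>i\<in>Basis. \<Sum>j\<in>Basis. lam i * dm i j h * (F j \<bullet> s))"
      by (simp add: DF inner_add_left inner_sum_left distrib_left sum.distrib sum_distrib_left mult.assoc)
    also have "(\<Sum>i\<in>Basis. \<Sum>j\<in>Basis. lam i * dm i j h * (F j \<bullet> s)) = (\<Sum>j\<in>Basis. \<kappa> h j * (F j \<bullet> s))"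
      by (subst sum.swap) (simp add: sum_distrib_right[symmetric] dm[OF _ h])
    finally show ?thesis by (simp add: sum.distrib)
  qed
  then show ?thesis by (simp add: jet_system_def F)
qed

context atlas
begin

text \<open>
  The implication for all frames supplies, through \<open>change_frame_first_order\<close>, the corrected implications
  that \<open>jet_systems_imp_point_system\<close> asks for.
\<close>

lemma frames_imp_point_systems:
  assumes iso: "\<And>q. q \<in> points A \<Longrightarrow> maximal_g_isotropic (D q)"
    and I: "I \<subseteq> Basis" and c: "adapted_chart A I N nb c"
    and s: "local_frame A D (fst c) Basis s" and p: "p \<in> fst c" "p \<in> N"
    and w: "w \<in> span (Basis - I)"
  shows "(\<And>s lam \<mu>. local_frame A D (fst c) Basis s \<Longrightarrow>
        form_jet_system A c I s (snd c p) lam \<mu> \<Longrightarrow>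
        vf_jet_system A c I s (snd c p) lam \<mu>) \<Longrightarrow>
      form_point_system A c I s (snd c p) w lam \<mu> \<Longrightarrow>
      vf_point_system A c I s (snd c p) w lam \<mu>"
    and "(\<And>s lam \<mu>. local_frame A D (fst c) Basis s \<Longrightarrow>
        vf_jet_system A c I s (snd c p) lam \<mu> \<Longrightarrow>
        form_jet_system A c I s (snd c p) lam \<mu>) \<Longrightarrow>
      vf_point_system A c I s (snd c p) w lam \<mu> \<Longrightarrow>
      form_point_system A c I s (snd c p) w lam \<mu>"
proof -
  have cA: "c \<in> charts A" using c by (simp add: adapted_chart_def)
  have z: "snd c p \<bullet> h = 0" if "h \<in> Basis - I" for h
    using adapted_mem_iff[OF c p(1)] p(2) that by blast
  have v: "vec_of_coord A c p w \<in> nb p"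
    using adapted_nb_iff[OF c I p] w by (simp add: vec_coord_of_coord[OF cA p(1)] span_Basis_diff[OF I])
  note max = maximal_pair_frame[OF iso I c s p v] and lin = linear_jets[OF iso I c s p v]
  have ch: "\<exists>s'. local_frame A D (fst c) Basis s' \<and>
      (jet_system I (vf_comp A c s' (snd c p)) (vf_jet A c s' (snd c p)) lam (\<lambda>_. 0) \<longleftrightarrow>
        (\<forall>h\<in>Basis - I. (\<Sum>i\<in>Basis. lam i * (vf_comp A c s (snd c p) i \<bullet> h)) = 0) \<and>
        (\<forall>u\<in>I. \<forall>h\<in>Basis - I. (\<Sum>i\<in>Basis. lam i * (vf_jet A c s (snd c p) i h \<bullet> u)
           + \<kappa> h i * (vf_comp A c s (snd c p) i \<bullet> u)) = 0)) \<and>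
      (jet_system I (form_comp A c s' (snd c p)) (form_jet A c s' (snd c p)) lam (\<lambda>_. 0) \<longleftrightarrow>
        (\<forall>h\<in>Basis - I. (\<Sum>i\<in>Basis. lam i * (form_comp A c s (snd c p) i \<bullet> h)) = 0) \<and>
        (\<forall>u\<in>I. \<forall>h\<in>Basis - I. (\<Sum>i\<in>Basis. lam i * (form_jet A c s (snd c p) i h \<bullet> u)
           + \<kappa> h i * (form_comp A c s (snd c p) i \<bullet> u)) = 0))"
    if lam: "\<exists>i\<in>Basis. lam i \<noteq> 0" for lam :: "'e \<Rightarrow> real" and \<kappa>
  proof -
    have "\<exists>m dm. local_frame A D (fst c) Basis (change_frame c m s) \<and>
     (\<forall>i j. m i j (snd c p) = (if j = i then 1 else 0)) \<and>
     (\<forall>i j. (m i j has_derivative dm i j) (at (snd c p))) \<and>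
     (\<forall>j\<in>Basis. \<forall>h\<in>Basis - I. (\<Sum>i\<in>Basis. lam i * dm i j h) = \<kappa> h j)"
      by (rule change_frame_first_order[OF cA s p(1) _ lam]) (rule z)
    then obtain m dm where mm: "local_frame A D (fst c) Basis (change_frame c m s) \<and>
     (\<forall>i j. m i j (snd c p) = (if j = i then 1 else 0)) \<and>
     (\<forall>i j. (m i j has_derivative dm i j) (at (snd c p))) \<and>
     (\<forall>j\<in>Basis. \<forall>h\<in>Basis - I. (\<Sum>i\<in>Basis. lam i * dm i j h) = \<kappa> h j)"
      by (elim exE) (rule that)
    then have m: "local_frame A D (fst c) Basis (change_frame c m s)"
      "\<And>i j. m i j (snd c p) = (if j = i then 1 else 0)"
      "\<And>i j. (m i j has_derivative dm i j) (at (snd c p))"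
      "\<And>j h. j \<in> Basis \<Longrightarrow> h \<in> Basis - I \<Longrightarrow> (\<Sum>i\<in>Basis. lam i * dm i j h) = \<kappa> h j"
      by (simp_all only: simp_thms)
    let ?s = "change_frame c m s"
    have jet: "vf_comp A c ?s (snd c p) i = vf_comp A c s (snd c p) i"
      "form_comp A c ?s (snd c p) i = form_comp A c s (snd c p) i"
      "vf_jet A c ?s (snd c p) i h
        = vf_jet A c s (snd c p) i h + (\<Sum>j\<in>Basis. dm i j h *\<^sub>R vf_comp A c s (snd c p) j)"
      "form_jet A c ?s (snd c p) i h
        = form_jet A c s (snd c p) i h + (\<Sum>j\<in>Basis. dm i j h *\<^sub>R form_comp A c s (snd c p) j)"
      if "i \<in> Basis" for i h
      by (rule change_frame_jet[where dm = dm and m = m, OF cA s p(1)]; rule m(2) m(3) that)+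
    have "vf_jet_system A c I ?s (snd c p) lam (\<lambda>_. 0) \<longleftrightarrow>
        (\<forall>h\<in>Basis - I. (\<Sum>i\<in>Basis. lam i * (vf_comp A c s (snd c p) i \<bullet> h)) = 0) \<and>
        (\<forall>u\<in>I. \<forall>h\<in>Basis - I. (\<Sum>i\<in>Basis. lam i * (vf_jet A c s (snd c p) i h \<bullet> u)
           + \<kappa> h i * (vf_comp A c s (snd c p) i \<bullet> u)) = 0)"
      by (rule jet_system_change[where dm = dm]) (simp_all only: jet m(4))
    moreover have "form_jet_system A c I ?s (snd c p) lam (\<lambda>_. 0) \<longleftrightarrow>
        (\<forall>h\<in>Basis - I. (\<Sum>i\<in>Basis. lam i * (form_comp A c s (snd c p) i \<bullet> h)) = 0) \<and>
        (\<forall>u\<in>I. \<forall>h\<in>Basis - I. (\<Sum>i\<in>Basis. lam i * (form_jet A c s (snd c p) i h \<bullet> u)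
           + \<kappa> h i * (form_comp A c s (snd c p) i \<bullet> u)) = 0)"
      by (rule jet_system_change[where dm = dm]) (simp_all only: jet m(4))
    ultimately show ?thesis
      using m(1) by (intro exI[of _ ?s] conjI)
  qed
  {
    assume H: "\<And>s lam \<mu>. local_frame A D (fst c) Basis s \<Longrightarrow>
        form_jet_system A c I s (snd c p) lam \<mu> \<Longrightarrow>
        vf_jet_system A c I s (snd c p) lam \<mu>"
      and P: "form_point_system A c I s (snd c p) w lam \<mu>"
    show "vf_point_system A c I s (snd c p) w lam \<mu>"
    proof (rule jet_systems_imp_point_system[OF max(1) I lin(2) lin(1) w H[OF s] _ P])
      fix \<kappa> and lam :: "'e \<Rightarrow> real" assume l: "\<exists>i\<in>Basis. lam i \<noteq> 0"
        and a: "\<forall>h\<in>Basis - I. (\<Sum>i\<in>Basis. lam i * (form_comp A c s (snd c p) i \<bullet> h)) = 0"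
          "\<forall>u\<in>I. \<forall>h\<in>Basis - I. (\<Sum>i\<in>Basis. lam i * (form_jet A c s (snd c p) i h \<bullet> u)
           + \<kappa> h i * (form_comp A c s (snd c p) i \<bullet> u)) = 0"
      from ch[OF l, of \<kappa>] show "(\<forall>h\<in>Basis - I. (\<Sum>i\<in>Basis. lam i * (vf_comp A c s (snd c p) i \<bullet> h)) = 0) \<and>
        (\<forall>u\<in>I. \<forall>h\<in>Basis - I. (\<Sum>i\<in>Basis. lam i * (vf_jet A c s (snd c p) i h \<bullet> u)
           + \<kappa> h i * (vf_comp A c s (snd c p) i \<bullet> u)) = 0)"
        using a H by blast
    qed
  next
    assume H: "\<And>s lam \<mu>. local_frame A D (fst c) Basis s \<Longrightarrow>
        vf_jet_system A c I s (snd c p) lam \<mu> \<Longrightarrow>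
        form_jet_system A c I s (snd c p) lam \<mu>"
      and P: "vf_point_system A c I s (snd c p) w lam \<mu>"
    show "form_point_system A c I s (snd c p) w lam \<mu>"
    proof (rule jet_systems_imp_point_system[OF max(2) I lin(1) lin(2) w H[OF s] _ P])
      fix \<kappa> and lam :: "'e \<Rightarrow> real" assume l: "\<exists>i\<in>Basis. lam i \<noteq> 0"
        and a: "\<forall>h\<in>Basis - I. (\<Sum>i\<in>Basis. lam i * (vf_comp A c s (snd c p) i \<bullet> h)) = 0"
          "\<forall>u\<in>I. \<forall>h\<in>Basis - I. (\<Sum>i\<in>Basis. lam i * (vf_jet A c s (snd c p) i h \<bullet> u)
           + \<kappa> h i * (vf_comp A c s (snd c p) i \<bullet> u)) = 0"
      from ch[OF l, of \<kappa>] show "(\<forall>h\<in>Basis - I. (\<Sum>i\<in>Basis. lam i * (form_comp A c s (snd c p) i \<bullet> h)) = 0) \<and>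
        (\<forall>u\<in>I. \<forall>h\<in>Basis - I. (\<Sum>i\<in>Basis. lam i * (form_jet A c s (snd c p) i h \<bullet> u)
           + \<kappa> h i * (form_comp A c s (snd c p) i \<bullet> u)) = 0)"
        using a H by blast
    qed
  }
qed

text \<open>
  The two connectives \<open>P\<close> stand for isotropy and coisotropy. From left to right, the implications at all
  \<open>w\<close> are evaluated as in \<open>point_systems_imp_jet_systems\<close>; from right to left, one adapted chart and one
  frame around each point suffice, but the implication is used for all frames obtained from this one.
\<close>

lemma tangent_dirac_iff_jet_systems:
  assumes iso: "\<And>q. q \<in> points A \<Longrightarrow> maximal_g_isotropic (D q)"
    and I: "I \<subseteq> Basis"
    and ex: "\<And>p. p \<in> N \<Longrightarrow> \<exists>c s. adapted_chart A I N nb c \<and> p \<in> fst c \<and>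
      local_frame A D (fst c) Basis (s :: 'e \<Rightarrow> 'p \<Rightarrow> 'e big_fibre)"
    and P: "P = (\<lambda>x y. x \<longrightarrow> y) \<or> P = (\<lambda>x y. y \<longrightarrow> x)"
  shows "(\<forall>q\<in>Sigma N nb. \<forall>X \<theta>. (X, \<theta>) \<in> tangent_dirac A D q \<longrightarrow>
       P (X \<in> tangent_space (tangent_atlas A) (Sigma N nb) q)
         (\<theta> \<in> ann (tangent_space (tangent_atlas A) (Sigma N nb) q))) \<longleftrightarrow>
     (\<forall>c s. adapted_chart A I N nb c \<and> local_frame A D (fst c) Basis (s :: 'e \<Rightarrow> 'p \<Rightarrow> 'e big_fibre) \<longrightarrow>
       (\<forall>p\<in>fst c \<inter> N. \<forall>lam \<mu>.
          P (vf_jet_system A c I s (snd c p) lam \<mu>) (form_jet_system A c I s (snd c p) lam \<mu>)))"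
    (is "?l \<longleftrightarrow> ?r")
proof
  let ?T = "tangent_space (tangent_atlas A) (Sigma N nb)"
  have sys: "(\<forall>X \<theta>. (X, \<theta>) \<in> tangent_dirac A D (p, v) \<longrightarrow> P (X \<in> ?T (p, v)) (\<theta> \<in> ann (?T (p, v)))) \<longleftrightarrow>
      (\<forall>lam \<mu>. P (vf_point_system A c I s (snd c p) (vec_coord A c p v) lam \<mu>)
         (form_point_system A c I s (snd c p) (vec_coord A c p v) lam \<mu>))"
    if "adapted_chart A I N nb c" "local_frame A D (fst c) Basis s" "p \<in> fst c" "p \<in> N" "v \<in> nb p" for c s p v
    by (rule tangent_dirac_systems[OF iso I that])
  {
    assume l: ?l
    show ?r
    proof (intro allI impI ballI, elim conjE)
      fix c lam \<mu> p and s :: "'e \<Rightarrow> 'p \<Rightarrow> 'e big_fibre"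
      assume c: "adapted_chart A I N nb c" and s: "local_frame A D (fst c) Basis s" and "p \<in> fst c \<inter> N"
      then have p: "p \<in> fst c" "p \<in> N" by auto
      have cA: "c \<in> charts A" using c by (simp add: adapted_chart_def)
      have imp: "P (vf_point_system A c I s (snd c p) w lam \<mu>) (form_point_system A c I s (snd c p) w lam \<mu>)"
        if w: "w \<in> span (Basis - I)" for w lam \<mu>
      proof -
        let ?v = "vec_of_coord A c p w"
        have vw: "vec_coord A c p ?v = w" by (rule vec_coord_of_coord[OF cA p(1)])
        have v: "?v \<in> nb p"
          using w unfolding adapted_nb_iff[OF c I p] vw span_Basis_diff[OF I] .
        have "(p, ?v) \<in> Sigma N nb" using p v by blast
        from bspec[OF l this] show ?thesis
          unfolding sys[OF c s p v] vw by blast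
      qed
      have v: "0 \<in> nb p" unfolding adapted_nb_iff[OF c I p] linear_0[OF linear_vec_coord[OF cA p(1)]] by simp
      note lin = linear_jets[OF iso I c s p v]
      from P show "P (vf_jet_system A c I s (snd c p) lam \<mu>) (form_jet_system A c I s (snd c p) lam \<mu>)"
      proof
        assume P: "P = (\<lambda>x y. x \<longrightarrow> y)"
        show ?thesis unfolding P
          by (rule impI, rule point_systems_imp_jet_systems[OF lin(1) lin(2)]) (use imp P in auto)
      next
        assume P: "P = (\<lambda>x y. y \<longrightarrow> x)"
        show ?thesis unfolding P
          by (rule impI, rule point_systems_imp_jet_systems[OF lin(2) lin(1)]) (use imp P in auto)
      qed
    qed
  next
    assume r: ?r
    show ?l
    proof (intro ballI)
      fix q assume "q \<in> Sigma N nb"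
      then obtain p v where q: "q = (p, v)" "p \<in> N" "v \<in> nb p" by auto
      obtain c and s :: "'e \<Rightarrow> 'p \<Rightarrow> 'e big_fibre" where c: "adapted_chart A I N nb c" and p: "p \<in> fst c" "p \<in> N"
        and s: "local_frame A D (fst c) Basis s" using ex[OF q(2)] q(2) by blast
      have w: "vec_coord A c p v \<in> span (Basis - I)"
        using q(3) unfolding adapted_nb_iff[OF c I p] span_Basis_diff[OF I] .
      have H: "P (vf_jet_system A c I s (snd c p) lam \<mu>) (form_jet_system A c I s (snd c p) lam \<mu>)"
        if "local_frame A D (fst c) Basis s" for s :: "'e \<Rightarrow> 'p \<Rightarrow> 'e big_fibre" and lam \<mu>
        using r c p that by blast
      note fr = frames_imp_point_systems[OF iso I c s p w]
      have "P (vf_point_system A c I s (snd c p) (vec_coord A c p v) lam \<mu>)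
          (form_point_system A c I s (snd c p) (vec_coord A c p v) lam \<mu>)" for lam \<mu>
        using P
      proof
        assume P: "P = (\<lambda>x y. x \<longrightarrow> y)"
        show ?thesis unfolding P by (rule impI, rule fr(2)) (use H P in auto)
      next
        assume P: "P = (\<lambda>x y. y \<longrightarrow> x)"
        show ?thesis unfolding P by (rule impI, rule fr(1)) (use H P in auto)
      qed
      then show "\<forall>X \<theta>. (X, \<theta>) \<in> tangent_dirac A D q \<longrightarrow> P (X \<in> ?T q) (\<theta> \<in> ann (?T q))"
        unfolding q(1) sys[OF c s p q(3)] by blast
    qed
  }
qed

end

section \<open>Existence of adapted charts\<close>

lemma smooth_local_inverse:
  fixes f :: "'a::euclidean_space \<Rightarrow> 'a"
  assumes \<Omega>: "open \<Omega>" and f: "smooth_on \<Omega> f" and z: "z \<in> \<Omega>" and inj: "inj (frechet_derivative f (at z))"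
  shows "\<exists>U V g. open U \<and> U \<subseteq> \<Omega> \<and> z \<in> U \<and> open V \<and> homeomorphism U V f g \<and> smooth_on V g"
proof -
  define f' where "f' x = Blinfun (frechet_derivative f (at x))" for x
  have f': "blinfun_apply (f' x) = frechet_derivative f (at x)" if "x \<in> \<Omega>" for x
    unfolding f'_def using smooth_on_linear_derivative[OF f that]
    by (simp add: bounded_linear_Blinfun_apply linear_conv_bounded_linear)
  have der: "(f has_derivative blinfun_apply (f' x)) (at x)" if "x \<in> \<Omega>" for x
    unfolding f'[OF that] by (rule smooth_on_has_derivative[OF f that])
  have cont: "continuous_on \<Omega> f'"
  proof (rule continuous_on_blinfun_componentwise)
    fix i :: 'a
    show "continuous_on \<Omega> (\<lambda>x. blinfun_apply (f' x) i)"
      by (rule continuous_on_eq[OF smooth_on_continuous[OF smooth_on_derivative[OF f, of i]]]) (simp add: f')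
  qed
  obtain h where h: "linear h" "h \<circ> frechet_derivative f (at z) = id"
    using linear_injective_left_inverse[OF smooth_on_linear_derivative[OF f z] inj] by blast
  have "Blinfun h o\<^sub>L f' z = id_blinfun"
  proof (rule blinfun_eqI)
    fix i
    have "h (frechet_derivative f (at z) i) = i" using fun_cong[OF h(2), of i] by simp
    then show "blinfun_apply (Blinfun h o\<^sub>L f' z) i = blinfun_apply id_blinfun i"
      using h(1) by (simp add: f'[OF z] bounded_linear_Blinfun_apply linear_conv_bounded_linear)
  qed
  from inverse_function_theorem[OF \<Omega> der cont z this]
  obtain U V g g' where U: "open U" "U \<subseteq> \<Omega>" "z \<in> U" "open V" "homeomorphism U V f g"
    and g: "\<And>y. y \<in> V \<Longrightarrow> (g has_derivative g' y) (at y)"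
      "\<And>y. y \<in> V \<Longrightarrow> g' y = inv (blinfun_apply (f' (g y)))"
      "\<And>y. y \<in> V \<Longrightarrow> bij (blinfun_apply (f' (g y)))"
    by metis
  have gV: "g ` V \<subseteq> \<Omega>" using U by (auto simp: homeomorphism_def)
  have "frechet_derivative f (at (g y)) (g' y w) = w" if "y \<in> V" for y w
  proof -
    have "g y \<in> \<Omega>" using gV that by blast
    then show ?thesis
      using g(2,3)[OF that] by (simp add: f' bij_is_surj surj_f_inv_f)
  qed
  then have "smooth_on V g"
    unfolding smooth_on_def using Ck_on_inverse_function[OF U(4) \<Omega> f gV g(1)] by blast
  then show ?thesis using U by blast
qed

context atlas
begin

lemma openin_chart_preimage:
  assumes c: "c \<in> charts A" and S: "open S"
  shows "openin (manifold_topology A) {q \<in> fst c. snd c q \<in> S}"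
  unfolding openin_iff
proof (intro conjI ballI)
  show "{q \<in> fst c. snd c q \<in> S} \<subseteq> points A" using chartsD(2)[OF c] by blast
  fix e assume "e \<in> A"
  then have e: "e \<in> charts A" by (rule atlas_charts)
  have "snd e ` (fst e \<inter> {q \<in> fst c. snd c q \<in> S}) = snd e ` (fst e \<inter> fst c) \<inter> transit e c -` S"
    by (auto simp: charts_inv_left[OF e])
  then show "open (snd e ` (fst e \<inter> {q \<in> fst c. snd c q \<in> S}))"
    using continuous_open_preimage[OF smooth_on_continuous[OF smooth_transit[OF e c]] open_transit_domain[OF e c] S]
    by simp
qed

lemma reparametrized_chart:
  assumes c: "c \<in> charts A" and B: "open B" and f: "smooth_on B f" and fB: "f ` B \<subseteq> snd c ` fst c"
    and ofB: "open (f ` B)" and V: "open V" "f ` B \<subseteq> V" and g: "smooth_on V g" and gf: "\<And>z. z \<in> B \<Longrightarrow> g (f z) = z"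
  defines "d \<equiv> ({q \<in> fst c. snd c q \<in> f ` B}, g \<circ> snd c)"
  shows "d \<in> charts A" "snd d ` fst d = B" "\<And>z. z \<in> B \<Longrightarrow> chart_inv d z = chart_inv c (f z)"
    "\<And>z. z \<in> B \<Longrightarrow> chart_inv c (f z) \<in> fst d" "\<And>z. z \<in> B \<Longrightarrow> snd c (chart_inv c (f z)) = f z"
proof -
  have k: "chart_inv c (f z) \<in> fst c" "snd c (chart_inv c (f z)) = f z" if "z \<in> B" for z
  proof -
    have "f z \<in> snd c ` fst c" by (rule subsetD[OF fB imageI[OF that]])
    then obtain q where q: "q \<in> fst c" "f z = snd c q" by (elim imageE)
    show "chart_inv c (f z) \<in> fst c" "snd c (chart_inv c (f z)) = f z"
      using q by (simp_all add: charts_inv_left[OF c])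
  qed
  show kd: "\<And>z. z \<in> B \<Longrightarrow> chart_inv c (f z) \<in> fst d" "\<And>z. z \<in> B \<Longrightarrow> snd c (chart_inv c (f z)) = f z"
    using k by (simp_all add: d_def)
  have sd: "snd d (chart_inv c (f z)) = z" if "z \<in> B" for z
    using k[OF that] gf[OF that] by (simp add: d_def)
  have fd: "\<exists>z\<in>B. q = chart_inv c (f z)" if q: "q \<in> fst d" for q
  proof -
    obtain z where "z \<in> B" "snd c q = f z" "q \<in> fst c" using q by (auto simp: d_def)
    then show ?thesis using charts_inv_left[OF c, of q] by auto
  qed
  show im: "snd d ` fst d = B"
  proof (intro equalityI subsetI)
    fix x assume "x \<in> snd d ` fst d"
    then obtain q where q: "q \<in> fst d" "x = snd d q" by blast
    from fd[OF q(1)] show "x \<in> B" using q sd by auto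
  next
    fix z assume "z \<in> B"
    then show "z \<in> snd d ` fst d" using kd(1) sd by (intro image_eqI[of _ _ "chart_inv c (f z)"]) auto
  qed
  have "inj_on (snd d) (fst d)"
  proof (rule inj_onI)
    fix x y assume "x \<in> fst d" "y \<in> fst d" "snd d x = snd d y"
    then show "x = y" using fd[of x] fd[of y] sd by auto
  qed
  then have ch: "is_chart d" by (simp add: is_chart_def im B)
  show inv: "chart_inv d z = chart_inv c (f z)" if "z \<in> B" for z
    using chart_inv_left[OF ch kd(1)[OF that]] sd[OF that] by simp
  have od: "openin (manifold_topology A) (fst d)"
    using openin_chart_preimage[OF c ofB] by (simp add: d_def)
  have "compatible d e \<and> compatible e d" if "e \<in> A" for e
  proof
    have e: "e \<in> charts A" using that by (rule atlas_charts)
    let ?E = "snd c ` (fst c \<inter> fst e)"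
    have E: "open ?E" by (rule open_transit_domain[OF c e])
    have dE: "snd d ` (fst d \<inter> fst e) = B \<inter> f -` ?E"
    proof (intro equalityI subsetI)
      fix x assume "x \<in> snd d ` (fst d \<inter> fst e)"
      then obtain q where q: "q \<in> fst d" "q \<in> fst e" "x = snd d q" by blast
      from fd[OF q(1)] obtain z where z: "z \<in> B" "q = chart_inv c (f z)" by (elim bexE)
      have "f z = snd c q" "q \<in> fst c" using k[OF z(1)] z(2) by auto
      then show "x \<in> B \<inter> f -` ?E" using q z sd[OF z(1)] by auto
    next
      fix z assume z: "z \<in> B \<inter> f -` ?E"
      then obtain q where q: "q \<in> fst c" "q \<in> fst e" "f z = snd c q" by blast
      have "chart_inv c (f z) = q" unfolding q(3) by (rule charts_inv_left[OF c q(1)])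
      then show "z \<in> snd d ` (fst d \<inter> fst e)"
        using z q sd[of z] kd(1)[of z] by (intro image_eqI[of _ _ q]) auto
    qed
    have odE: "open (B \<inter> f -` ?E)"
      by (rule continuous_open_preimage[OF smooth_on_continuous[OF f] B E])
    have "smooth_on (B \<inter> f -` ?E) (transit c e \<circ> f)"
      by (rule smooth_on_compose[OF odE E _ smooth_on_subset[OF f] smooth_transit[OF c e]]) auto
    then have "smooth_on (B \<inter> f -` ?E) (transit d e)"
      by (rule smooth_on_transfer[OF odE]) (simp add: inv)
    then show "compatible d e" unfolding compatible_def dE by (rule conjI[OF odE])
    let ?D = "snd e ` (fst e \<inter> fst d)"
    have oD: "open ?D" by (rule open_chart_image[OF e od])
    have sub: "fst d \<subseteq> fst c" by (auto simp: d_def)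
    have "smooth_on ?D (g \<circ> transit e c)"
    proof (rule smooth_on_compose[OF oD V(1) _ _ g])
      show "transit e c ` ?D \<subseteq> V"
        using V(2) by (auto simp: charts_inv_left[OF e] d_def)
      show "smooth_on ?D (transit e c)"
        by (rule smooth_on_subset[OF smooth_transit[OF e c]]) (use sub in auto)
    qed
    then have "smooth_on ?D (transit e d)" by (simp add: d_def o_def)
    then show "compatible e d" unfolding compatible_def by (rule conjI[OF oD])
  qed
  moreover have "fst d \<subseteq> points A" using od openin_iff by blast
  ultimately show "d \<in> charts A" using ch by (simp add: charts_def)
qed

lemma span_vec_of_coord_iff:
  assumes c: "c \<in> charts A" and p: "p \<in> fst c" and S: "S \<subseteq> Basis"
  shows "span (vec_of_coord A c p ` S) = {v. \<forall>u\<in>Basis - S. vec_coord A c p v \<bullet> u = 0}"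
proof -
  have "Basis - (Basis - S) = S" using S by blast
  then have w: "w \<in> span S \<longleftrightarrow> (\<forall>u\<in>Basis - S. w \<bullet> u = 0)" for w
    using span_Basis_diff[of "Basis - S" w] by simp
  show ?thesis
    unfolding linear_span_image[OF linear_vec_of_coord[OF c p]]
  proof (intro equalityI subsetI)
    fix v assume "v \<in> vec_of_coord A c p ` span S"
    then show "v \<in> {v. \<forall>u\<in>Basis - S. vec_coord A c p v \<bullet> u = 0}"
      by (auto simp: vec_coord_of_coord[OF c p] w)
  next
    fix v assume "v \<in> {v. \<forall>u\<in>Basis - S. vec_coord A c p v \<bullet> u = 0}"
    then have "vec_coord A c p v \<in> span S" by (simp add: w)
    then show "v \<in> vec_of_coord A c p ` span S"
      by (rule image_eqI[rotated]) (simp add: vec_of_coord_coord[OF c p])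
  qed
qed

lemma normal_bundle_rank:
  assumes c: "c \<in> charts A" and p: "p \<in> fst c" "p \<in> N" and J: "J \<subseteq> Basis"
    and slice: "snd c ` (fst c \<inter> N) = {z \<in> snd c ` fst c. \<forall>a\<in>Basis - J. z \<bullet> a = 0}"
    and nb: "subspace (nb p)" "nb p \<inter> tangent_space A N p = {0}"
      "{v + w | v w. v \<in> nb p \<and> w \<in> tangent_space A N p} = UNIV"
    and bas: "basis_family {..<k} f (nb p)"
  shows "k = card (Basis - J :: 'e set)"
proof -
  have T: "tangent_space A N p = span (vec_of_coord A c p ` J)"
    unfolding tangent_space_slice[OF c p slice] span_vec_of_coord_iff[OF c p(1) J] ..
  have "inj (vec_of_coord A c p)" using vec_coord_of_coord[OF c p(1)] by (metis injI)
  then have "dim (vec_of_coord A c p ` J) = dim J"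
    by (intro dim_image_eq linear_vec_of_coord c p) (auto intro: inj_on_subset)
  moreover have "dim J = card J"
    using independent_mono[OF independent_Basis J] by (rule dim_eq_card_independent)
  ultimately have dT: "dim (tangent_space A N p) = card J" by (simp add: T)
  have dn: "dim (nb p) = k"
    using bas unfolding basis_family_def by (metis card_image card_lessThan dim_eq_card_independent dim_span)
  have "subspace (tangent_space A N p)" unfolding T by (rule subspace_span)
  from dim_sums_Int[OF nb(1) this] have "DIM('e) = k + card J"
    unfolding nb(2,3) dT dn by simp
  then show ?thesis using card_Diff_subset[OF finite_subset[OF J finite_Basis] J] by simp
qed

text \<open>
  Near a point of \<open>N\<close>, take a slice chart and a local frame \<open>Y\<^sub>a\<close> of the normal bundle, written as vector
  fields in this chart. The map \<open>\<Psi>(x, y) = (x, 0) + \<Sum> y\<^sup>a Y\<^sub>a(x, 0)\<close> has \<open>\<partial>\<Psi>/\<partial>y\<^sup>a = Y\<^sub>a\<close> at \<open>y = 0\<close> and maps exactly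
  \<open>y = 0\<close> into \<open>N\<close>, because the \<open>Y\<^sub>a\<close> are independent modulo the tangent space of \<open>N\<close>. It is a local
  diffeomorphism, and its inverse after the slice chart is adapted. In the formal text \<open>\<psi>\<close> is
  \<open>(x, y) \<mapsto> (x, 0)\<close>, combined with a bijection from \<open>I\<close> to the indices of the slice chart along \<open>N\<close>. The
  range is a ball about a point with \<open>y = 0\<close>, so the fibres are star-shaped.
\<close>

lemma adapted_chart_exists:
  assumes emb: "embedded_submanifold A (card I) N" and I: "I \<subseteq> Basis" and nb: "normal_bundle A N nb"
    and p: "p \<in> N" and W: "openin (manifold_topology A) W" "p \<in> W"
  shows "\<exists>d. adapted_chart A I N nb d \<and> p \<in> fst d \<and> fst d \<subseteq> W"
proof -
  from emb p have "\<exists>c\<in>charts A. \<exists>J\<subseteq>Basis. p \<in> fst c \<and> card J = card I \<and>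
        snd c ` (fst c \<inter> N) = {z \<in> snd c ` fst c. \<forall>a\<in>Basis - J. z \<bullet> a = 0}"
    unfolding embedded_submanifold_def by blast
  then obtain c J where c: "c \<in> charts A" and J: "J \<subseteq> Basis" and pc: "p \<in> fst c" and cJ: "card J = card I"
    and slice: "snd c ` (fst c \<inter> N) = {z \<in> snd c ` fst c. \<forall>a\<in>Basis - J. z \<bullet> a = 0}"
    by blast
  from nb p have "\<exists>V (k::nat) X. openin (manifold_topology A) V \<and> p \<in> V \<and> (\<forall>i<k. smooth_vf A V (X i)) \<and>
        (\<forall>q\<in>V \<inter> N. basis_family {..<k} (\<lambda>i. X i q) (nb q))"
    unfolding normal_bundle_def by blast
  then obtain V and k :: nat and X where V: "openin (manifold_topology A) V" "p \<in> V" and X: "\<And>i. i < k \<Longrightarrow> smooth_vf A V (X i)"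
    and bas: "\<And>q. q \<in> V \<Longrightarrow> q \<in> N \<Longrightarrow> basis_family {..<k} (\<lambda>i. X i q) (nb q)"
    by blast
  have nbq: "subspace (nb q)" "nb q \<inter> tangent_space A N q = {0}"
      "{v + w | v w. v \<in> nb q \<and> w \<in> tangent_space A N q} = UNIV" if "q \<in> N" for q
    using nb that unfolding normal_bundle_def by blast+
  have fin: "finite I" "finite J" "finite (Basis - I)"
    using finite_subset[OF I] finite_subset[OF J] by auto
  have "k = card (Basis - J)"
    by (rule normal_bundle_rank[where nb = nb and p = p, OF c pc p J slice nbq[OF p] bas[OF V(2) p]])
  then have "card (Basis - I) = card {..<k}"
    using cJ card_Diff_subset[OF fin(2) J] card_Diff_subset[OF fin(1) I] by simp
  then obtain \<pi> where \<pi>: "bij_betw \<pi> (Basis - I) {..<k}"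
    using finite_same_card_bij[OF fin(3)] by blast
  obtain \<sigma> where \<sigma>: "bij_betw \<sigma> I J" using finite_same_card_bij[OF fin(1,2)] cJ by metis
  have \<pi>k: "\<pi> a < k" if "a \<in> Basis - I" for a using \<pi> that by (auto simp: bij_betw_def)
  have basN: "basis_family (Basis - I) (\<lambda>a. X (\<pi> a) q) (nb q)" if "q \<in> V" "q \<in> N" for q
    using basis_family_reindex[OF \<pi> bas[OF that]] by (simp add: o_def)
  define Y where "Y a = vf_rep A c (X (\<pi> a))" for a
  let ?U = "snd c ` (fst c \<inter> (V \<inter> W))"
  have oU: "open ?U" by (intro open_chart_image c openin_Int V W)
  have sY: "smooth_on ?U (Y a)" if "a \<in> Basis - I" for a
    unfolding Y_def by (rule smooth_on_subset[OF smooth_vf_rep[OF X[OF \<pi>k[OF that]] V(1) c]]) auto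
  have memN: "q \<in> N \<longleftrightarrow> (\<forall>a\<in>Basis - J. snd c q \<bullet> a = 0)" if "q \<in> fst c" for q
    using charts_image_iff[OF c that, of "fst c \<inter> N"] slice that by auto
  \<comment> \<open>The \<open>Y\<^sub>a\<close> are independent modulo the tangent space of \<open>N\<close>.\<close>
  have indep: "\<forall>a\<in>Basis - I. y a = 0"
    if q: "q \<in> fst c" "q \<in> V" "q \<in> N"
      and y: "\<forall>j\<in>Basis - J. (\<Sum>a\<in>Basis - I. y a *\<^sub>R Y a (snd c q)) \<bullet> j = 0" for q y
  proof -
    have e: "(\<Sum>a\<in>Basis - I. y a *\<^sub>R Y a (snd c q)) = vec_coord A c q (\<Sum>a\<in>Basis - I. y a *\<^sub>R X (\<pi> a) q)"
      by (simp add: Y_def vf_rep_chart[OF c q(1)] linear_sum[OF linear_vec_coord[OF c q(1)]]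
          linear_scale[OF linear_vec_coord[OF c q(1)]])
    have "(\<Sum>a\<in>Basis - I. y a *\<^sub>R X (\<pi> a) q) \<in> tangent_space A N q"
      using y unfolding e tangent_space_slice[OF c q(1,3) slice] by simp
    moreover have "(\<Sum>a\<in>Basis - I. y a *\<^sub>R X (\<pi> a) q) \<in> nb q"
      using basN[OF q(2,3)] unfolding basis_family_iff[OF fin(3)] by blast
    ultimately have "(\<Sum>a\<in>Basis - I. y a *\<^sub>R X (\<pi> a) q) = 0" using nbq(2)[OF q(3)] by blast
    then show ?thesis using basN[OF q(2,3)] unfolding basis_family_iff[OF fin(3)] by blast
  qed
  define \<psi> where "\<psi> z = (\<Sum>u\<in>I. (z \<bullet> u) *\<^sub>R \<sigma> u)" for z :: 'e
  define \<Psi> where "\<Psi> z = \<psi> z + (\<Sum>a\<in>Basis - I. (z \<bullet> a) *\<^sub>R Y a (\<psi> z))" for z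
  define \<Omega> where "\<Omega> = \<psi> -` ?U"
  have bl\<psi>: "bounded_linear \<psi>"
    unfolding \<psi>_def[abs_def]
    by (intro bounded_linear_sum bounded_linear_compose[OF bounded_linear_scaleR_left] bounded_linear_inner_left)
  have \<psi>J: "\<psi> z \<bullet> j = 0" if "j \<in> Basis - J" for z j
  proof -
    have "\<sigma> u \<bullet> j = 0" if "u \<in> I" for u
      using \<sigma> that \<open>j \<in> Basis - J\<close> J by (auto simp: bij_betw_def inner_Basis subset_iff)
    then show ?thesis by (simp add: \<psi>_def inner_sum_left)
  qed
  have \<psi>\<sigma>: "\<psi> z \<bullet> \<sigma> u = z \<bullet> u" if "u \<in> I" for z u
  proof -
    have "\<psi> z \<bullet> \<sigma> u = (\<Sum>u'\<in>I. if u' = u then z \<bullet> u' else 0)"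
      unfolding \<psi>_def inner_sum_left
    proof (rule sum.cong[OF refl])
      fix u' assume u': "u' \<in> I"
      have "\<sigma> u' = \<sigma> u \<longleftrightarrow> u' = u" using \<sigma> u' that by (auto simp: bij_betw_def inj_on_def)
      moreover have "\<sigma> u' \<in> Basis" "\<sigma> u \<in> Basis" using \<sigma> u' that J by (auto simp: bij_betw_def)
      ultimately show "(z \<bullet> u') *\<^sub>R \<sigma> u' \<bullet> \<sigma> u = (if u' = u then z \<bullet> u' else 0)"
        by (simp add: inner_Basis)
    qed
    then show ?thesis using that fin(1) by simp
  qed
  have o\<Omega>: "open \<Omega>"
    unfolding \<Omega>_def by (rule continuous_open_vimage[OF oU]) (use linear_continuous_at[OF bl\<psi>] in blast)
  have s\<psi>: "smooth_on \<Omega> \<psi>" by (rule smooth_on_bounded_linear[OF bl\<psi>])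
  have "smooth_on \<Omega> (Y a \<circ> \<psi>)" if "a \<in> Basis - I" for a
    by (rule smooth_on_compose[OF o\<Omega> oU _ s\<psi> sY[OF that]]) (auto simp: \<Omega>_def)
  then have s\<Psi>: "smooth_on \<Omega> \<Psi>"
    unfolding \<Psi>_def[abs_def]
    by (intro smooth_on_add smooth_on_sum smooth_on_scaleR o\<Omega> s\<psi>
        smooth_on_bounded_linear[OF bounded_linear_inner_left]) (simp add: o_def)
  have d\<Psi>: "frechet_derivative \<Psi> (at z) v = \<psi> v + (\<Sum>a\<in>Basis - I. (v \<bullet> a) *\<^sub>R Y a (\<psi> z))"
    if z: "z \<in> \<Omega>" "\<forall>a\<in>Basis - I. z \<bullet> a = 0" for z v
  proof -
    have zU: "\<psi> z \<in> ?U" using z(1) by (simp add: \<Omega>_def)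
    have dY: "((\<lambda>z. Y a (\<psi> z)) has_derivative (\<lambda>v. frechet_derivative (Y a) (at (\<psi> z)) (\<psi> v))) (at z)"
      if "a \<in> Basis - I" for a
      by (rule has_derivative_compose[OF bounded_linear_imp_has_derivative[OF bl\<psi>]
            smooth_on_has_derivative[OF sY[OF that] zU]])
    have "(\<Psi> has_derivative (\<lambda>v. \<psi> v + (\<Sum>a\<in>Basis - I.
       (z \<bullet> a) *\<^sub>R frechet_derivative (Y a) (at (\<psi> z)) (\<psi> v) + (v \<bullet> a) *\<^sub>R Y a (\<psi> z)))) (at z)"
      unfolding \<Psi>_def[abs_def]
      by (intro has_derivative_add has_derivative_sum bounded_bilinear.FDERIV[OF bounded_bilinear_scaleR] dY
          bounded_linear_imp_has_derivative[OF bl\<psi>] bounded_linear_imp_has_derivative[OF bounded_linear_inner_left])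
    then show ?thesis using z(2) by (simp add: frechet_derivative_eqI sum.distrib)
  qed
  define z0 where "z0 = (\<Sum>u\<in>I. (snd c p \<bullet> \<sigma> u) *\<^sub>R u)"
  have z0u: "z0 \<bullet> u = snd c p \<bullet> \<sigma> u" if "u \<in> I" for u
    using inner_sum_scaleR_Basis[OF I that] by (simp add: z0_def)
  have z0a: "z0 \<bullet> a = 0" if "a \<in> Basis - I" for a
  proof -
    have "u \<bullet> a = 0" if "u \<in> I" for u using that \<open>a \<in> Basis - I\<close> I by (auto simp: inner_Basis subset_iff)
    then show ?thesis by (simp add: z0_def inner_sum_left)
  qed
  have \<psi>z0: "\<psi> z0 = snd c p"
  proof (rule euclidean_eqI)
    fix j :: 'e assume j: "j \<in> Basis"
    show "\<psi> z0 \<bullet> j = snd c p \<bullet> j"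
    proof (cases "j \<in> J")
      case True
      then obtain u where u: "u \<in> I" "j = \<sigma> u" using \<sigma> by (auto simp: bij_betw_def)
      then show ?thesis using \<psi>\<sigma>[of u z0] z0u[of u] by simp
    next
      case False
      then show ?thesis using \<psi>J[of j z0] memN[OF pc] p j by auto
    qed
  qed
  have z0\<Omega>: "z0 \<in> \<Omega>" using pc V W by (auto simp: \<Omega>_def \<psi>z0)
  have \<Psi>0: "\<Psi> z = \<psi> z" if "\<forall>a\<in>Basis - I. z \<bullet> a = 0" for z
    using that by (simp add: \<Psi>_def)
  have lin: "linear (frechet_derivative \<Psi> (at z0))" by (rule smooth_on_linear_derivative[OF s\<Psi> z0\<Omega>])
  have "inj (frechet_derivative \<Psi> (at z0))"
    unfolding linear_injective_0[OF lin]
  proof (intro allI impI)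
    fix v assume "frechet_derivative \<Psi> (at z0) v = 0"
    then have e: "\<psi> v + (\<Sum>a\<in>Basis - I. (v \<bullet> a) *\<^sub>R Y a (snd c p)) = 0"
      using d\<Psi>[OF z0\<Omega>, of v] z0a by (simp add: \<psi>z0)
    then have "(\<Sum>a\<in>Basis - I. (v \<bullet> a) *\<^sub>R Y a (snd c p)) = - \<psi> v" by (simp add: add_eq_0_iff)
    then have a: "\<forall>a\<in>Basis - I. v \<bullet> a = 0"
      by (intro indep[OF pc V(2) p]) (simp add: \<psi>J)
    then have "\<psi> v = 0" using e by simp
    then have u: "v \<bullet> u = 0" if "u \<in> I" for u using \<psi>\<sigma>[OF that, of v] by simp
    show "v = 0"
    proof (rule euclidean_eqI)
      fix b :: 'e assume "b \<in> Basis"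
      then show "v \<bullet> b = 0 \<bullet> b" using a u[of b] by (cases "b \<in> I") simp_all
    qed
  qed
  from smooth_local_inverse[OF o\<Omega> s\<Psi> z0\<Omega> this]
  obtain U' V' g where U': "open U'" "U' \<subseteq> \<Omega>" "z0 \<in> U'" and V': "open V'" and hom: "homeomorphism U' V' \<Psi> g"
    and sg: "smooth_on V' g" by blast
  have "open (U' \<inter> \<Psi> -` ?U)"
    by (rule continuous_open_preimage[OF _ U'(1) oU])
      (rule continuous_on_subset[OF smooth_on_continuous[OF s\<Psi>] U'(2)])
  moreover have "z0 \<in> U' \<inter> \<Psi> -` ?U"
    using U'(3) \<Psi>0[of z0] z0a \<psi>z0 pc V W by auto
  ultimately obtain r where r: "0 < r" "ball z0 r \<subseteq> U' \<inter> \<Psi> -` ?U" by (meson openE)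
  define B where "B = ball z0 r"
  have BU: "z \<in> U'" "z \<in> \<Omega>" "\<Psi> z \<in> ?U" if "z \<in> B" for z using r(2) that U'(2) by (auto simp: B_def)
  have oB: "open B" and z0B: "z0 \<in> B" using r(1) by (auto simp: B_def)
  have g\<Psi>: "g (\<Psi> z) = z" "\<Psi> z \<in> V'" if "z \<in> B" for z
    using hom BU(1)[OF that] by (auto simp: homeomorphism_def)
  have "\<Psi> ` B = V' \<inter> g -` B"
  proof (intro equalityI subsetI)
    fix y assume y: "y \<in> V' \<inter> g -` B"
    then have "\<Psi> (g y) = y" using hom by (auto simp: homeomorphism_def)
    then show "y \<in> \<Psi> ` B" using y by (metis IntD2 image_eqI vimageD)
  qed (use g\<Psi> in auto)
  then have o\<Psi>B: "open (\<Psi> ` B)"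
    using continuous_open_preimage[OF smooth_on_continuous[OF sg] V' oB] by simp
  have s\<Psi>B: "smooth_on B \<Psi>" by (rule smooth_on_subset[OF s\<Psi>]) (use BU in blast)
  have \<Psi>Bc: "\<Psi> ` B \<subseteq> snd c ` fst c" using BU(3) by blast
  define d where "d = ({q \<in> fst c. snd c q \<in> \<Psi> ` B}, g \<circ> snd c)"
  have \<Psi>BV: "\<Psi> ` B \<subseteq> V'" using g\<Psi> by blast
  note rep0 = reparametrized_chart[OF c oB s\<Psi>B \<Psi>Bc o\<Psi>B V' \<Psi>BV sg, folded d_def]
  have dA: "d \<in> charts A" and imd: "snd d ` fst d = B"
    by (rule rep0, erule g\<Psi>)+
  have rep: "chart_inv d z = chart_inv c (\<Psi> z)" "chart_inv c (\<Psi> z) \<in> fst d"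
    "snd c (chart_inv c (\<Psi> z)) = \<Psi> z" if "z \<in> B" for z
    by (rule rep0, erule g\<Psi>, rule that)+
  define K where "K z = chart_inv c (\<Psi> z)" for z
  have K: "K z \<in> fst d" "snd c (K z) = \<Psi> z" "K z \<in> fst c" "snd d (K z) = z" "K z \<in> V" "K z \<in> W" if z: "z \<in> B" for z
  proof -
    show 1: "K z \<in> fst d" and 2: "snd c (K z) = \<Psi> z"
      using rep(2,3)[OF z] by (simp_all add: K_def)
    show 3: "K z \<in> fst c" using 1 by (simp add: d_def)
    show "snd d (K z) = z" using 2 g\<Psi>(1)[OF z] by (simp add: d_def)
    show "K z \<in> V" "K z \<in> W"
      using BU(3)[OF z] charts_image_iff[OF c 3, of "fst c \<inter> (V \<inter> W)"] 2 by auto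
  qed
  have fd: "\<exists>z\<in>B. q = K z" if q: "q \<in> fst d" for q
  proof -
    obtain z where "z \<in> B" "snd c q = \<Psi> z" "q \<in> fst c" using q by (auto simp: d_def)
    then show ?thesis using charts_inv_left[OF c, of q] by (auto simp: K_def)
  qed
  have KN: "K z \<in> N \<longleftrightarrow> (\<forall>a\<in>Basis - I. z \<bullet> a = 0)" if z: "z \<in> B" for z
  proof
    assume "\<forall>a\<in>Basis - I. z \<bullet> a = 0"
    then show "K z \<in> N" using memN[OF K(3)[OF z]] \<psi>J by (simp add: K(2)[OF z] \<Psi>0)
  next
    assume "K z \<in> N"
    then have J0: "\<forall>j\<in>Basis - J. \<Psi> z \<bullet> j = 0" using memN[OF K(3)[OF z]] by (simp add: K(2)[OF z])
    obtain q where q: "q \<in> fst c" "q \<in> V" "\<psi> z = snd c q" using BU(2)[OF z] by (auto simp: \<Omega>_def)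
    have "q \<in> N" using memN[OF q(1)] \<psi>J[of _ z] by (simp add: q(3))
    then show "\<forall>a\<in>Basis - I. z \<bullet> a = 0"
      using J0 \<psi>J[of _ z]
      by (intro indep[OF q(1,2)]) (auto simp: \<Psi>_def inner_add_left q(3)[symmetric])
  qed
  have "adapted_chart A I N nb d"
    unfolding adapted_chart_def imd
  proof (intro conjI ballI dA)
    show sl: "snd d ` (fst d \<inter> N) = {z \<in> B. \<forall>a\<in>Basis - I. z \<bullet> a = 0}"
    proof (intro equalityI subsetI)
      fix x assume "x \<in> snd d ` (fst d \<inter> N)"
      then obtain q where q: "q \<in> fst d" "q \<in> N" "x = snd d q" by blast
      obtain z where z: "z \<in> B" "q = K z" using fd[OF q(1)] by blast
      show "x \<in> {z \<in> B. \<forall>a\<in>Basis - I. z \<bullet> a = 0}" using q z K(4)[OF z(1)] KN[OF z(1)] by simp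
    next
      fix z assume "z \<in> {z \<in> B. \<forall>a\<in>Basis - I. z \<bullet> a = 0}"
      then have z: "z \<in> B" "K z \<in> N" using KN by auto
      then show "z \<in> snd d ` (fst d \<inter> N)" using K(1,4)[OF z(1)] by (intro image_eqI[of _ _ "K z"]) auto
    qed
    fix q assume "q \<in> fst d \<inter> N"
    then have q: "q \<in> fst d" "q \<in> N" by auto
    have "snd d ` (fst d \<inter> N) = {z \<in> snd d ` fst d. \<forall>a\<in>Basis - I. z \<bullet> a = 0}" using sl imd by simp
    from tangent_space_slice[OF dA q this]
    show "tangent_space A N q = span (vec_of_coord A d q ` I)"
      unfolding span_vec_of_coord_iff[OF dA q(1) I] .
    obtain z where z: "z \<in> B" "q = K z" using fd[OF q(1)] by blast
    have za: "\<forall>a\<in>Basis - I. z \<bullet> a = 0" using KN[OF z(1)] q z by simp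
    have qc: "q \<in> fst c" "snd c q = \<psi> z" "snd d q = z" "q \<in> V"
      using K[OF z(1)] \<Psi>0[OF za] by (simp_all add: z(2))
    have "(\<Psi> has_derivative frechet_derivative \<Psi> (at z)) (at z)"
      by (rule smooth_on_has_derivative[OF s\<Psi>B z(1)])
    then have "(transit d c has_derivative frechet_derivative \<Psi> (at z)) (at z)"
      by (rule has_derivative_transform_within_open[OF _ oB z(1)]) (simp add: rep(1,3))
    then have Dt: "Dtransit d c z = frechet_derivative \<Psi> (at z)" by (rule frechet_derivative_eqI)
    have "vec_of_coord A d q a = X (\<pi> a) q" if a: "a \<in> Basis - I" for a
    proof -
      have "\<psi> a = 0" unfolding \<psi>_def
        using a I by (intro sum.neutral) (auto simp: inner_Basis subset_iff)
      moreover have "(\<Sum>b\<in>Basis - I. (a \<bullet> b) *\<^sub>R Y b (\<psi> z)) = Y a (\<psi> z)"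
      proof -
        have "(\<Sum>b\<in>Basis - I. (a \<bullet> b) *\<^sub>R Y b (\<psi> z)) = (\<Sum>b\<in>Basis - I. if b = a then Y b (\<psi> z) else 0)"
          using a by (intro sum.cong) (auto simp: inner_Basis)
        then show ?thesis using a fin(3) by simp
      qed
      ultimately have "Dtransit d c z a = vec_coord A c q (X (\<pi> a) q)"
        unfolding Dt d\<Psi>[OF BU(2)[OF z(1)] za] Y_def qc(2)[symmetric] vf_rep_chart[OF c qc(1)] by simp
      then show ?thesis
        using vec_of_coord_change[OF dA q(1) c qc(1), of a] vec_of_coord_coord[OF c qc(1)] qc(3) by simp
    qed
    then have "vec_of_coord A d q ` (Basis - I) = (\<lambda>a. X (\<pi> a) q) ` (Basis - I)" by (rule image_cong[OF refl])
    then show "nb q = span (vec_of_coord A d q ` (Basis - I))"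
      using basN[OF qc(4) q(2)] by (simp add: basis_family_def)
  next
    fix z and t :: real assume z: "z \<in> B" and t: "t \<in> {0..1}"
    have xu: "x_part I v \<bullet> b = (if b \<in> I then v \<bullet> b else 0)" if "b \<in> Basis" for v b
    proof (cases "b \<in> I")
      case True
      then show ?thesis using inner_sum_scaleR_Basis[OF I True] by (simp add: x_part_def)
    next
      case False
      have "(\<Sum>u\<in>I. (v \<bullet> u) *\<^sub>R u \<bullet> b) = 0"
        using False that I by (intro sum.neutral) (auto simp: inner_Basis subset_iff)
      then show ?thesis using False by (simp add: x_part_def inner_sum_left)
    qed
    \<comment> \<open>The centre \<open>z0\<close> has \<open>y = 0\<close>, so projecting to \<open>y = 0\<close> does not increase the distance to it.\<close>
    have "norm (x_part I z - z0) \<le> norm (z - z0)"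
    proof (rule norm_le_componentwise)
      fix b :: 'e assume b: "b \<in> Basis"
      show "\<bar>(x_part I z - z0) \<bullet> b\<bar> \<le> \<bar>(z - z0) \<bullet> b\<bar>"
        using xu[OF b, of z] z0a[of b] b by (cases "b \<in> I") (auto simp: inner_diff_left)
    qed
    then have "x_part I z \<in> B" using z by (simp add: B_def dist_norm norm_minus_commute)
    moreover have "convex B" by (simp add: B_def)
    ultimately have "(1 - t) *\<^sub>R x_part I z + t *\<^sub>R z \<in> B"
      using z t by (intro convexD) auto
    then show "x_part I z + t *\<^sub>R (z - x_part I z) \<in> B" by (simp add: algebra_simps)
  qed
  moreover have "p \<in> fst d"
  proof -
    have "K z0 = p" using \<Psi>0[of z0] z0a by (simp add: K_def \<psi>z0 charts_inv_left[OF c pc])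
    then show ?thesis using K(1)[OF z0B] by simp
  qed
  moreover have "fst d \<subseteq> W" using fd K(6) by blast
  ultimately show ?thesis by blast
qed

lemma Basis_frame_exists:
  assumes D: "dirac_structure A D" and p: "p \<in> points A"
  shows "\<exists>V (s :: 'e \<Rightarrow> 'p \<Rightarrow> 'e big_fibre). openin (manifold_topology A) V \<and> p \<in> V \<and>
     (\<forall>W\<subseteq>V. local_frame A D W Basis s)"
proof -
  obtain V k s where V: "openin (manifold_topology A) V" "p \<in> V" and s: "local_frame A D V {..<k::nat} s"
    using D p unfolding dirac_structure_def vector_subbundle_def by blast
  have "basis_family {..<k} (\<lambda>i. s i p) (D p)" "maximal_g_isotropic (D p)"
    using s V D p by (auto simp: local_frame_def dirac_structure_def)
  then have "card {..<k} = DIM('e)" using maximal_g_isotropic_card_basis by blast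
  then obtain \<pi> where \<pi>: "bij_betw \<pi> (Basis :: 'e set) {..<k}"
    using finite_same_card_bij[OF finite_Basis, of "{..<k}"] by auto
  have "local_frame A D W Basis (\<lambda>i. s (\<pi> i))" if W: "W \<subseteq> V" for W
    unfolding local_frame_def
  proof (intro conjI ballI)
    fix i :: 'e assume "i \<in> Basis"
    then have "is_section A D V (s (\<pi> i))" using s \<pi> by (auto simp: local_frame_def bij_betw_def)
    then show "is_section A D W (s (\<pi> i))"
      using W unfolding is_section_def smooth_vf_def smooth_form_def
      by (meson Int_mono image_mono order_refl smooth_on_subset subsetD)
  next
    fix q assume "q \<in> W"
    then have "basis_family {..<k} (\<lambda>i. s i q) (D q)" using s W by (auto simp: local_frame_def)
    from basis_family_reindex[OF \<pi> this] show "basis_family Basis (\<lambda>i. s (\<pi> i) q) (D q)" by (simp add: o_def)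
  qed
  then show ?thesis using V by blast
qed

text \<open>
  Every frame is a split basis, with \<open>B = C\<close> its vectors and \<open>\<epsilon> = \<tau>\<close> its covectors. Hence the implications
  for all split bases are the implications for all frames.
\<close>

lemma split_basis_systems_iff:
  fixes c :: "('p, 'e) chart"
  assumes I: "I \<subseteq> Basis" and c: "adapted_chart A I N nb c"
  shows "(\<forall>B \<epsilon> C \<tau>. split_basis A D I (fst c) B \<epsilon> C \<tau> \<longrightarrow>
        (\<forall>z\<in>snd c ` (fst c \<inter> N). \<forall>lam \<nu> \<mu> \<xi>. P (system_T A c I B C z lam \<nu> \<mu> \<xi>) (system_A A c I \<epsilon> \<tau> z lam \<nu> \<mu> \<xi>))) \<longleftrightarrow>
     (\<forall>s. local_frame A D (fst c) Basis (s :: 'e \<Rightarrow> 'p \<Rightarrow> 'e big_fibre) \<longrightarrow>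
        (\<forall>p\<in>fst c \<inter> N. \<forall>lam \<mu>. P (vf_jet_system A c I s (snd c p) lam \<mu>)
           (form_jet_system A c I s (snd c p) lam \<mu>)))"
    (is "?l \<longleftrightarrow> ?r")
proof -
  have cA: "c \<in> charts A" using c by (simp add: adapted_chart_def)
  show ?thesis
  proof
    assume l: ?l
    show ?r
    proof (intro allI impI ballI)
      fix s :: "'e \<Rightarrow> 'p \<Rightarrow> 'e big_fibre" and p lam \<mu>
      assume s: "local_frame A D (fst c) Basis s" and p: "p \<in> fst c \<inter> N"
      let ?B = "\<lambda>i p. fst (s i p)" and ?\<epsilon> = "\<lambda>i p. snd (s i p)"
      have ss: "(\<lambda>i p. if i \<in> I then (?B i p, ?\<epsilon> i p) else (?B i p, ?\<epsilon> i p)) = s" by auto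
      have sb: "split_basis A D I (fst c) ?B ?\<epsilon> ?B ?\<epsilon>" unfolding split_basis_def ss by (rule s)
      have z: "snd c p \<in> snd c ` fst c" using p by blast
      have if_same: "(\<lambda>i. if i \<in> I then lam i else lam i) = lam" for lam :: "'e \<Rightarrow> real" by auto
      have s': "local_frame A D (fst c) Basis (\<lambda>i p. if i \<in> I then (?B i p, ?\<epsilon> i p) else (?B i p, ?\<epsilon> i p))"
        unfolding ss by (rule s)
      have "P (system_T A c I ?B ?B (snd c p) lam lam \<mu> \<mu>) (system_A A c I ?\<epsilon> ?\<epsilon> (snd c p) lam lam \<mu> \<mu>)"
        using l sb p by blast
      then show "P (vf_jet_system A c I s (snd c p) lam \<mu>)
           (form_jet_system A c I s (snd c p) lam \<mu>)"
        unfolding system_iff_jet_system[OF I cA s' z] ss if_same .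
    qed
  next
    assume r: ?r
    show ?l
    proof (intro allI impI ballI)
      fix B \<epsilon> C \<tau> z lam \<nu> \<mu> \<xi>
      assume sb: "split_basis A D I (fst c) B \<epsilon> C \<tau>" and "z \<in> snd c ` (fst c \<inter> N)"
      then obtain p where p: "p \<in> fst c \<inter> N" "z = snd c p" by blast
      note s = sb[unfolded split_basis_def]
      have z: "snd c p \<in> snd c ` fst c" using p by blast
      show "P (system_T A c I B C z lam \<nu> \<mu> \<xi>) (system_A A c I \<epsilon> \<tau> z lam \<nu> \<mu> \<xi>)"
        unfolding p(2) system_iff_jet_system[OF I cA s z] using r s p(1) by blast
    qed
  qed
qed

text \<open>
  Adapted charts with a frame of \<open>D\<close> on their domain exist around every point of \<open>N\<close>. They make the total
  space embedded, and reduce both sides to the implications between the systems.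
\<close>

lemma normal_bundle_iff_systems:
  assumes D: "dirac_structure A D" and I: "I \<subseteq> Basis" and emb: "embedded_submanifold A (card I) N"
    and nb: "normal_bundle A N nb"
    and P: "P = (\<lambda>x y. x \<longrightarrow> y) \<or> P = (\<lambda>x y. y \<longrightarrow> x)"
  shows "(\<exists>k. embedded_submanifold (tangent_atlas A) k (Sigma N nb)) \<and>
     (\<forall>q\<in>Sigma N nb. \<forall>X \<theta>. (X, \<theta>) \<in> tangent_dirac A D q \<longrightarrow>
       P (X \<in> tangent_space (tangent_atlas A) (Sigma N nb) q)
         (\<theta> \<in> ann (tangent_space (tangent_atlas A) (Sigma N nb) q))) \<longleftrightarrow>
     (\<forall>p\<in>N. (\<exists>c B \<epsilon> C \<tau>. adapted_chart A I N nb c \<and> p \<in> fst c \<and> split_basis A D I (fst c) B \<epsilon> C \<tau>) \<and>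
      (\<forall>c B \<epsilon> C \<tau>. adapted_chart A I N nb c \<and> p \<in> fst c \<and> split_basis A D I (fst c) B \<epsilon> C \<tau> \<longrightarrow>
               (\<forall>z\<in>snd c ` (fst c \<inter> N). \<forall>lam \<nu> \<mu> \<xi>.
                  P (system_T A c I B C z lam \<nu> \<mu> \<xi>) (system_A A c I \<epsilon> \<tau> z lam \<nu> \<mu> \<xi>))))"
    (is "?e \<and> ?l \<longleftrightarrow> ?r")
proof -
  have iso: "maximal_g_isotropic (D q)" if "q \<in> points A" for q
    using D that by (simp add: dirac_structure_def)
  have N: "N \<subseteq> points A" using emb by (simp add: embedded_submanifold_def)
  have ex: "\<exists>c s. adapted_chart A I N nb c \<and> p \<in> fst c \<and> local_frame A D (fst c) Basis (s :: 'e \<Rightarrow> 'p \<Rightarrow> 'e big_fibre)"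
    if p: "p \<in> N" for p
  proof -
    have pA: "p \<in> points A" using N p by blast
    obtain V and s :: "'e \<Rightarrow> 'p \<Rightarrow> 'e big_fibre" where V: "openin (manifold_topology A) V" "p \<in> V"
      and s: "\<And>W. W \<subseteq> V \<Longrightarrow> local_frame A D W Basis s"
      using Basis_frame_exists[OF D pA] by blast
    obtain c where "adapted_chart A I N nb c" "p \<in> fst c" "fst c \<subseteq> V"
      using adapted_chart_exists[OF emb I nb p V] by blast
    then show ?thesis using s by blast
  qed
  have exs: "\<exists>c B \<epsilon> C \<tau>. adapted_chart A I N nb c \<and> p \<in> fst c \<and> split_basis A D I (fst c) B \<epsilon> C \<tau>"
    if p: "p \<in> N" for p
  proof -
    obtain c and s :: "'e \<Rightarrow> 'p \<Rightarrow> 'e big_fibre" where c: "adapted_chart A I N nb c" "p \<in> fst c"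
      and s: "local_frame A D (fst c) Basis s" using ex[OF p] by blast
    let ?B = "\<lambda>i p. fst (s i p)" and ?\<epsilon> = "\<lambda>i p. snd (s i p)"
    have "(\<lambda>i p. if i \<in> I then (?B i p, ?\<epsilon> i p) else (?B i p, ?\<epsilon> i p)) = s" by auto
    then have "split_basis A D I (fst c) ?B ?\<epsilon> ?B ?\<epsilon>" unfolding split_basis_def using s by simp
    then show ?thesis using c by blast
  qed
  have emb: ?e using embedded_normal_bundle[OF N I, of nb] ex by blast
  have "?r \<longleftrightarrow>
     (\<forall>c s. adapted_chart A I N nb c \<and> local_frame A D (fst c) Basis (s :: 'e \<Rightarrow> 'p \<Rightarrow> 'e big_fibre) \<longrightarrow>
       (\<forall>p\<in>fst c \<inter> N. \<forall>lam \<mu>.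
          P (vf_jet_system A c I s (snd c p) lam \<mu>) (form_jet_system A c I s (snd c p) lam \<mu>)))"
    (is "_ \<longleftrightarrow> ?j")
  proof
    assume l: ?r
    show ?j
    proof (intro allI impI, elim conjE)
      fix c and s :: "'e \<Rightarrow> 'p \<Rightarrow> 'e big_fibre"
      assume c: "adapted_chart A I N nb c" and s: "local_frame A D (fst c) Basis s"
      show "\<forall>p\<in>fst c \<inter> N. \<forall>lam \<mu>. P (vf_jet_system A c I s (snd c p) lam \<mu>)
          (form_jet_system A c I s (snd c p) lam \<mu>)"
      proof (cases "fst c \<inter> N = {}")
        case False
        then obtain p where p: "p \<in> fst c" "p \<in> N" by blast
        then have "\<forall>B \<epsilon> C \<tau>. split_basis A D I (fst c) B \<epsilon> C \<tau> \<longrightarrow>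
               (\<forall>z\<in>snd c ` (fst c \<inter> N). \<forall>lam \<nu> \<mu> \<xi>.
                  P (system_T A c I B C z lam \<nu> \<mu> \<xi>) (system_A A c I \<epsilon> \<tau> z lam \<nu> \<mu> \<xi>))"
          using l c by blast
        then show ?thesis unfolding split_basis_systems_iff[OF I c] using s by blast
      qed simp
    qed
  next
    assume r: ?j
    have "\<forall>B \<epsilon> C \<tau>. split_basis A D I (fst c) B \<epsilon> C \<tau> \<longrightarrow>
               (\<forall>z\<in>snd c ` (fst c \<inter> N). \<forall>lam \<nu> \<mu> \<xi>.
                  P (system_T A c I B C z lam \<nu> \<mu> \<xi>) (system_A A c I \<epsilon> \<tau> z lam \<nu> \<mu> \<xi>))"
      if c: "adapted_chart A I N nb c" for c
      unfolding split_basis_systems_iff[OF I c] using r c by blast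
    then show ?r using exs by blast
  qed
  then show ?thesis
    using emb tangent_dirac_iff_jet_systems[OF iso I ex P] by blast
qed

end

theorem proposition4p1:
  fixes A :: "('p, 'e::euclidean_space) chart set"
    and D :: "'p \<Rightarrow> 'e big_fibre set"
    and N :: "'p set"
    and I :: "'e set"
  assumes "smooth_manifold A"
    and "dirac_structure A D"
    and "I \<subseteq> Basis"
    and "embedded_submanifold A (card I) N"
  shows
    "((\<exists>nb. normal_bundle A N nb \<and>
         coisotropic_submanifold (tangent_atlas A) (tangent_dirac A D) (Sigma N nb)) \<longleftrightarrow>
      (\<exists>nb. normal_bundle A N nb \<and>
         (\<forall>p\<in>N.
            (\<exists>c B \<epsilon> C \<tau>. adapted_chart A I N nb c \<and> p \<in> fst c \<and> split_basis A D I (fst c) B \<epsilon> C \<tau>) \<and>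
            (\<forall>c B \<epsilon> C \<tau>. adapted_chart A I N nb c \<and> p \<in> fst c \<and> split_basis A D I (fst c) B \<epsilon> C \<tau> \<longrightarrow>
               (\<forall>z\<in>snd c ` (fst c \<inter> N). \<forall>lam \<nu> \<mu> \<xi>.
                  system_A A c I \<epsilon> \<tau> z lam \<nu> \<mu> \<xi> \<longrightarrow> system_T A c I B C z lam \<nu> \<mu> \<xi>)))))
     \<and>
     ((\<exists>nb. normal_bundle A N nb \<and>
         isotropic_submanifold (tangent_atlas A) (tangent_dirac A D) (Sigma N nb)) \<longleftrightarrow>
      (\<exists>nb. normal_bundle A N nb \<and>
         (\<forall>p\<in>N.
            (\<exists>c B \<epsilon> C \<tau>. adapted_chart A I N nb c \<and> p \<in> fst c \<and> split_basis A D I (fst c) B \<epsilon> C \<tau>) \<and>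
            (\<forall>c B \<epsilon> C \<tau>. adapted_chart A I N nb c \<and> p \<in> fst c \<and> split_basis A D I (fst c) B \<epsilon> C \<tau> \<longrightarrow>
               (\<forall>z\<in>snd c ` (fst c \<inter> N). \<forall>lam \<nu> \<mu> \<xi>.
                  system_T A c I B C z lam \<nu> \<mu> \<xi> \<longrightarrow> system_A A c I \<epsilon> \<tau> z lam \<nu> \<mu> \<xi>)))))"
proof -
  interpret atlas A
    by (rule atlas.intro) (use assms(1) in \<open>simp add: smooth_manifold_def\<close>)
  have co: "coisotropic_submanifold TA TD Q \<longleftrightarrow> (\<exists>k. embedded_submanifold TA k Q) \<and>
     (\<forall>q\<in>Q. \<forall>X \<theta>. (X, \<theta>) \<in> TD q \<longrightarrow> (\<theta> \<in> ann (tangent_space TA Q q) \<longrightarrow> X \<in> tangent_space TA Q q))"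
    and isot: "isotropic_submanifold TA TD Q \<longleftrightarrow> (\<exists>k. embedded_submanifold TA k Q) \<and>
     (\<forall>q\<in>Q. \<forall>X \<theta>. (X, \<theta>) \<in> TD q \<longrightarrow> (X \<in> tangent_space TA Q q \<longrightarrow> \<theta> \<in> ann (tangent_space TA Q q)))"
    for TA :: "('p \<times> 'e, 'e \<times> 'e) chart set" and TD Q
    unfolding coisotropic_submanifold_def isotropic_submanifold_def by blast+
  note iff = normal_bundle_iff_systems[OF assms(2,3,4)]
  show ?thesis
    unfolding co isot
    by (intro conjI arg_cong[where f = Ex] ext conj_cong refl;
        rule iff[where P = "\<lambda>x y. y \<longrightarrow> x"] iff[where P = "\<lambda>x y. x \<longrightarrow> y"]; simp)
qed

end
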